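(* Let $\sigma$ be an invertible ergodic measure-preserving transformation of a probability space $(\Omega,\mathbb P)$. Let $a$ and $b$ be non-zero measurable functions from $\Omega$ to $[0,1]$, and for each $\omega\in\Omega$ and $\epsilon\in(0,1)$ let $T^\epsilon_\omega=T_{\epsilon a(\omega),\epsilon b(\omega)}$ (paired tent map), with Perron--Frobenius operator $\mathcal L^\epsilon_\omega$. Let $\lambda_k^\epsilon(\omega)$ denote the $k$-th Lyapunov exponent of the cocycle $\mathcal L^{\epsilon(n)}_\omega$ acting on $\mathrm{BV}$. Then, as $\epsilon\to0$, the leading two Lyapunov exponents of the cocycle are $\lambda_1^\epsilon=0$ and $$\lambda_2^\epsilon=-\epsilon\int_\Omega (a(\omega)+b(\omega))\,d\mathbb P(\omega)+O(\epsilon^2|\log\epsilon|).$$ Furthermore, $\lambda_1^\epsilon$ and $\lambda_2^\epsilon$ have multiplicity one, and the remainder of the Lyapunov spectrum is bounded above by $-\log 2+O\big(\log\log\tfrac1\epsilon/\log\tfrac1\epsilon\big)$. Explicitly: there are $C,\epsilon_0>0$ such that for every $\epsilon\in(0,\epsilon_0)$ and for $\mathbb P$-a.e. $\omega\in\Omega$: $\lambda_1^\epsilon(\omega)=0$; $\big|\lambda_2^\epsilon(\omega)+\epsilon\int(a+b)\,d\mathbb P\big|\le C\epsilon^2|\log\epsilon|$; $\lambda_k^\epsilon(\omega)\le-\log2+C\log\log\tfrac1\epsilon/\log\tfrac1\epsilon$ for all $k\ge3$; and $\lambda_1^\epsilon(\omega)>\lambda_2^\epsilon(\omega)>\lamb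da_3^\epsilon(\omega)$.
   Context: For $0\le a,b\le1$, the paired tent map $T_{a,b}:[-1,1]\to[-1,1]$ is $$T_{a,b}(x)=\begin{cases}2(1+b)(x+1)-1,& x\in[-1,-1/2],\\ -2(1+b)x-1,& x\in[-1/2,0),\\ 0,&x=0,\\ -2(1+a)x+1,&x\in(0,1/2],\\ 2(1+a)(x-1)+1,&x\in[1/2,1].\end{cases}$$ The Perron--Frobenius operator $\mathcal L$ of $T$ is defined by $\int (\mathcal L f)\,g\,dm=\int f\cdot (g\circ T)\,dm$ for $f\in L^1([-1,1])$, $g\in L^\infty([-1,1])$, with $m$ Lebesgue measure. The cocycle is $\mathcal L^{\epsilon(n)}_\omega=\mathcal L^\epsilon_{\sigma^{n-1}\omega}\circ\cdots\circ\mathcal L^\epsilon_{\omega}$. $\mathrm{BV}$ is the Banach space of real functions of bounded variation on $[-1,1]$ (identified when equal almost everywhere), with norm $\|f\|_{\mathrm{BV}}=\max(\operatorname{var}_{0^c}f,\|f\|_1)$, where $\operatorname{var}_{0^c}f=\operatorname{var}_{[-1,0)}f+\operatorname{var}_{(0,1]}f$ and $\|f\|_1=\int_{[-1,1]}|f|\,dm$. (This norm is equivalent to the standard one.) The $k$-th Lyapunov exponent (counted with multiplicity) is $$\lambda_k^\epsilon(\omega)=\sup_{V\in\mathcal G_k(\mathrm{BV})}\ \inf_{f\in V\setminus\{0\}}\ \limsup_{n\to\infty}\tfrac1n\log\|\mathcal L^{\epsilon(n)}_\omega f\|_{\mathrm{BV}},$$ where $\mathcal G_k(\mathrm{BV})$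 is the set of $k$-dimensional subspaces of $\mathrm{BV}$ (with $\log0=-\infty$). "Non-zero" for $a$ and $b$ means not $\mathbb P$-almost everywhere equal to $0$. *)

theory Defs
  imports "HOL-Probability.Probability"
begin

definition paired_tent :: "real \<Rightarrow> real \<Rightarrow> real \<Rightarrow> real" where
  "paired_tent a b x =
     (if x \<le> - 1 / 2 then 2 * (1 + b) * (x + 1) - 1
      else if x < 0 then - 2 * (1 + b) * x - 1
      else if x = 0 then 0
      else if x \<le> 1 / 2 then - 2 * (1 + a) * x + 1
      else 2 * (1 + a) * (x - 1) + 1)"

text \<open>Lebesgue measure on the Borel subsets of \<open>[-1,1]\<close>. Every Lebesgue measurable function
  agrees almost everywhere with a Borel measurable one, so passing to the Borel sets changes
  neither \<open>L\<^sup>1\<close> nor \<open>L\<^sup>\<infinity>\<close>.\<close>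

definition leb :: "real measure" where
  "leb = restrict_space lborel {-1..1}"

quotient_type l1 = "real \<Rightarrow> real" / partial:
  "\<lambda>f g. integrable leb f \<and> integrable leb g \<and> (AE x in leb. f x = g x)"
  morphisms rep_l1 abs_l1
proof (rule part_equivpI)
  show "\<exists>f. integrable leb f \<and> integrable leb f \<and> (AE x in leb. f x = (f x :: real))"
    by (rule exI[of _ "\<lambda>_. 0"]) simp
qed (auto intro!: sympI transpI elim: AE_mp)

instantiation l1 :: real_normed_vector
begin

lift_definition zero_l1 :: l1 is "\<lambda>_. 0" by simp

lift_definition plus_l1 :: "l1 \<Rightarrow> l1 \<Rightarrow> l1" is "\<lambda>f g x. f x + g x"
  by (auto elim: AE_mp)

lift_definition uminus_l1 :: "l1 \<Rightarrow> l1" is "\<lambda>f x. - f x"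
  by (auto elim: AE_mp)

lift_definition minus_l1 :: "l1 \<Rightarrow> l1 \<Rightarrow> l1" is "\<lambda>f g x. f x - g x"
  by (auto elim: AE_mp)

lift_definition scaleR_l1 :: "real \<Rightarrow> l1 \<Rightarrow> l1" is "\<lambda>c f x. c * f x"
  by (auto elim: AE_mp)

lift_definition norm_l1 :: "l1 \<Rightarrow> real" is "\<lambda>f. LINT x|leb. \<bar>f x\<bar>"
  by (rule integral_cong_AE) (auto elim: AE_mp)

definition "sgn_l1 (f :: l1) = inverse (norm f) *\<^sub>R f"
definition "dist_l1 (f :: l1) g = norm (f - g)"
definition "uniformity_l1 =
  (INF e\<in>{0 <..}. principal {(f :: l1, g). dist f g < e})"
definition "open_l1 (U :: l1 set) \<longleftrightarrow>
  (\<forall>f\<in>U. eventually (\<lambda>(f', g). f' = f \<longrightarrow> g \<in> U) uniformity)"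

instance
proof
  fix f g h :: l1 and c d :: real
  show "f + g + h = f + (g + h)" by transfer (auto simp: algebra_simps)
  show "f + g = g + f" by transfer (auto simp: algebra_simps)
  show "0 + f = f" by transfer auto
  show "- f + f = 0" by transfer auto
  show "f - g = f + - g" by transfer auto
  show "c *\<^sub>R (f + g) = c *\<^sub>R f + c *\<^sub>R g" by transfer (auto simp: algebra_simps)
  show "(c + d) *\<^sub>R f = c *\<^sub>R f + d *\<^sub>R f" by transfer (auto simp: algebra_simps)
  show "c *\<^sub>R d *\<^sub>R f = (c * d) *\<^sub>R f" by transfer (auto simp: algebra_simps)
  show "1 *\<^sub>R f = f" by transfer auto
  show "norm f = 0 \<longleftrightarrow> f = 0"
    by transfer (subst integral_nonneg_eq_0_iff_AE; auto)
  show "norm (c *\<^sub>R f) = \<bar>c\<bar> * norm f" by transfer (auto simp: abs_mult)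
  show "norm (f + g) \<le> norm f + norm g"
  proof transfer
    fix f g :: "real \<Rightarrow> real"
    assume "integrable leb f \<and> integrable leb f \<and> (AE x in leb. f x = f x)"
      and "integrable leb g \<and> integrable leb g \<and> (AE x in leb. g x = g x)"
    then have "(LINT x|leb. \<bar>f x + g x\<bar>) \<le> (LINT x|leb. \<bar>f x\<bar> + \<bar>g x\<bar>)"
      by (intro integral_mono) auto
    then show "(LINT x|leb. \<bar>f x + g x\<bar>) \<le> (LINT x|leb. \<bar>f x\<bar>) + (LINT x|leb. \<bar>g x\<bar>)"
      using \<open>integrable leb f \<and> _\<close> \<open>integrable leb g \<and> _\<close> by simp
  qed
qed (fact sgn_l1_def dist_l1_def uniformity_l1_def open_l1_def)+

end

definition representatives :: "l1 \<Rightarrow> (real \<Rightarrow> real) set" where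
  "representatives f = {u. integrable leb u \<and> abs_l1 u = f}"

definition linfty :: "(real \<Rightarrow> real) set" where
  "linfty = {g \<in> borel_measurable leb. \<exists>C. AE x in leb. \<bar>g x\<bar> \<le> C}"

text \<open>If \<open>T\<close> is measurable and non-singular, the function \<open>h\<close> below exists and is unique; neither
  integral depends on the choice of representatives.\<close>

definition perron_frobenius :: "(real \<Rightarrow> real) \<Rightarrow> l1 \<Rightarrow> l1" where
  "perron_frobenius T f =
     (THE h. \<forall>g\<in>linfty. (LINT x|leb. rep_l1 h x * g x) = (LINT x|leb. rep_l1 f x * g (T x)))"

definition variation_on :: "real set \<Rightarrow> (real \<Rightarrow> real) \<Rightarrow> ennreal" where
  "variation_on S u =
     (SUP xs\<in>{xs. sorted xs \<and> set xs \<subseteq> S}.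
        ennreal (\<Sum>i<length xs - 1. \<bar>u (xs ! Suc i) - u (xs ! i)\<bar>))"

definition BV :: "l1 set" where
  "BV = {f. \<exists>u\<in>representatives f. variation_on {-1..1} u < \<infinity>}"

text \<open>Elements of \<open>BV\<close> are classes modulo null sets, so their variation is the least one among
  all representatives.\<close>

definition var0c :: "l1 \<Rightarrow> ennreal" where
  "var0c f = (INF u\<in>representatives f. variation_on {-1..<0} u + variation_on {0<..1} u)"

definition bv_norm :: "l1 \<Rightarrow> ennreal" where
  "bv_norm f = max (var0c f) (ennreal (norm f))"

definition ln_ennreal :: "ennreal \<Rightarrow> ereal" where
  "ln_ennreal x =
     (if x = 0 then - \<infinity> else if x = \<infinity> then \<infinity> else ereal (ln (enn2real x)))"

primrec cocycle :: "('w \<Rightarrow> 'w) \<Rightarrow> ('w \<Rightarrow> 'f \<Rightarrow> 'f) \<Rightarrow> nat \<Rightarrow> 'w \<Rightarrow> 'f \<Rightarrow> 'f" where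
  "cocycle \<sigma> L 0 \<omega> = id"
| "cocycle \<sigma> L (Suc n) \<omega> = L ((\<sigma> ^^ n) \<omega>) \<circ> cocycle \<sigma> L n \<omega>"

definition grassmannian :: "nat \<Rightarrow> 'v::real_vector set \<Rightarrow> 'v set set" where
  "grassmannian k X =
     {V. V \<subseteq> X \<and> (\<exists>B. finite B \<and> card B = k \<and> independent B \<and> V = span B)}"

definition lyapunov_exponent ::
  "('w \<Rightarrow> 'w) \<Rightarrow> ('w \<Rightarrow> l1 \<Rightarrow> l1) \<Rightarrow> nat \<Rightarrow> 'w \<Rightarrow> ereal" where
  "lyapunov_exponent \<sigma> L k \<omega> =
     (SUP V\<in>grassmannian k BV. INF f\<in>V - {0}.
        limsup (\<lambda>n. ereal (1 / real n) * ln_ennreal (bv_norm (cocycle \<sigma> L n \<omega> f))))"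

definition invertible_measure_preserving :: "'w measure \<Rightarrow> ('w \<Rightarrow> 'w) \<Rightarrow> bool" where
  "invertible_measure_preserving M \<sigma> \<longleftrightarrow>
     bij_betw \<sigma> (space M) (space M) \<and>
     \<sigma> \<in> M \<rightarrow>\<^sub>M M \<and> the_inv_into (space M) \<sigma> \<in> M \<rightarrow>\<^sub>M M \<and>
     distr M M \<sigma> = M"

definition ergodic :: "'w measure \<Rightarrow> ('w \<Rightarrow> 'w) \<Rightarrow> bool" where
  "ergodic M \<sigma> \<longleftrightarrow>
     (\<forall>A\<in>sets M. \<sigma> -` A \<inter> space M = A \<longrightarrow> measure M A = 0 \<or> measure M A = 1)"

end

theory Submission
  imports Defs "HOL-Real_Asymp.Real_Asymp"
begin

text \<open>Without leak (\<open>\<epsilon> = 0\<close>) the two halves \<open>[-1,0]\<close> and \<open>[0,1]\<close> are invariant and each carries a full tent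
map that preserves Lebesgue measure, so the exponent \<open>0\<close> is double and everything else decays like
\<open>2^(-n)\<close>. With leak, the map sends windows of length about \<open>\<epsilon> a\<close> and \<open>\<epsilon> b\<close> around \<open>1/2\<close> and \<open>-1/2\<close> across
\<open>0\<close>. The total mass is still conserved, which gives the first exponent. The difference of the masses
of the two halves is multiplied by about \<open>1 - \<epsilon> (a + b)\<close> in each step, which gives the second one. It
remains to control the rest of the function. The ordinary variation does not contract in one step,
because the leak creates a jump of the size of the function itself. That jump, however, lies within
\<open>\<epsilon>\<close> of \<open>0\<close>; the map carries it close to \<open>1\<close> or \<open>-1\<close>, and from then on its distance from that endpoint
at most doubles, up to a factor \<open>1 + \<epsilon>\<close>, in each step, while its size is halved. So it becomes harmless
when a jump at distance \<open>d\<close> from \<open>{-1,0,1}\<close> is counted with the weight \<open>max d \<epsilon> powr \<gamma>\<close>, \<open>0 < \<gamma> \<le> 1\<close>: one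
step multiplies the weight of a moved jump by at most \<open>(2 (1 + \<epsilon>)) powr \<gamma>\<close>, and a new jump weighs only
\<open>\<epsilon> powr \<gamma>\<close>.

The weighted variation \<open>V f\<close> is handled by duality, as the supremum of \<open>\<integral> f g\<close> over functions \<open>g\<close> whose
primitive vanishes at \<open>-1, 0, 1\<close> and is dominated by the weight. Since \<open>\<integral> (L f) g = \<integral> f (g \<circ> T)\<close>, a change
of variables in the primitive of \<open>g \<circ> T\<close> yields \<open>V (L f) \<le> \<theta> V f + \<epsilon> powr \<gamma> (|P| + |N|)\<close>, where \<open>P\<close> and \<open>N\<close>
are the masses of \<open>f\<close> on the right and on the left and \<open>\<theta> = (2 (1 + \<epsilon>)) powr \<gamma> / 2 + \<epsilon> powr \<gamma>\<close> (lemma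
\<open>lasota_yorke\<close>). The same duality shows that the leaking mass is proportional to \<open>P\<close> and \<open>N\<close> up to an
error of order \<open>\<epsilon> V f\<close> (lemma \<open>mass_right_perron_frobenius\<close>). Finally \<open>V\<close> is finite on \<open>BV\<close> (lemma
\<open>var_le_BV\<close>), and together with the masses it bounds the norm of \<open>BV\<close> (lemma \<open>bv_norm_le\<close>), so growth
rates can be read off from \<open>V\<close>, \<open>P\<close> and \<open>N\<close>.

Write \<open>l = ln (1/\<epsilon>)\<close>. Two choices of \<open>\<gamma>\<close> are made. For \<open>\<gamma> = 1 - 1/l\<close> new jumps weigh \<open>exp 1 * \<epsilon>\<close> and
\<open>1 - \<theta>\<close> is of order \<open>1/l\<close>, so that for functions of total mass \<open>0\<close> the cone \<open>V f \<le> K |P|\<close> with \<open>K\<close> of order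
\<open>\<epsilon> l\<close> is invariant. Inside it each step multiplies \<open>P\<close> by \<open>1 - \<epsilon> (a + b)\<close> up to an error of order \<open>\<epsilon>\<^sup>2 l\<close>,
and the ergodic theorem (\<open>birkhoff_upper_bound\<close>) turns these factors into the second exponent. For
\<open>\<gamma> = ln l / l\<close> new jumps weigh \<open>1/l\<close> and \<open>\<theta>\<close> is \<open>1/2\<close> up to an error of order \<open>ln l / l\<close>. The cone \<open>V f \<le> |P|\<close> is
again forward invariant, and an orbit of total mass \<open>0\<close> that never enters it decays like
\<open>(\<theta> + 2 \<epsilon> powr \<gamma>)^n\<close>. Every three-dimensional space contains such an orbit: for each \<open>n\<close> it has a normalised
element of total mass \<open>0\<close> whose right mass vanishes at time \<open>n\<close>, which keeps it outside the cone until
then, and a limit point of these elements decays at that rate forever (\<open>slow_combination\<close>). This bounds all further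
exponents.\<close>

section \<open>Integrals of bounded Borel functions over intervals\<close>

definition bdd_borel :: "(real \<Rightarrow> real) \<Rightarrow> bool" where
  "bdd_borel g \<longleftrightarrow> g \<in> borel_measurable borel \<and> (\<exists>C. \<forall>x. \<bar>g x\<bar> \<le> C)"

lemma bdd_borelI:
  assumes "g \<in> borel_measurable borel" "\<And>x. \<bar>g x\<bar> \<le> C"
  shows "bdd_borel g"
  using assms unfolding bdd_borel_def by blast

lemma bdd_borel_measurable [measurable_dest]: "bdd_borel g \<Longrightarrow> g \<in> borel_measurable borel"
  by (simp add: bdd_borel_def)

lemma bdd_borel_compose:
  assumes "bdd_borel g" "T \<in> borel_measurable borel"
  shows "bdd_borel (\<lambda>x. g (T x))"
  using assms by (auto simp: bdd_borel_def intro: measurable_compose[OF assms(2)])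

lemma bdd_borel_const: "bdd_borel (\<lambda>x. c)"
  by (auto simp: bdd_borel_def)

lemma bdd_borel_indicator: "A \<in> sets borel \<Longrightarrow> bdd_borel (indicator A)"
  by (rule bdd_borelI[where C = 1]) (auto simp: indicator_def)

lemma bdd_borel_add:
  assumes "bdd_borel f" "bdd_borel g"
  shows "bdd_borel (\<lambda>x. f x + g x)"
proof -
  obtain C D where "\<And>x. \<bar>f x\<bar> \<le> C" "\<And>x. \<bar>g x\<bar> \<le> D"
    using assms unfolding bdd_borel_def by blast
  then have "\<bar>f x + g x\<bar> \<le> C + D" for x
    using abs_triangle_ineq[of "f x" "g x"] by (smt (verit))
  then show ?thesis
    using assms by (intro bdd_borelI[where C = "C + D"]) (auto simp: bdd_borel_def)
qed

lemma bdd_borel_mult: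
  assumes "bdd_borel f" "bdd_borel g"
  shows "bdd_borel (\<lambda>x. f x * g x)"
proof -
  obtain C D where "\<And>x. \<bar>f x\<bar> \<le> C" "\<And>x. \<bar>g x\<bar> \<le> D"
    using assms unfolding bdd_borel_def by blast
  then have "\<bar>f x * g x\<bar> \<le> C * D" for x
    unfolding abs_mult by (intro mult_mono) (auto intro: order_trans[OF abs_ge_zero])
  then show ?thesis
    using assms by (intro bdd_borelI[where C = "C * D"]) (auto simp: bdd_borel_def)
qed

lemma bdd_borel_cmult: "bdd_borel g \<Longrightarrow> bdd_borel (\<lambda>x. c * g x)"
  using bdd_borel_mult[OF bdd_borel_const] by blast

lemma bdd_borel_diff:
  "bdd_borel f \<Longrightarrow> bdd_borel g \<Longrightarrow> bdd_borel (\<lambda>x. f x - g x)"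
  using bdd_borel_add[of f "\<lambda>x. (-1) * g x"] bdd_borel_cmult[of g "-1"] by simp

lemma bdd_borel_sum:
  "finite A \<Longrightarrow> (\<And>i. i \<in> A \<Longrightarrow> bdd_borel (f i)) \<Longrightarrow> bdd_borel (\<lambda>x. \<Sum>i\<in>A. f i x)"
  by (induction A rule: finite_induct) (auto intro: bdd_borel_const bdd_borel_add)

lemma bdd_borel_reflect: "bdd_borel g \<Longrightarrow> bdd_borel (\<lambda>x. g (- x))"
  by (rule bdd_borel_compose) auto

lemma bdd_borel_set_integrable:
  assumes "bdd_borel g"
  shows "set_integrable lborel {c..d} g"
proof -
  obtain C where C: "\<And>x. \<bar>g x\<bar> \<le> C"
    using assms unfolding bdd_borel_def by blast
  have [measurable]: "g \<in> borel_measurable borel"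
    using assms by (simp add: bdd_borel_def)
  have "integrable lborel (\<lambda>x. C * indicator {c..d} x :: real)"
    by (intro integrable_mult_right integrable_real_indicator) (auto simp: emeasure_lborel_Icc_eq)
  then show ?thesis
    unfolding set_integrable_def
    by (rule Bochner_Integration.integrable_bound)
      (auto simp: indicator_def intro!: AE_I2 order_trans[OF C])
qed

lemma set_integral_Icc_split:
  fixes g :: "real \<Rightarrow> real"
  assumes "bdd_borel g" "c \<le> m" "m \<le> d"
  shows "(LBINT t:{c..d}. g t) = (LBINT t:{c..m}. g t) + (LBINT t:{m..d}. g t)"
proof -
  have "{c..d} = {c..m} \<union> {m..d}"
    using assms by auto
  moreover have "AE t in lborel. \<not> (t \<in> {c..m} \<and> t \<in> {m..d})"
    using AE_lborel_singleton[of m] by eventually_elim auto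
  ultimately show ?thesis
    using set_integral_Un_AE[of "{c..m}" "{m..d}" lborel g] assms(1)
    by (auto simp: bdd_borel_set_integrable)
qed

lemma set_integral_Icc_affine:
  fixes g :: "real \<Rightarrow> real"
  assumes "s > 0"
  shows "(LBINT t:{c..d}. g (u - s * t)) = (1 / s) * (LBINT t:{u - s * d..u - s * c}. g t)"
proof -
  have *: "indicator {u - s * d..u - s * c} (u + - s * t) = (indicator {c..d} t :: real)" for t
    using assms by (auto simp: indicator_def)
  show ?thesis
    unfolding set_lebesgue_integral_def
    using assms lborel_integral_real_affine[of "-s" "\<lambda>t. indicator {u - s * d..u - s * c} t *\<^sub>R g t" u]
    by (simp only: *) (simp add: field_simps)
qed

lemma set_integral_Icc_reflect:
  fixes g :: "real \<Rightarrow> real"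
  shows "(LBINT t:{0..x}. g (- t)) = (LBINT t:{- x..0}. g t)"
  using set_integral_Icc_affine[of 1 0 x g 0] by simp

lemma set_integral_Icc_cong:
  fixes f g :: "real \<Rightarrow> real"
  assumes "f \<in> borel_measurable borel" "g \<in> borel_measurable borel"
    and "\<And>t. c < t \<Longrightarrow> t < d \<Longrightarrow> f t = g t"
  shows "(LBINT t:{c..d}. f t) = (LBINT t:{c..d}. g t)"
proof (rule set_lebesgue_integral_cong_AE)
  show "AE x in lborel. x \<in> {c..d} \<longrightarrow> f x = g x"
    using AE_lborel_singleton[of c] AE_lborel_singleton[of d]
    by eventually_elim (use assms(3) in auto)
qed (use assms in auto)

lemma set_integral_Icc_const: "c \<le> d \<Longrightarrow> (LBINT t:{c..d}. k) = (d - c) * (k :: real)"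
  by (simp add: set_lebesgue_integral_def mult.commute)

lemma set_integral_Icc_diff:
  fixes f g :: "real \<Rightarrow> real"
  assumes "bdd_borel f" "bdd_borel g"
  shows "(LBINT t:{c..d}. f t - g t) = (LBINT t:{c..d}. f t) - (LBINT t:{c..d}. g t)"
  using assms by (intro set_integral_diff bdd_borel_set_integrable)

section \<open>Test functions with dominated primitive\<close>

text \<open>For a smooth function \<open>f\<close>, integration by parts gives \<open>\<integral> f k = - \<integral> f' K\<close> with \<open>K\<close> the primitive of \<open>k\<close>,
which vanishes at both ends. So \<open>\<integral> f k\<close> is at most the variation of \<open>f\<close> weighted by \<open>w\<close>, and for
continuous \<open>w\<close> the supremum over these \<open>k\<close> equals it. Constants are not seen.\<close>

definition half_test :: "(real \<Rightarrow> real) \<Rightarrow> (real \<Rightarrow> real) \<Rightarrow> bool" where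
  "half_test w k \<longleftrightarrow> bdd_borel k \<and> (\<forall>x\<in>{0..1}. \<bar>LBINT t:{0..x}. k t\<bar> \<le> w x) \<and>
     (LBINT t:{0..1}. k t) = 0"

text \<open>The left half is reflected onto \<open>[0,1]\<close>. Since the primitive vanishes at \<open>0\<close>, a jump of the tested
function at \<open>0\<close> is not seen, as in the variation over the complement of \<open>0\<close>.\<close>

definition paired_test :: "(real \<Rightarrow> real) \<Rightarrow> (real \<Rightarrow> real) \<Rightarrow> bool" where
  "paired_test w g \<longleftrightarrow> half_test w g \<and> half_test w (\<lambda>x. g (- x))"

lemma half_test_cmult:
  assumes "half_test w k"
  shows "half_test (\<lambda>x. \<bar>c\<bar> * w x) (\<lambda>x. c * k x)"
  using assms by (auto simp: half_test_def bdd_borel_cmult abs_mult mult_left_mono)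

lemma half_test_cong:
  assumes "half_test w f'" "bdd_borel f" "\<And>t. 0 < t \<Longrightarrow> f t = f' t"
  shows "half_test w f"
proof -
  have f': "bdd_borel f'" using assms(1) by (simp add: half_test_def)
  have "(LBINT t:{0..x}. f t) = (LBINT t:{0..x}. f' t)" for x
    by (rule set_integral_Icc_cong[OF bdd_borel_measurable[OF assms(2)] bdd_borel_measurable[OF f'] assms(3)])
  then show ?thesis
    using assms(1,2) unfolding half_test_def by presburger
qed

text \<open>The primitive of \<open>k - c\<close> is antisymmetric about \<open>1/2\<close>, because \<open>k\<close> is symmetric and \<open>c\<close> is its mean. Hence
the bound on \<open>[0,1/2]\<close> carries over to \<open>[1/2,1]\<close>, and the primitive vanishes at \<open>1\<close>.\<close>

lemma half_test_symmetric:
  assumes k: "bdd_borel k" and sym: "\<And>t. 0 < t \<Longrightarrow> t < 1 \<Longrightarrow> k (1 - t) = k t"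
    and c: "c = 2 * (LBINT t:{0..1/2}. k t)"
    and w: "\<And>x. w (1 - x) = w x"
    and bound: "\<And>x. 0 \<le> x \<Longrightarrow> x \<le> 1/2 \<Longrightarrow> \<bar>(LBINT t:{0..x}. k t) - c * x\<bar> \<le> w x"
  shows "half_test w (\<lambda>x. k x - c)"
proof -
  have int: "(LBINT t:{0..x}. k t - c) = (LBINT t:{0..x}. k t) - c * x" if "0 \<le> x" for x
    using that by (simp add: set_integral_Icc_diff k bdd_borel_const set_integral_Icc_const mult.commute)
  have up: "(LBINT t:{0..x}. k t) = c - (LBINT t:{0..1 - x}. k t)" if x: "1/2 \<le> x" "x \<le> 1" for x
  proof -
    have refl: "(LBINT t:{y..1}. k t) = (LBINT t:{0..1 - y}. k t)" if "1/2 \<le> y" "y \<le> 1" for y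
    proof -
      have "(LBINT t:{0..1 - y}. k t) = (LBINT t:{0..1 - y}. k (1 - t))"
      proof (rule set_integral_Icc_cong)
        show "k t = k (1 - t)" if "0 < t" "t < 1 - y" for t
          using that \<open>1/2 \<le> y\<close> sym[of t] by simp
      qed (use k bdd_borel_compose[OF k, of "\<lambda>t. 1 - t"] in \<open>auto intro: bdd_borel_measurable\<close>)
      also have "\<dots> = (LBINT t:{y..1}. k t)"
        using set_integral_Icc_affine[of 1 0 "1 - y" k 1] by simp
      finally show ?thesis by simp
    qed
    have "(LBINT t:{0..x}. k t) + (LBINT t:{x..1}. k t)
        = (LBINT t:{0..1/2}. k t) + (LBINT t:{1/2..1}. k t)"
      using set_integral_Icc_split[OF k, of 0 x 1] set_integral_Icc_split[OF k, of 0 "1/2" 1] x by simp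
    then show ?thesis
      using refl[of x] refl[of "1/2"] x by (simp add: c)
  qed
  have "\<bar>LBINT t:{0..x}. k t - c\<bar> \<le> w x" if x: "0 \<le> x" "x \<le> 1" for x
  proof (cases "x \<le> 1/2")
    case True
    then show ?thesis using bound int x by simp
  next
    case False
    have "(LBINT t:{0..x}. k t - c) = - ((LBINT t:{0..1 - x}. k t) - c * (1 - x))"
      using False x up[of x] int[of x] by (simp add: algebra_simps)
    then show ?thesis
      using bound[of "1 - x"] False x w[of x] by simp
  qed
  moreover have "(LBINT t:{0..1}. k t - c) = 0"
  proof -
    have "(LBINT t:{0..0}. k t) = 0"
      using set_integral_Icc_split[OF k, of 0 0 0] by simp
    then show ?thesis
      using up[of 1] int[of 1] by simp
  qed
  ultimately show ?thesis
    using k by (auto simp: half_test_def intro: bdd_borel_diff bdd_borel_const)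
qed

section \<open>Composition of test functions with the paired tent map\<close>

lemma paired_tent_measurable [measurable]: "paired_tent a b \<in> borel_measurable borel"
  unfolding paired_tent_def by measurable

lemma paired_tent_odd: "paired_tent a b (- x) = - paired_tent b a x"
proof (cases "x = 1/2 \<or> x = - 1/2")
  case True
  then show ?thesis by (elim disjE) (simp_all add: paired_tent_def field_simps)
next
  case False
  then show ?thesis by (auto simp: paired_tent_def algebra_simps)
qed

lemma paired_tent_symmetric: "0 < x \<Longrightarrow> x < 1 \<Longrightarrow> paired_tent a b (1 - x) = paired_tent a b x"
  by (auto simp: paired_tent_def algebra_simps)

text \<open>The distance of \<open>x\<close> to \<open>{0,1}\<close> to the power \<open>\<alpha>\<close>, cut off at \<open>e\<close>: jumps created by the leak lie
within \<open>e\<close> of \<open>0\<close>, and it does not matter how much closer they are.\<close>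

definition weight :: "real \<Rightarrow> real \<Rightarrow> real \<Rightarrow> real" where
  "weight e \<alpha> x = max (min x (1 - x)) e powr \<alpha>"

text \<open>A jump is multiplied by an inverse slope, which is at most \<open>1/2\<close>, and its weight grows by at most
\<open>(2 (1 + e)) powr \<alpha>\<close>. The last term pays for the subtraction of a mean from the composed test function.\<close>

definition contraction :: "real \<Rightarrow> real \<Rightarrow> real" where
  "contraction e \<alpha> = (2 * (1 + e)) powr \<alpha> / 2 + e powr \<alpha>"

text \<open>On \<open>[0,1/2]\<close> the map is affine, so the primitive of \<open>g \<circ> T\<close> at \<open>x\<close> is \<open>1 / (2 (1 + a))\<close> times the integral of
\<open>g\<close> from \<open>T x\<close> to \<open>1\<close>, which is bounded by the weight at \<open>|T x|\<close>; and the map multiplies distances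
to \<open>{0,1}\<close>, cut off at \<open>e\<close>, by at most \<open>2 (1 + e)\<close>. As \<open>g\<close> has integral \<open>0\<close> over \<open>[0,1]\<close>, the mean \<open>c\<close> of \<open>g \<circ> T\<close> only comes from
the part \<open>[-a,0]\<close> of the image, where the primitive of \<open>g\<close> is at most \<open>e powr \<alpha>\<close>.\<close>

lemma half_test_tent:
  assumes g: "paired_test (weight e \<alpha>) g"
    and a: "0 \<le> a" "a \<le> e" and e: "0 < e" "e \<le> 1/2" and \<alpha>: "0 < \<alpha>" "\<alpha> \<le> 1"
  shows "\<exists>c. \<bar>c\<bar> \<le> e powr \<alpha> \<and>
    half_test (\<lambda>x. contraction e \<alpha> * weight e \<alpha> x) (\<lambda>x. g (paired_tent a b x) - c)"
proof -
  define m where "m = 2 * (1 + a)"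
  define k where "k x = g (paired_tent a b x)" for x
  define c where "c = 2 * (LBINT t:{0..1/2}. k t)"
  have m: "m \<ge> 2" "m \<le> 2 * (1 + e)" using a by (auto simp: m_def)
  have gb: "bdd_borel g" and G0: "(LBINT t:{0..1}. g t) = 0"
    and Gr: "\<And>x. 0 \<le> x \<Longrightarrow> x \<le> 1 \<Longrightarrow> \<bar>LBINT t:{0..x}. g t\<bar> \<le> weight e \<alpha> x"
    and Gl: "\<And>x. 0 \<le> x \<Longrightarrow> x \<le> 1 \<Longrightarrow> \<bar>LBINT t:{- x..0}. g t\<bar> \<le> weight e \<alpha> x"
    using g by (auto simp: paired_test_def half_test_def set_integral_Icc_reflect)
  have kb: "bdd_borel k"
    unfolding k_def by (rule bdd_borel_compose[OF gb]) simp
  have tail: "\<bar>LBINT t:{y..1}. g t\<bar> \<le> weight e \<alpha> \<bar>y\<bar>" if y: "- 1 \<le> y" "y \<le> 1" for y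
  proof (cases "0 \<le> y")
    case True
    then show ?thesis
      using set_integral_Icc_split[OF gb, of 0 y 1] Gr[of y] G0 y by simp
  next
    case False
    then show ?thesis
      using set_integral_Icc_split[OF gb, of y 0 1] Gl[of "- y"] G0 y by simp
  qed
  have fold: "(LBINT t:{0..x}. k t) = (1 / m) * (LBINT t:{1 - m * x..1}. g t)"
    if "0 \<le> x" "x \<le> 1/2" for x
  proof -
    have "(LBINT t:{0..x}. k t) = (LBINT t:{0..x}. g (1 - m * t))"
    proof (rule set_integral_Icc_cong)
      show "k t = g (1 - m * t)" if "0 < t" "t < x" for t
        using that \<open>x \<le> 1/2\<close> by (simp add: k_def paired_tent_def m_def algebra_simps)
    qed (use kb bdd_borel_compose[OF gb, of "\<lambda>t. 1 - m * t"] in \<open>auto intro: bdd_borel_measurable\<close>)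
    then show ?thesis
      using set_integral_Icc_affine[of m 0 x g 1] m by simp
  qed
  have range: "- a \<le> 1 - m * x" "1 - m * x \<le> 1" if "0 \<le> x" "x \<le> 1/2" for x
  proof -
    have "m * x \<le> m * (1/2)"
      using that m by (intro mult_left_mono) auto
    then show "- a \<le> 1 - m * x" by (simp add: m_def)
    show "1 - m * x \<le> 1" using that m by simp
  qed
  have cs: "\<bar>c\<bar> \<le> e powr \<alpha>"
  proof -
    have "1 - m * (1/2) = - a" by (simp add: m_def field_simps)
    then have "c = (2 / m) * (LBINT t:{- a..1}. g t)"
      using fold[of "1/2"] by (simp add: c_def)
    then have "\<bar>c\<bar> \<le> 1 * \<bar>LBINT t:{- a..1}. g t\<bar>"
      using mult_right_mono[of "2 / m" 1 "\<bar>LBINT t:{- a..1}. g t\<bar>"] m by (simp add: abs_mult)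
    also have "\<dots> \<le> weight e \<alpha> a"
      using tail[of "- a"] a e by simp
    also have "\<dots> = e powr \<alpha>"
      using a by (simp add: weight_def max_def min_def)
    finally show ?thesis .
  qed
  have grow: "weight e \<alpha> \<bar>1 - m * x\<bar> \<le> (2 * (1 + e)) powr \<alpha> * weight e \<alpha> x"
    if x: "0 \<le> x" "x \<le> 1/2" for x
  proof -
    define y where "y = 1 - m * x"
    have y: "- a \<le> y" "y \<le> 1" using range[OF x] by (auto simp: y_def)
    have mx: "m * x \<le> 2 * (1 + e) * x"
      using m x by (intro mult_right_mono) auto
    have "2 * (1 + e) * x \<le> 2 * (1 + e) * max x e" "1 * e \<le> 2 * (1 + e) * max x e"
      using e x by (intro mult_left_mono mult_mono; simp)+
    moreover have "min \<bar>y\<bar> (1 - \<bar>y\<bar>) \<le> max (m * x) e"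
      using y a by (cases "0 \<le> y") (auto simp: y_def)
    ultimately have "max (min \<bar>y\<bar> (1 - \<bar>y\<bar>)) e \<le> 2 * (1 + e) * max x e"
      using mx by (auto simp: max_def split: if_splits)
    then have "weight e \<alpha> \<bar>y\<bar> \<le> (2 * (1 + e) * max x e) powr \<alpha>"
      unfolding weight_def using e \<alpha> by (intro powr_mono2) auto
    also have "\<dots> = (2 * (1 + e)) powr \<alpha> * weight e \<alpha> x"
      using x e by (simp add: powr_mult weight_def min_absorb1)
    finally show ?thesis by (simp add: y_def)
  qed
  have "half_test (\<lambda>x. contraction e \<alpha> * weight e \<alpha> x) (\<lambda>x. k x - c)"
  proof (rule half_test_symmetric[OF kb _ c_def])
    show "k (1 - t) = k t" if "0 < t" "t < 1" for t
      using that by (simp add: k_def paired_tent_symmetric)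
    show "contraction e \<alpha> * weight e \<alpha> (1 - x) = contraction e \<alpha> * weight e \<alpha> x" for x
      by (simp add: weight_def min.commute)
    fix x :: real assume x: "0 \<le> x" "x \<le> 1/2"
    have xw: "x \<le> weight e \<alpha> x"
    proof -
      have "x \<le> x powr \<alpha>"
        using powr_mono'[of \<alpha> 1 x] \<alpha> x by simp
      also have "\<dots> \<le> weight e \<alpha> x"
        unfolding weight_def using x e \<alpha> by (intro powr_mono2) auto
      finally show ?thesis .
    qed
    have "\<bar>LBINT t:{0..x}. k t\<bar> = (1 / m) * \<bar>LBINT t:{1 - m * x..1}. g t\<bar>"
      using fold[OF x] m by (simp add: abs_mult)
    also have "\<dots> \<le> (1 / 2) * weight e \<alpha> \<bar>1 - m * x\<bar>"
      using m range[OF x] a e by (intro mult_mono tail) (auto simp: field_simps)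
    also have "\<dots> \<le> (2 * (1 + e)) powr \<alpha> / 2 * weight e \<alpha> x"
      using grow[OF x] by simp
    finally have "\<bar>(LBINT t:{0..x}. k t) - c * x\<bar> \<le> (2 * (1 + e)) powr \<alpha> / 2 * weight e \<alpha> x + \<bar>c * x\<bar>"
      by linarith
    also have "\<bar>c * x\<bar> \<le> e powr \<alpha> * weight e \<alpha> x"
      unfolding abs_mult using cs xw x by (intro mult_mono) auto
    finally show "\<bar>(LBINT t:{0..x}. k t) - c * x\<bar> \<le> contraction e \<alpha> * weight e \<alpha> x"
      by (simp add: contraction_def algebra_simps)
  qed
  with cs show ?thesis unfolding k_def by (intro exI[of _ c]) simp
qed

lemma paired_test_tent:
  assumes g: "paired_test (weight e \<alpha>) g"
    and a: "a \<in> {0..e}" "b \<in> {0..e}" and e: "0 < e" "e \<le> 1/2" and \<alpha>: "0 < \<alpha>" "\<alpha> \<le> 1"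
  shows "\<exists>c c'. \<bar>c\<bar> \<le> e powr \<alpha> \<and> \<bar>c'\<bar> \<le> e powr \<alpha> \<and>
    paired_test (\<lambda>x. contraction e \<alpha> * weight e \<alpha> x)
      (\<lambda>x. g (paired_tent a b x) - (if 0 \<le> x then c else c'))"
proof -
  have "paired_test (weight e \<alpha>) (\<lambda>x. g (- x))"
    using g by (simp add: paired_test_def)
  then obtain c' where c': "\<bar>c'\<bar> \<le> e powr \<alpha>"
    "half_test (\<lambda>x. contraction e \<alpha> * weight e \<alpha> x) (\<lambda>x. g (- paired_tent b a x) - c')"
    using half_test_tent[of e \<alpha> "\<lambda>x. g (- x)" b a] a e \<alpha> unfolding atLeastAtMost_iff by blast
  obtain c where c: "\<bar>c\<bar> \<le> e powr \<alpha>"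
    "half_test (\<lambda>x. contraction e \<alpha> * weight e \<alpha> x) (\<lambda>x. g (paired_tent a b x) - c)"
    using half_test_tent[OF g, of a b] a e \<alpha> unfolding atLeastAtMost_iff by blast
  let ?g = "\<lambda>x. g (paired_tent a b x) - (if 0 \<le> x then c else c')"
  have gb: "bdd_borel ?g"
  proof (rule bdd_borel_diff)
    show "bdd_borel (\<lambda>x. g (paired_tent a b x))"
      using g by (auto simp: paired_test_def half_test_def intro: bdd_borel_compose[OF _ paired_tent_measurable])
    show "bdd_borel (\<lambda>x::real. if 0 \<le> x then c else c')"
      by (rule bdd_borelI[where C = "max \<bar>c\<bar> \<bar>c'\<bar>"]) auto
  qed
  have "half_test (\<lambda>x. contraction e \<alpha> * weight e \<alpha> x) ?g"
    by (rule half_test_cong[OF c(2) gb]) auto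
  moreover have "half_test (\<lambda>x. contraction e \<alpha> * weight e \<alpha> x) (\<lambda>x. ?g (- x))"
    by (rule half_test_cong[OF c'(2) bdd_borel_reflect[OF gb]]) (simp add: paired_tent_odd)
  ultimately show ?thesis
    using c(1) c'(1) by (intro exI[of _ c] exI[of _ c']) (simp add: paired_test_def)
qed

text \<open>Up to its endpoints, the part of \<open>[0,1]\<close> that the right half of the map sends across \<open>0\<close> is the window
of length \<open>p\<close> around \<open>1/2\<close> with \<open>p = a / (1 + a)\<close>.\<close>

definition leak :: "real \<Rightarrow> real \<Rightarrow> real" where
  "leak p x = (if \<bar>x - 1/2\<bar> < p / 2 then 1 else 0)"

lemma bdd_borel_leak: "bdd_borel (leak p)"
  by (rule bdd_borelI[where C = 1]) (auto simp: leak_def [abs_def])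

text \<open>On \<open>[0,1/2]\<close> the primitive of \<open>leak p - p\<close> has absolute value at most \<open>p * x\<close>, and \<open>x \<le> x powr \<alpha>\<close>. The
factor \<open>p\<close> in the bound is essential: it makes the error in the leaking mass proportional to the leak.\<close>

lemma half_test_leak:
  assumes p: "0 \<le> p" "p \<le> 1/2" and \<alpha>: "0 < \<alpha>" "\<alpha> \<le> 1" "0 < e"
  shows "half_test (\<lambda>x. p * weight e \<alpha> x) (\<lambda>x. leak p x - p)"
proof -
  have int: "(LBINT t:{0..x}. leak p t) = max 0 (x - (1 - p) / 2)" if x: "0 \<le> x" "x \<le> 1/2" for x
  proof -
    have "(LBINT t:{0..x}. leak p t) = (LBINT t:{0..x}. indicator {(1 - p) / 2<..} t)"
    proof (rule set_integral_Icc_cong)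
      show "leak p t = indicator {(1 - p) / 2<..} t" if "0 < t" "t < x" for t
        using that x p by (auto simp: leak_def indicator_def abs_if field_simps)
    qed (auto intro!: bdd_borel_measurable bdd_borel_leak)
    also have "\<dots> = max 0 (x - (1 - p) / 2)"
    proof -
      have "(LBINT t:{0..x}. indicator {(1 - p) / 2<..} t) = (LINT t|lborel. indicator {(1 - p) / 2<..x} t :: real)"
        unfolding set_lebesgue_integral_def
        by (rule Bochner_Integration.integral_cong) (use p in \<open>auto simp: indicator_def\<close>)
      then show ?thesis by (simp add: max_def)
    qed
    finally show ?thesis .
  qed
  have half: "(LBINT t:{0..1/2}. leak p t) = p / 2"
    using int[of "1/2"] p by (simp add: field_simps)
  show ?thesis
  proof (rule half_test_symmetric[OF bdd_borel_leak])
    show "p = 2 * (LBINT t:{0..1/2}. leak p t)" using half by simp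
    show "leak p (1 - t) = leak p t" for t
      using abs_minus_commute[of "1/2" t] by (simp add: leak_def)
    show "p * weight e \<alpha> (1 - x) = p * weight e \<alpha> x" for x
      by (simp add: weight_def min.commute)
    fix x :: real assume x: "0 \<le> x" "x \<le> 1/2"
    have "x \<le> x powr \<alpha>"
      using powr_mono'[of \<alpha> 1 x] \<alpha> x by simp
    also have "\<dots> \<le> weight e \<alpha> x"
      unfolding weight_def using x \<alpha> by (intro powr_mono2) auto
    finally have xw: "p * x \<le> p * weight e \<alpha> x" using p by (intro mult_left_mono)
    have "x * (1 - 2 * p) \<le> 1/2 * (1 - 2 * p)"
      using x p by (intro mult_right_mono) auto
    then have "max 0 (x - (1 - p) / 2) \<le> 2 * (p * x)" 
      using p x by (simp add: field_simps)
    then have "\<bar>max 0 (x - (1 - p) / 2) - p * x\<bar> \<le> p * x"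
      using p x by (simp add: abs_le_iff)
    then show "\<bar>(LBINT t:{0..x}. leak p t) - p * x\<bar> \<le> p * weight e \<alpha> x"
      using xw int[OF x] by simp
  qed
qed

section \<open>Pairing integrable classes with bounded functions\<close>

lemma space_leb: "space leb = {-1..1}"
  by (simp add: leb_def space_restrict_space)

lemma integrable_leb_iff:
  fixes u :: "real \<Rightarrow> real"
  shows "integrable leb u \<longleftrightarrow> integrable lborel (\<lambda>x. indicator {-1..1} x * u x)"
  unfolding leb_def by (subst integrable_restrict_space) auto

lemma integral_leb:
  fixes u :: "real \<Rightarrow> real"
  shows "(LINT x|leb. u x) = (LINT x|lborel. indicator {-1..1} x * u x)"
  unfolding leb_def by (subst integral_restrict_space) auto

lemma AE_leb_iff: "(AE x in leb. Q x) \<longleftrightarrow> (AE x in lborel. x \<in> {-1..1} \<longrightarrow> Q x)"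
  unfolding leb_def by (subst AE_restrict_space_iff) auto

lemma borel_measurable_leb_iff:
  fixes u :: "real \<Rightarrow> real"
  shows "u \<in> borel_measurable leb \<longleftrightarrow> (\<lambda>x. indicator {-1..1} x * u x) \<in> borel_measurable borel"
  unfolding leb_def by (subst borel_measurable_restrict_space_iff) auto

lemma borel_measurable_lebI: "u \<in> borel_measurable borel \<Longrightarrow> u \<in> borel_measurable leb"
  unfolding leb_def by (rule measurable_restrict_space1) simp

lemma integrable_rep_l1: "integrable leb (rep_l1 f)"
  using Quotient3_rep_reflp[OF Quotient3_l1, of f] by simp

lemma abs_rep_l1: "abs_l1 (rep_l1 f) = f"
  by (rule Quotient3_abs_rep[OF Quotient3_l1])

text \<open>Pairings with a class can therefore be computed from any representative.\<close>

lemma rep_abs_l1: "integrable leb u \<Longrightarrow> AE x in leb. rep_l1 (abs_l1 u) x = u x"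
  using rep_abs_rsp_left[OF Quotient3_l1, of u u] by simp

lemma abs_l1_eqI:
  assumes "integrable leb u" "integrable leb v" "AE x in leb. u x = v x"
  shows "abs_l1 u = abs_l1 v"
  using Quotient3_rel_abs[OF Quotient3_l1, of u v] assms by simp

definition pairing :: "l1 \<Rightarrow> (real \<Rightarrow> real) \<Rightarrow> real" where
  "pairing f g = (LINT x|leb. rep_l1 f x * g x)"

lemma pairing_abs_l1:
  assumes "integrable leb u" "g \<in> borel_measurable leb"
  shows "pairing (abs_l1 u) g = (LINT x|leb. u x * g x)"
  unfolding pairing_def
proof (rule integral_cong_AE)
  show "AE x in leb. rep_l1 (abs_l1 u) x * g x = u x * g x"
    using rep_abs_l1[OF assms(1)] by eventually_elim simp
qed (use assms integrable_rep_l1[of "abs_l1 u"] in auto)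

lemma integrable_mult_linfty:
  assumes "integrable leb u" "g \<in> linfty"
  shows "integrable leb (\<lambda>x. u x * g x)"
proof -
  obtain C where C: "AE x in leb. \<bar>g x\<bar> \<le> C" and [measurable]: "g \<in> borel_measurable leb"
    using assms(2) by (auto simp: linfty_def)
  from C have "AE x in leb. norm (u x * g x) \<le> norm (C * u x)"
  proof eventually_elim
    case (elim x)
    then have "\<bar>u x\<bar> * \<bar>g x\<bar> \<le> \<bar>u x\<bar> * \<bar>C\<bar>" by (intro mult_left_mono) auto
    then show ?case by (simp add: abs_mult mult.commute)
  qed
  moreover have [measurable]: "u \<in> borel_measurable leb"
    using assms(1) by (rule borel_measurable_integrable)
  ultimately show ?thesis
    by (intro Bochner_Integration.integrable_bound[OF integrable_mult_right[OF assms(1)]]) simp_all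
qed

lemma bdd_borel_linfty: "bdd_borel g \<Longrightarrow> g \<in> linfty"
  by (auto simp: linfty_def bdd_borel_def intro: borel_measurable_lebI)

lemma bdd_borel_measurable_leb: "bdd_borel g \<Longrightarrow> g \<in> borel_measurable leb"
  by (auto simp: bdd_borel_def intro: borel_measurable_lebI)

lemma integrable_pairing: "bdd_borel g \<Longrightarrow> integrable leb (\<lambda>x. rep_l1 f x * g x)"
  by (intro integrable_mult_linfty integrable_rep_l1 bdd_borel_linfty)

lemma pairing_add_left:
  assumes "bdd_borel g"
  shows "pairing (f + h) g = pairing f g + pairing h g"
proof -
  have "f + h = abs_l1 (\<lambda>x. rep_l1 f x + rep_l1 h x)"
    using plus_l1.abs_eq[of "rep_l1 f" "rep_l1 h"] integrable_rep_l1 by (simp add: abs_rep_l1)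
  then show ?thesis
    using assms integrable_rep_l1 integrable_pairing[OF assms]
    by (simp add: pairing_abs_l1 bdd_borel_measurable_leb pairing_def[of f] pairing_def[of h] distrib_right)
qed

lemma pairing_scaleR_left:
  assumes "bdd_borel g"
  shows "pairing (c *\<^sub>R f) g = c * pairing f g"
proof -
  have "c *\<^sub>R f = abs_l1 (\<lambda>x. c * rep_l1 f x)"
    using scaleR_l1.abs_eq[of "rep_l1 f" c] integrable_rep_l1 by (simp add: abs_rep_l1)
  then show ?thesis
    using assms integrable_rep_l1 integrable_pairing[OF assms]
    by (simp add: pairing_abs_l1 bdd_borel_measurable_leb pairing_def[of f] mult.assoc)
qed

lemma pairing_add_right:
  "bdd_borel g \<Longrightarrow> bdd_borel k \<Longrightarrow> pairing f (\<lambda>x. g x + k x) = pairing f g + pairing f k"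
  using integrable_pairing by (simp add: pairing_def distrib_left)

lemma pairing_diff_right:
  "bdd_borel g \<Longrightarrow> bdd_borel k \<Longrightarrow> pairing f (\<lambda>x. g x - k x) = pairing f g - pairing f k"
  using integrable_pairing by (simp add: pairing_def right_diff_distrib)

lemma pairing_cmult_right: "pairing f (\<lambda>x. c * g x) = c * pairing f g"
  by (simp add: pairing_def mult.left_commute)

lemma pairing_cong_AE:
  assumes "bdd_borel g" "bdd_borel k" "finite S" "\<And>x. x \<in> {-1..1} - S \<Longrightarrow> g x = k x"
  shows "pairing f g = pairing f k"
  unfolding pairing_def
proof (rule integral_cong_AE)
  have "AE x in lborel. \<forall>s\<in>S. x \<noteq> s"
    using assms(3) by (subst AE_finite_all) (auto intro: AE_lborel_singleton)
  then show "AE x in leb. rep_l1 f x * g x = rep_l1 f x * k x"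
    unfolding AE_leb_iff by eventually_elim (use assms(4) in force)
qed (use assms integrable_rep_l1[of f] bdd_borel_measurable_leb in auto)

lemma norm_l1_eq: "norm f = (LINT x|leb. \<bar>rep_l1 f x\<bar>)"
  by (simp add: norm_l1.rep_eq)

lemma abs_pairing_le:
  assumes "bdd_borel g" "\<And>x. x \<in> {-1..1} \<Longrightarrow> \<bar>g x\<bar> \<le> C"
  shows "\<bar>pairing f g\<bar> \<le> C * norm f"
proof -
  have "\<bar>pairing f g\<bar> \<le> (LINT x|leb. \<bar>rep_l1 f x * g x\<bar>)"
    unfolding pairing_def by (rule integral_abs_bound)
  also have "\<dots> \<le> (LINT x|leb. C * \<bar>rep_l1 f x\<bar>)"
  proof (rule integral_mono)
    show "\<bar>rep_l1 f x * g x\<bar> \<le> C * \<bar>rep_l1 f x\<bar>" if "x \<in> space leb" for x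
      using assms(2)[of x] that by (simp add: space_leb abs_mult mult_right_mono mult.commute[of "\<bar>rep_l1 f x\<bar>"])
  qed (use integrable_pairing[OF assms(1)] integrable_rep_l1 in auto)
  finally show ?thesis by (simp add: norm_l1_eq)
qed

text \<open>The sign of a representative is a bounded Borel function, so no larger class of test functions than
the bounded Borel ones is needed to separate classes.\<close>

lemma norm_l1_attained:
  obtains g where "bdd_borel g" "\<And>x. \<bar>g x\<bar> \<le> 1" "pairing f g = norm f"
proof
  let ?g = "\<lambda>x. sgn (indicator {-1..1} x * rep_l1 f x)"
  have "(\<lambda>x. indicator {-1..1} x * rep_l1 f x) \<in> borel_measurable borel"
    using integrable_rep_l1[of f] borel_measurable_leb_iff by blast
  then have "?g \<in> borel_measurable borel" by simp
  then show "bdd_borel ?g"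
    by (rule bdd_borelI[where C = 1]) (simp add: sgn_if)
  show "\<bar>?g x\<bar> \<le> 1" for x by (simp add: sgn_if)
  show "pairing f ?g = norm f"
    unfolding pairing_def norm_l1_eq
    by (rule Bochner_Integration.integral_cong) (auto simp: space_leb sgn_if)
qed

lemma pairing_eqI:
  assumes "\<And>g. bdd_borel g \<Longrightarrow> pairing f g = pairing h g"
  shows "f = h"
proof -
  obtain g where g: "bdd_borel g" "pairing (f + (-1) *\<^sub>R h) g = norm (f + (-1) *\<^sub>R h)"
    by (rule norm_l1_attained)
  then have "norm (f + (-1) *\<^sub>R h) = 0"
    using assms[OF g(1)] g(1) g(2)[symmetric]
    unfolding pairing_add_left[OF g(1)] pairing_scaleR_left[OF g(1)] by linarith
  then show ?thesis by simp
qed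

section \<open>The Perron--Frobenius operator by inverse branches\<close>

text \<open>The contribution to the transferred density of the affine branch \<open>x \<mapsto> u + s * x\<close> on \<open>I\<close>.\<close>

definition branch_transfer :: "real \<Rightarrow> real \<Rightarrow> real set \<Rightarrow> (real \<Rightarrow> real) \<Rightarrow> real \<Rightarrow> real" where
  "branch_transfer u s I F y = indicator I ((y - u) / s) * F ((y - u) / s) / \<bar>s\<bar>"

lemma branch_transfer:
  fixes F :: "real \<Rightarrow> real"
  assumes F: "integrable leb F" and s: "s \<noteq> 0" and I: "I \<in> sets borel" "I \<subseteq> {-1..1}"
    and image: "\<And>x. x \<in> I \<Longrightarrow> u + s * x \<in> {-1..1}" and g: "g \<in> linfty"
  shows "integrable leb (branch_transfer u s I F)" (is ?A)
    and "integrable lborel (\<lambda>x. indicator I x * (F x * g (u + s * x)))" (is ?B)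
    and "(LINT y|leb. branch_transfer u s I F y * g y) = (LINT x|lborel. indicator I x * (F x * g (u + s * x)))" (is ?C)
proof -
  let ?h = "\<lambda>y. indicator {-1..1} y * branch_transfer u s I F y"
  have h: "?h (u + s * x) = indicator I x * F x / \<bar>s\<bar>" for x
    using s image[of x] by (auto simp: branch_transfer_def indicator_def)
  have "integrable lborel (\<lambda>x. indicator I x * (indicator {-1..1} x * F x))"
    using F I unfolding integrable_leb_iff
    using integrable_real_mult_indicator[of I lborel "\<lambda>x. indicator {-1..1} x * F x"]
    by (simp add: mult.commute)
  also have "(\<lambda>x. indicator I x * (indicator {-1..1} x * F x)) = (\<lambda>x. indicator I x * F x)"
    using I by (intro ext) (auto simp: indicator_def)
  finally have IF: "integrable lborel (\<lambda>x. indicator I x * F x)" .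
  have hi: "integrable lborel ?h"
    using lborel_integrable_real_affine_iff[OF s, of ?h u] IF unfolding h by simp
  then show A: ?A unfolding integrable_leb_iff .
  have hg: "integrable lborel (\<lambda>y. indicator {-1..1} y * (branch_transfer u s I F y * g y))"
    using integrable_mult_linfty[OF A g] unfolding integrable_leb_iff .
  have hgx: "indicator {-1..1} (u + s * x) * (branch_transfer u s I F (u + s * x) * g (u + s * x))
      = (indicator I x * (F x * g (u + s * x))) / \<bar>s\<bar>" for x
    using h[of x] by (simp add: mult.assoc[symmetric])
  have "integrable lborel (\<lambda>x. (indicator I x * (F x * g (u + s * x))) / \<bar>s\<bar>)"
    using lborel_integrable_real_affine[OF hg s, of u] unfolding hgx .
  from integrable_mult_right[OF this, of "\<bar>s\<bar>"] show ?B using s by simp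
  show ?C
    unfolding integral_leb
    by (subst lborel_integral_real_affine[OF s, of _ u], unfold hgx) (use s in simp)
qed

definition tent_transfer :: "real \<Rightarrow> real \<Rightarrow> (real \<Rightarrow> real) \<Rightarrow> real \<Rightarrow> real" where
  "tent_transfer a b F y =
     branch_transfer 1 (- 2 * (1 + a)) {0..1/2} F y +
     branch_transfer (1 - 2 * (1 + a)) (2 * (1 + a)) {1/2..1} F y +
     (branch_transfer (- 1) (- 2 * (1 + b)) {-1/2..0} F y +
     branch_transfer (2 * (1 + b) - 1) (2 * (1 + b)) {-1..-1/2} F y)"

lemma tent_transfer:
  fixes F :: "real \<Rightarrow> real"
  assumes F: "integrable leb F" and a: "a \<in> {0..1}" and b: "b \<in> {0..1}"
  shows "integrable leb (tent_transfer a b F)"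
    and "g \<in> linfty \<Longrightarrow> (LINT y|leb. tent_transfer a b F y * g y) = (LINT x|leb. F x * g (paired_tent a b x))"
proof -
  have up: "(1 + c) * x \<le> 1 + c" if "c \<in> {0..1}" "x \<le> 1" for c x :: real
    using mult_left_mono[of x 1 "1 + c"] that by simp
  have one: "(1 + c) * x \<ge> 0" if "c \<in> {0..1}" "x \<ge> 0" for c x :: real
    using that by simp
  have im1: "1 + - 2 * (1 + a) * x \<in> {-1..1}" if "x \<in> {0..1/2}" for x
    using up[OF a, of "2 * x"] one[OF a, of x] that a by (simp add: algebra_simps)
  have im2: "1 - 2 * (1 + a) + 2 * (1 + a) * x \<in> {-1..1}" if "x \<in> {1/2..1}" for x
    using up[OF a, of "2 * (1 - x)"] one[OF a, of "1 - x"] that a by (simp add: algebra_simps)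
  have im3: "- 1 + - 2 * (1 + b) * x \<in> {-1..1}" if "x \<in> {-1/2..0}" for x
    using up[OF b, of "- 2 * x"] one[OF b, of "- x"] that b by (simp add: algebra_simps)
  have im4: "2 * (1 + b) - 1 + 2 * (1 + b) * x \<in> {-1..1}" if "x \<in> {-1..-1/2}" for x
    using up[OF b, of "2 * (1 + x)"] one[OF b, of "1 + x"] that b by (simp add: algebra_simps)
  have s: "- 2 * (1 + a) \<noteq> 0" "2 * (1 + a) \<noteq> 0" "- 2 * (1 + b) \<noteq> 0" "2 * (1 + b) \<noteq> 0"
    using a b by auto
  have I: "{0..1/2::real} \<subseteq> {-1..1}" "{1/2..1::real} \<subseteq> {-1..1}" "{-1/2..0::real} \<subseteq> {-1..1}"
      "{-1..-1/2::real} \<subseteq> {-1..1}"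
    and B: "{0..1/2::real} \<in> sets borel" "{1/2..1::real} \<in> sets borel" "{-1/2..0::real} \<in> sets borel"
      "{-1..-1/2::real} \<in> sets borel"
    by auto
  note b1 = branch_transfer[OF F s(1) B(1) I(1) im1] and b2 = branch_transfer[OF F s(2) B(2) I(2) im2]
    and b3 = branch_transfer[OF F s(3) B(3) I(3) im3] and b4 = branch_transfer[OF F s(4) B(4) I(4) im4]
  have zero: "(\<lambda>_. 0) \<in> linfty" by (auto simp: linfty_def)
  note i = b1(1)[OF _ zero] b2(1)[OF _ zero] b3(1)[OF _ zero] b4(1)[OF _ zero]
  show "integrable leb (tent_transfer a b F)"
    unfolding tent_transfer_def by (intro Bochner_Integration.integrable_add i)
  assume g: "g \<in> linfty"
  note j = i[THEN integrable_mult_linfty, OF _ g]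
  note k = b1(2)[OF _ g] b2(2)[OF _ g] b3(2)[OF _ g] b4(2)[OF _ g]
  have "(LINT y|leb. tent_transfer a b F y * g y) =
     (LINT x|lborel. indicator {0..1/2} x * (F x * g (1 + - 2 * (1 + a) * x))
      + indicator {1/2..1} x * (F x * g (1 - 2 * (1 + a) + 2 * (1 + a) * x))
      + (indicator {-1/2..0} x * (F x * g (- 1 + - 2 * (1 + b) * x))
      + indicator {-1..-1/2} x * (F x * g (2 * (1 + b) - 1 + 2 * (1 + b) * x))))" (is "_ = (LINT x|lborel. ?G x)")
    unfolding tent_transfer_def distrib_right
    using j k b1(3)[OF _ g] b2(3)[OF _ g] b3(3)[OF _ g] b4(3)[OF _ g]
    by simp
  also have "\<dots> = (LINT x|lborel. indicator {-1..1} x * (F x * g (paired_tent a b x)))"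
  proof -
    have eq: "AE x in lborel. ?G x = indicator {-1..1} x * (F x * g (paired_tent a b x))"
      using AE_lborel_singleton[of "1/2"] AE_lborel_singleton[of "0"] AE_lborel_singleton[of "-1/2"]
    proof eventually_elim
      case (elim x)
      have "paired_tent a b x = 1 + - 2 * (1 + a) * x" if "0 < x" "x < 1/2"
        using that by (simp add: paired_tent_def)
      moreover have "paired_tent a b x = 1 - 2 * (1 + a) + 2 * (1 + a) * x" if "1/2 < x"
        using that by (simp add: paired_tent_def algebra_simps)
      moreover have "paired_tent a b x = - 1 + - 2 * (1 + b) * x" if "x < 0" "-1/2 < x"
        using that by (simp add: paired_tent_def)
      moreover have "paired_tent a b x = 2 * (1 + b) - 1 + 2 * (1 + b) * x" if "x < - 1/2"
        using that by (simp add: paired_tent_def algebra_simps)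
      ultimately show ?case
        using elim by (simp add: indicator_def)
    qed
    let ?F = "\<lambda>x. indicator {-1..1} x * F x" and ?g = "\<lambda>x. indicator {-1..1} x * g x"
    have "?F \<in> borel_measurable borel" "?g \<in> borel_measurable borel"
      using F g borel_measurable_leb_iff by (auto simp: linfty_def)
    have "paired_tent a b x \<in> {-1..1}" if "x \<in> {-1..1}" for x
      using im1[of x] im2[of x] im3[of x] im4[of x] that
      by (auto simp: paired_tent_def algebra_simps)
    then have "indicator {-1..1} x * (F x * g (paired_tent a b x)) = ?F x * ?g (paired_tent a b x)" for x
      by (auto simp: indicator_def)
    then have eq': "(\<lambda>x. indicator {-1..1} x * (F x * g (paired_tent a b x)))
        = (\<lambda>x. ?F x * ?g (paired_tent a b x))"
      by (rule ext)
    have "(\<lambda>x. ?F x * ?g (paired_tent a b x)) \<in> borel_measurable borel"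
      by (rule borel_measurable_times[OF \<open>?F \<in> _\<close> measurable_compose[OF paired_tent_measurable \<open>?g \<in> _\<close>]])
    then have "(\<lambda>x. indicator {-1..1} x * (F x * g (paired_tent a b x))) \<in> borel_measurable lborel"
      unfolding eq' by simp
    moreover have "?G \<in> borel_measurable lborel"
      using k by (intro borel_measurable_add) auto
    ultimately show ?thesis
      by (intro integral_cong_AE eq)
  qed
  finally show "(LINT y|leb. tent_transfer a b F y * g y) = (LINT x|leb. F x * g (paired_tent a b x))"
    by (simp add: integral_leb)
qed

text \<open>The sum over the four inverse branches satisfies the defining duality, and a class is determined by
its pairings; so the definite description in the definition of the operator is this sum.\<close>

lemma pairing_perron_frobenius:
  assumes a: "a \<in> {0..1}" and b: "b \<in> {0..1}" and g: "bdd_borel g"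
  shows "pairing (perron_frobenius (paired_tent a b) f) g = pairing f (\<lambda>x. g (paired_tent a b x))"
proof -
  let ?P = "\<lambda>h. \<forall>g\<in>linfty. (LINT x|leb. rep_l1 h x * g x) = (LINT x|leb. rep_l1 f x * g (paired_tent a b x))"
  let ?h = "abs_l1 (tent_transfer a b (rep_l1 f))"
  have Ph: "?P ?h"
  proof
    fix g assume g: "g \<in> linfty"
    then have "g \<in> borel_measurable leb" by (simp add: linfty_def)
    then show "(LINT x|leb. rep_l1 ?h x * g x) = (LINT x|leb. rep_l1 f x * g (paired_tent a b x))"
      using pairing_abs_l1[OF tent_transfer(1)[OF integrable_rep_l1 a b], of g f]
        tent_transfer(2)[OF integrable_rep_l1 a b g, of f]
      by (simp add: pairing_def)
  qed
  have "perron_frobenius (paired_tent a b) f = ?h"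
    unfolding perron_frobenius_def
  proof (rule the_equality[of ?P, OF Ph])
    fix h assume h: "?P h"
    show "h = ?h"
    proof (rule pairing_eqI)
      fix g assume "bdd_borel g"
      then have "g \<in> linfty" by (rule bdd_borel_linfty)
      then show "pairing h g = pairing ?h g"
        using h Ph by (simp add: pairing_def)
    qed
  qed
  then show ?thesis
    using Ph bdd_borel_linfty[OF g] by (simp add: pairing_def)
qed

section \<open>The Lasota--Yorke inequality and the leaking mass\<close>

definition mass_right :: "l1 \<Rightarrow> real" where
  "mass_right f = pairing f (indicator {0<..})"

definition mass_left :: "l1 \<Rightarrow> real" where
  "mass_left f = pairing f (indicator {..<0})"

text \<open>An upper bound for the dual weighted variation, as a predicate: the supremum itself is never
formed, so its finiteness is never an issue.\<close>

definition var_le :: "(real \<Rightarrow> real) \<Rightarrow> l1 \<Rightarrow> real \<Rightarrow> bool" where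
  "var_le w f c \<longleftrightarrow> (\<forall>g. paired_test w g \<longrightarrow> pairing f g \<le> c)"

lemma paired_test_bdd_borel: "paired_test w g \<Longrightarrow> bdd_borel g"
  by (simp add: paired_test_def half_test_def)

lemma half_test_mono:
  "half_test w k \<Longrightarrow> (\<And>x. 0 \<le> x \<Longrightarrow> x \<le> 1 \<Longrightarrow> w x \<le> w' x) \<Longrightarrow> half_test w' k"
  by (auto simp: half_test_def intro: order_trans)

lemma paired_test_mono:
  "paired_test w g \<Longrightarrow> (\<And>x. 0 \<le> x \<Longrightarrow> x \<le> 1 \<Longrightarrow> w x \<le> w' x) \<Longrightarrow> paired_test w' g"
  unfolding paired_test_def using half_test_mono by blast

lemma paired_test_cmult:
  "paired_test w g \<Longrightarrow> paired_test (\<lambda>x. \<bar>c\<bar> * w x) (\<lambda>x. c * g x)"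
  unfolding paired_test_def using half_test_cmult by blast

text \<open>The case \<open>\<theta> = 0\<close>, which occurs when there is no leak, follows from the others by letting the factor
decrease to \<open>0\<close>.\<close>

lemma var_leD_scaled:
  assumes f: "var_le w f c" and w: "\<And>x. 0 \<le> x \<Longrightarrow> x \<le> 1 \<Longrightarrow> 0 \<le> w x"
    and \<theta>: "0 \<le> \<theta>" and g: "paired_test (\<lambda>x. \<theta> * w x) g"
  shows "\<bar>pairing f g\<bar> \<le> \<theta> * c"
proof -
  have pos: "\<bar>pairing f g\<bar> \<le> d * c" if "\<theta> \<le> d" "0 < d" for d
  proof -
    have *: "s * pairing f g \<le> d * c" if "\<bar>s\<bar> = 1" for s
    proof -
      have "paired_test (\<lambda>x. \<bar>s / d\<bar> * (\<theta> * w x)) (\<lambda>x. s / d * g x)"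
        by (rule paired_test_cmult[OF g])
      then have "paired_test w (\<lambda>x. s / d * g x)"
      proof (rule paired_test_mono)
        fix x :: real assume "0 \<le> x" "x \<le> 1"
        then have "\<theta> * w x \<le> d * w x"
          using w \<open>\<theta> \<le> d\<close> by (intro mult_right_mono) auto
        then show "\<bar>s / d\<bar> * (\<theta> * w x) \<le> w x"
          using \<open>0 < d\<close> \<open>\<bar>s\<bar> = 1\<close> by (simp add: field_simps)
      qed
      then have "s / d * pairing f g \<le> c"
        using f pairing_cmult_right[of f "s / d" g] unfolding var_le_def by metis
      then show ?thesis using \<open>0 < d\<close> by (simp add: field_simps)
    qed
    show ?thesis using *[of 1] *[of "-1"] by simp
  qed
  show ?thesis
  proof (cases "\<theta> = 0")
    case False
    then show ?thesis using pos[of \<theta>] \<theta> by simp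
  next
    case True
    have "((\<lambda>d. d * c) \<longlongrightarrow> 0 * c) (at_right 0)"
      by (intro tendsto_intros)
    moreover have "eventually (\<lambda>d. \<bar>pairing f g\<bar> \<le> d * c) (at_right 0)"
      using True pos by (auto simp: eventually_at_right_field intro: exI[of _ 1])
    ultimately have "\<bar>pairing f g\<bar> \<le> 0 * c"
      by (intro tendsto_lowerbound) auto
    then show ?thesis using True by simp
  qed
qed

lemma weight_nonneg: "0 \<le> weight e \<alpha> x"
  by (simp add: weight_def)

lemma pairing_two_constants:
  "pairing f (\<lambda>x. if 0 \<le> x then c else c') = c * mass_right f + c' * mass_left f"
proof -
  have "pairing f (\<lambda>x. if 0 \<le> x then c else c')
      = pairing f (\<lambda>x. c * indicator {0<..} x + c' * indicator {..<0} x)"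
  proof (rule pairing_cong_AE[where S = "{0}"])
    show "bdd_borel (\<lambda>x::real. if 0 \<le> x then c else c')"
      by (rule bdd_borelI[where C = "max \<bar>c\<bar> \<bar>c'\<bar>"]) auto
  qed (auto intro!: bdd_borel_add bdd_borel_cmult bdd_borel_indicator)
  also have "\<dots> = c * mass_right f + c' * mass_left f"
    by (simp add: pairing_add_right bdd_borel_cmult bdd_borel_indicator pairing_cmult_right
        mass_right_def mass_left_def)
  finally show ?thesis .
qed

lemma bdd_borel_two_constants: "bdd_borel (\<lambda>x::real. if 0 \<le> x then c else c' :: real)"
  by (rule bdd_borelI[where C = "max \<bar>c\<bar> \<bar>c'\<bar>"]) auto

text \<open>Pairing the image of \<open>f\<close> with \<open>g\<close> is pairing \<open>f\<close> with \<open>g \<circ> T\<close>. After subtraction of a constant on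
each half, \<open>g \<circ> T\<close> is again a test function, for the weight multiplied by \<open>contraction e \<alpha>\<close>; the two constants
are at most \<open>e powr \<alpha>\<close> and are integrated against the masses of \<open>f\<close>.\<close>

lemma lasota_yorke:
  assumes a: "a \<in> {0..e}" "b \<in> {0..e}" and e: "0 < e" "e \<le> 1/2" and \<alpha>: "0 < \<alpha>" "\<alpha> \<le> 1"
    and f: "var_le (weight e \<alpha>) f c"
  shows "var_le (weight e \<alpha>) (perron_frobenius (paired_tent a b) f)
    (contraction e \<alpha> * c + e powr \<alpha> * (\<bar>mass_right f\<bar> + \<bar>mass_left f\<bar>))"
  unfolding var_le_def
proof (intro allI impI)
  fix g assume g: "paired_test (weight e \<alpha>) g"
  obtain c1 c2 where c12: "\<bar>c1\<bar> \<le> e powr \<alpha>" "\<bar>c2\<bar> \<le> e powr \<alpha>"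
    and t: "paired_test (\<lambda>x. contraction e \<alpha> * weight e \<alpha> x)
      (\<lambda>x. g (paired_tent a b x) - (if 0 \<le> x then c1 else c2))"
    using paired_test_tent[OF g a e \<alpha>] by blast
  have gT: "bdd_borel (\<lambda>x. g (paired_tent a b x))"
    using paired_test_bdd_borel[OF g] by (rule bdd_borel_compose) simp
  have "pairing (perron_frobenius (paired_tent a b) f) g = pairing f (\<lambda>x. g (paired_tent a b x))"
    using a e by (intro pairing_perron_frobenius paired_test_bdd_borel[OF g]) auto
  also have "\<dots> = pairing f (\<lambda>x. g (paired_tent a b x) - (if 0 \<le> x then c1 else c2))
      + (c1 * mass_right f + c2 * mass_left f)"
    using pairing_diff_right[OF gT bdd_borel_two_constants, of f c1 c2]
    by (simp add: pairing_two_constants)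
  also have "\<dots> \<le> contraction e \<alpha> * c + (e powr \<alpha> * \<bar>mass_right f\<bar> + e powr \<alpha> * \<bar>mass_left f\<bar>)"
  proof (intro add_mono)
    show "pairing f (\<lambda>x. g (paired_tent a b x) - (if 0 \<le> x then c1 else c2)) \<le> contraction e \<alpha> * c"
      using var_leD_scaled[OF f _ _ t] by (simp add: weight_nonneg contraction_def)
    show "c1 * mass_right f \<le> e powr \<alpha> * \<bar>mass_right f\<bar>"
      by (rule order_trans[OF abs_ge_self], unfold abs_mult, intro mult_right_mono) (use c12 in auto)
    show "c2 * mass_left f \<le> e powr \<alpha> * \<bar>mass_left f\<bar>"
      by (rule order_trans[OF abs_ge_self], unfold abs_mult, intro mult_right_mono) (use c12 in auto)
  qed
  finally show "pairing (perron_frobenius (paired_tent a b) f) g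
      \<le> contraction e \<alpha> * c + e powr \<alpha> * (\<bar>mass_right f\<bar> + \<bar>mass_left f\<bar>)"
    by (simp add: distrib_left)
qed

lemma total_mass_perron_frobenius:
  assumes "a \<in> {0..1}" "b \<in> {0..1}"
  shows "mass_right (perron_frobenius (paired_tent a b) f) + mass_left (perron_frobenius (paired_tent a b) f)
    = mass_right f + mass_left f"
  using pairing_perron_frobenius[OF assms, of "\<lambda>_. 1" f] pairing_two_constants[of _ 1 1]
  by (simp add: bdd_borel_const)

text \<open>Mass crosses \<open>0\<close> exactly through the two windows. Replacing the indicator of a window by its mean
\<open>p\<close> or \<open>q\<close> on its half leaves a test function for \<open>p\<close> or \<open>q\<close> times the weight, and the means contribute the
stated multiples of the masses.\<close>

lemma mass_right_perron_frobenius: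
  fixes a b e \<alpha> :: real
  defines "p \<equiv> a / (1 + a)" and "q \<equiv> b / (1 + b)"
  assumes a: "a \<in> {0..1}" "b \<in> {0..1}" and \<alpha>: "0 < \<alpha>" "\<alpha> \<le> 1" and e: "0 < e"
    and f: "var_le (weight e \<alpha>) f c"
  shows "\<bar>mass_right (perron_frobenius (paired_tent a b) f)
    - ((1 - p) * mass_right f + q * mass_left f)\<bar> \<le> (p + q) * c"
proof -
  have pq: "0 \<le> p" "p \<le> 1/2" "0 \<le> q" "q \<le> 1/2"
    using a by (auto simp: p_def q_def field_simps)
  define K where "K x = (if 0 \<le> x then - (leak p x - p) else leak q (- x) - q)" for x
  have bK: "bdd_borel K"
  proof -
    have "K = (\<lambda>x. (if 0 \<le> x then p else - q) + (if 0 \<le> x then - 1 else 0) * leak p x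
        + (if 0 \<le> x then 0 else 1) * leak q (- x))"
      by (auto simp: K_def)
    moreover have "bdd_borel (\<lambda>x. (if 0 \<le> x then p else - q) + (if 0 \<le> x then - 1 else 0) * leak p x
        + (if 0 \<le> x then 0 else 1) * leak q (- x))"
      by (intro bdd_borel_add bdd_borel_mult bdd_borel_two_constants bdd_borel_leak
          bdd_borel_reflect[OF bdd_borel_leak])
    ultimately show ?thesis by simp
  qed
  have test: "paired_test (\<lambda>x. (p + q) * weight e \<alpha> x) K"
    unfolding paired_test_def
  proof
    have "half_test (\<lambda>x. \<bar>- 1\<bar> * (p * weight e \<alpha> x)) (\<lambda>x. (- 1) * (leak p x - p))"
      by (rule half_test_cmult[OF half_test_leak[OF pq(1,2) \<alpha> e]])
    then have "half_test (\<lambda>x. \<bar>- 1\<bar> * (p * weight e \<alpha> x)) K"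
      by (rule half_test_cong[OF _ bK]) (simp add: K_def)
    then show "half_test (\<lambda>x. (p + q) * weight e \<alpha> x) K"
      by (rule half_test_mono) (use pq weight_nonneg in \<open>auto intro!: mult_right_mono\<close>)
    have "half_test (\<lambda>x. q * weight e \<alpha> x) (\<lambda>x. K (- x))"
      by (rule half_test_cong[OF half_test_leak[OF pq(3,4) \<alpha> e] bdd_borel_reflect[OF bK]]) (simp add: K_def)
    then show "half_test (\<lambda>x. (p + q) * weight e \<alpha> x) (\<lambda>x. K (- x))"
      by (rule half_test_mono) (use pq weight_nonneg in \<open>auto intro!: mult_right_mono\<close>)
  qed
  have tent: "paired_tent c d x = 2 * (1 + c) * (\<bar>x - 1/2\<bar> - c / (1 + c) / 2)"
    if "0 < x" "0 \<le> c" for c d x :: real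
  proof -
    have "2 * (1 + c) * (t - r / 2) = 2 * (1 + c) * t - (1 + c) * r" for t r :: real
      by (simp add: algebra_simps)
    moreover have "(1 + c) * (c / (1 + c)) = c" using that by simp
    ultimately have "2 * (1 + c) * (\<bar>x - 1/2\<bar> - c / (1 + c) / 2) = 2 * (1 + c) * \<bar>x - 1/2\<bar> - c"
      by metis
    then show ?thesis
      using that by (simp add: paired_tent_def abs_if algebra_simps)
  qed
  have right: "0 < paired_tent c d x \<longleftrightarrow> c / (1 + c) / 2 < \<bar>x - 1/2\<bar>"
      and null: "paired_tent c d x = 0 \<longleftrightarrow> c / (1 + c) / 2 = \<bar>x - 1/2\<bar>"
    if "0 < x" "0 \<le> c" for c d x :: real
    unfolding tent[OF that] using that by (auto simp: zero_less_mult_iff)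
  have "mass_right (perron_frobenius (paired_tent a b) f)
      = pairing f (\<lambda>x. indicator {0<..} (paired_tent a b x))"
    unfolding mass_right_def by (intro pairing_perron_frobenius a bdd_borel_indicator) simp
  \<comment> \<open>At the endpoints of the windows, which are sent to \<open>0\<close>, and at \<open>0\<close> the two sides may differ.\<close>
  also have "\<dots> = pairing f (\<lambda>x. K x + (if 0 \<le> x then 1 - p else q))"
  proof (rule pairing_cong_AE[where S = "{0, 1/2 - p/2, 1/2 + p/2, - 1/2 - q/2, - 1/2 + q/2}"])
    show "bdd_borel (\<lambda>x. indicator {0<..} (paired_tent a b x))"
      by (rule bdd_borel_compose[OF bdd_borel_indicator]) auto
    show "bdd_borel (\<lambda>x. K x + (if 0 \<le> x then 1 - p else q))"
      by (intro bdd_borel_add bK bdd_borel_two_constants)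
    fix x assume x: "x \<in> {-1..1} - {0, 1/2 - p/2, 1/2 + p/2, - 1/2 - q/2, - 1/2 + q/2}"
    show "indicator {0<..} (paired_tent a b x) = K x + (if 0 \<le> x then 1 - p else q)"
    proof (cases "0 < x")
      case True
      have "\<bar>x - 1/2\<bar> \<noteq> p / 2" using x by (auto simp: abs_if split: if_splits)
      then show ?thesis
        using right[OF True, of a b] True a by (auto simp: K_def leak_def p_def[symmetric])
    next
      case False
      then have x0: "0 < - x" using x by auto
      have "\<bar>- x - 1/2\<bar> \<noteq> q / 2" using x by (auto simp: abs_if split: if_splits)
      then have "0 < paired_tent a b x \<longleftrightarrow> \<bar>- x - 1/2\<bar> < q / 2"
        using right[OF x0, of b a] null[OF x0, of b a] a by (auto simp: paired_tent_odd q_def[symmetric])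
      then show ?thesis
        using x0 by (auto simp: K_def leak_def)
    qed
  qed simp
  also have "\<dots> = pairing f K + ((1 - p) * mass_right f + q * mass_left f)"
    by (simp add: pairing_add_right bK bdd_borel_two_constants pairing_two_constants)
  finally show ?thesis
    using var_leD_scaled[OF f _ _ test] pq by (simp add: weight_nonneg)
qed

section \<open>Variation, monotone decomposition and finiteness on BV\<close>

abbreviation list_variation :: "(real \<Rightarrow> real) \<Rightarrow> real list \<Rightarrow> real" where
  "list_variation u xs \<equiv> (\<Sum>i<length xs - 1. \<bar>u (xs ! Suc i) - u (xs ! i)\<bar>)"

lemma variation_on_le_iff:
  assumes "0 \<le> c"
  shows "variation_on S u \<le> ennreal c \<longleftrightarrow> (\<forall>xs. sorted xs \<longrightarrow> set xs \<subseteq> S \<longrightarrow> list_variation u xs \<le> c)"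
  using assms by (auto simp: variation_on_def SUP_le_iff)

lemma list_variation_append:
  "list_variation u xs + \<bar>u y - u x\<bar> \<le> list_variation u (xs @ [x, y])"
proof -
  let ?n = "length xs"
  have "list_variation u xs = (\<Sum>i<?n - 1. \<bar>u ((xs @ [x, y]) ! Suc i) - u ((xs @ [x, y]) ! i)\<bar>)"
    by (rule sum.cong) (auto simp: nth_append)
  moreover have "\<bar>u y - u x\<bar> = (\<Sum>i\<in>{?n}. \<bar>u ((xs @ [x, y]) ! Suc i) - u ((xs @ [x, y]) ! i)\<bar>)"
    by (simp add: nth_append)
  ultimately have "list_variation u xs + \<bar>u y - u x\<bar>
      = (\<Sum>i\<in>{..<?n - 1} \<union> {?n}. \<bar>u ((xs @ [x, y]) ! Suc i) - u ((xs @ [x, y]) ! i)\<bar>)"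
    by (subst sum.union_disjoint) auto
  also have "\<dots> \<le> list_variation u (xs @ [x, y])"
    by (rule sum_mono2) auto
  finally show ?thesis .
qed

text \<open>Here \<open>p\<close> is the variation of \<open>u\<close> over the part of \<open>E\<close> up to \<open>x\<close>, and \<open>q\<close> extends \<open>p - u\<close> from \<open>E\<close> to the line
monotonically. The set \<open>E\<close> is general because \<open>u\<close> may be under control only on a set of full measure; the
difference \<open>p - q\<close> then extends it with comparable variation.\<close>

lemma jordan_decomposition:
  fixes u :: "real \<Rightarrow> real"
  assumes "variation_on E u \<le> ennreal c" and c: "0 \<le> c"
  obtains p q where "mono p" "mono q" "\<And>x. x \<in> E \<Longrightarrow> u x = p x - q x"
    "\<And>x y. p y - p x \<le> c" "\<And>x y. q y - q x \<le> 4 * c"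
    "\<And>x. \<bar>p x\<bar> \<le> c" "\<exists>C. \<forall>x. \<bar>q x\<bar> \<le> C"
proof (cases "E = {}")
  case True
  show thesis
    by (rule that[of "\<lambda>_. 0" "\<lambda>_. 0"]) (use True c in \<open>auto simp: mono_def\<close>)
next
  case False
  then obtain e0 where e0: "e0 \<in> E" by auto
  have var: "list_variation u xs \<le> c" if "sorted xs" "set xs \<subseteq> E" for xs
    using assms that by (simp add: variation_on_le_iff)
  define A where "A x = list_variation u ` {xs. sorted xs \<and> set xs \<subseteq> E \<inter> {..x}}" for x
  define p where "p x = Sup (A x)" for x
  have A0: "0 \<in> A x" for x
    unfolding A_def by (intro image_eqI[of _ _ "[]"]) auto
  have Abdd: "bdd_above (A x)" for x
    using var by (auto simp: A_def bdd_above_def intro!: exI[of _ c])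
  have p0: "0 \<le> p x" and pc: "p x \<le> c" for x
    using A0[of x] Abdd[of x] var by (auto simp: p_def A_def intro!: cSup_upper cSup_least)
  have pmono: "mono p"
  proof (rule monoI)
    fix x y :: real assume "x \<le> y"
    then have "A x \<subseteq> A y" unfolding A_def by (intro image_mono) auto
    then show "p x \<le> p y"
      unfolding p_def using A0[of x] Abdd[of y] by (intro cSup_subset_mono) auto
  qed
  have step: "p x + \<bar>u y - u x\<bar> \<le> p y" if xy: "x \<in> E" "y \<in> E" "x \<le> y" for x y
  proof -
    have "p x \<le> p y - \<bar>u y - u x\<bar>"
      unfolding p_def[of x]
    proof (rule cSup_least)
      show "A x \<noteq> {}" using A0 by blast
      fix v assume "v \<in> A x"
      then obtain xs where xs: "v = list_variation u xs" "sorted xs" "set xs \<subseteq> E \<inter> {..x}"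
        by (auto simp: A_def)
      then have "list_variation u (xs @ [x, y]) \<in> A y"
        using xy unfolding A_def by (intro imageI) (auto simp: sorted_append)
      then have "list_variation u (xs @ [x, y]) \<le> p y"
        unfolding p_def by (rule cSup_upper[OF _ Abdd])
      then show "v \<le> p y - \<bar>u y - u x\<bar>"
        using list_variation_append[of u xs y x] xs(1) by linarith
    qed
    then show ?thesis by simp
  qed
  define q0 where "q0 x = p x - u x" for x
  have q0mono: "q0 x \<le> q0 y" if "x \<in> E" "y \<in> E" "x \<le> y" for x y
    using step[OF that] by (simp add: q0_def)
  have q0c: "\<bar>q0 y - q0 x\<bar> \<le> 2 * c" if "x \<in> E" "y \<in> E" for x y
  proof (cases "x \<le> y")
    case True
    then show ?thesis using step[of x y] that p0[of x] pc[of y] by (auto simp: q0_def abs_le_iff)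
  next
    case False
    then show ?thesis using step[of y x] that p0[of y] pc[of x] by (auto simp: q0_def abs_le_iff)
  qed
  \<comment> \<open>The inserted element lies below all values of \<open>q0\<close> on \<open>E\<close>; it makes the supremum meaningful to the left of \<open>E\<close>.\<close>
  define Q where "Q x = insert (q0 e0 - 2 * c) (q0 ` (E \<inter> {..x}))" for x
  define q where "q x = Sup (Q x)" for x
  have Qb: "v \<le> q0 e0 + 2 * c" if "v \<in> Q x" for v x
    using that q0c[OF e0] c unfolding Q_def by (auto simp: abs_le_iff) (smt (verit))
  then have Qbdd: "bdd_above (Q x)" for x
    by (auto simp: bdd_above_def)
  have q1: "q0 e0 - 2 * c \<le> q x" for x
    unfolding q_def by (rule cSup_upper[OF _ Qbdd]) (simp add: Q_def)
  have q2: "q x \<le> q0 e0 + 2 * c" for x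
    unfolding q_def by (rule cSup_least) (use Qb in \<open>auto simp: Q_def\<close>)
  have qmono: "mono q"
  proof (rule monoI)
    fix x y :: real assume "x \<le> y"
    then have "Q x \<subseteq> Q y" by (auto simp: Q_def)
    then show "q x \<le> q y"
      unfolding q_def using Qbdd[of y] by (intro cSup_subset_mono) (auto simp: Q_def)
  qed
  have qE: "q x = q0 x" if "x \<in> E" for x
    unfolding q_def
  proof (rule cSup_eq_maximum)
    show "q0 x \<in> Q x" using that by (auto simp: Q_def)
    show "v \<le> q0 x" if "v \<in> Q x" for v
      using that q0c[OF e0 \<open>x \<in> E\<close>] q0mono[OF _ \<open>x \<in> E\<close>] by (auto simp: Q_def abs_le_iff)
  qed
  show thesis
  proof (rule that[OF pmono qmono])
    show "u x = p x - q x" if "x \<in> E" for x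
      using qE[OF that] by (simp add: q0_def)
    show "p y - p x \<le> c" for x y using p0[of x] pc[of y] by simp
    show "q y - q x \<le> 4 * c" for x y using q1[of x] q2[of y] by simp
    show "\<bar>p x\<bar> \<le> c" for x using p0[of x] pc[of x] by simp
    show "\<exists>C. \<forall>x. \<bar>q x\<bar> \<le> C"
      using q1 q2 by (intro exI[of _ "\<bar>q0 e0\<bar> + 2 * c"]) (auto simp: abs_le_iff, (smt (verit))+)
  qed
qed

lemma list_variation_mono:
  assumes p: "mono p" and osc: "\<And>x y. p y - p x \<le> c" and xs: "sorted xs"
  shows "list_variation p xs \<le> c"
proof -
  have "list_variation p xs = (\<Sum>i<length xs - 1. p (xs ! Suc i) - p (xs ! i))"
    using monoD[OF p sorted_nth_mono[OF xs]] by (intro sum.cong) auto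
  also have "\<dots> = p (xs ! (length xs - 1)) - p (xs ! 0)"
    by (rule sum_lessThan_telescope)
  finally show ?thesis using osc by simp
qed

lemma variation_on_mono_diff:
  assumes "mono p" "mono q" "\<And>x y. p y - p x \<le> c" "\<And>x y. q y - q x \<le> d"
    and "\<And>x. x \<in> S \<Longrightarrow> u x = p x - q x"
  shows "variation_on S u \<le> ennreal (c + d)"
proof -
  have cd: "0 \<le> c + d" using assms(3)[of 0 0] assms(4)[of 0 0] by simp
  have "list_variation u xs \<le> c + d" if "sorted xs" "set xs \<subseteq> S" for xs
  proof -
    have "list_variation u xs \<le> (\<Sum>i<length xs - 1. \<bar>p (xs ! Suc i) - p (xs ! i)\<bar> + \<bar>q (xs ! Suc i) - q (xs ! i)\<bar>)"
    proof (rule sum_mono)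
      fix i assume "i \<in> {..<length xs - 1}"
      then have "xs ! i \<in> S" "xs ! Suc i \<in> S"
        using that by (auto simp: subset_iff)
      then show "\<bar>u (xs ! Suc i) - u (xs ! i)\<bar> \<le> \<bar>p (xs ! Suc i) - p (xs ! i)\<bar> + \<bar>q (xs ! Suc i) - q (xs ! i)\<bar>"
        by (simp add: assms(5))
    qed
    also have "\<dots> \<le> c + d"
      unfolding sum.distrib using assms that by (intro add_mono list_variation_mono) auto
    finally show ?thesis .
  qed
  then show ?thesis by (simp add: variation_on_le_iff cd)
qed

text \<open>By the second mean value theorem the integral equals \<open>p 0 * K c + p 1 * (K 1 - K c)\<close> for some \<open>c\<close>, where \<open>K\<close>
is the primitive of \<open>k\<close>; and \<open>K 1 = 0\<close>.\<close>

lemma set_integral_mono_half_test: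
  assumes p: "mono p" "bdd_borel p" and k: "half_test w k" and w: "\<And>x. 0 \<le> x \<Longrightarrow> x \<le> 1 \<Longrightarrow> w x \<le> 1"
  shows "\<bar>LBINT t:{0..1}. p t * k t\<bar> \<le> p 1 - p 0"
proof -
  have kb: "bdd_borel k" and k1: "(LBINT t:{0..1}. k t) = 0"
    and kx: "\<And>x. 0 \<le> x \<Longrightarrow> x \<le> 1 \<Longrightarrow> \<bar>LBINT t:{0..x}. k t\<bar> \<le> 1"
    using half_test_mono[OF k w] by (auto simp: half_test_def)
  have ki: "k integrable_on {c..d}" and kI: "integral {c..d} k = (LBINT t:{c..d}. k t)" for c d
    using set_borel_integral_eq_integral[OF bdd_borel_set_integrable[OF kb, of c d]] by auto
  obtain c where c: "c \<in> {0..1}"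
    "((\<lambda>x. p x * k x) has_integral (p 0 * integral {0..c} k + p 1 * integral {c..1} k)) {0..1}"
    using second_mean_value_theorem_full[OF ki[of 0 1], of p] monoD[OF p(1)] by auto
  have "(LBINT t:{0..1}. p t * k t) = p 0 * integral {0..c} k + p 1 * integral {c..1} k"
    using set_borel_integral_eq_integral[OF bdd_borel_set_integrable[OF bdd_borel_mult[OF p(2) kb], of 0 1]]
      integral_unique[OF c(2)] by simp
  also have "integral {c..1} k = - integral {0..c} k"
    using set_integral_Icc_split[OF kb, of 0 c 1] c(1) k1 by (simp add: kI)
  finally have "(LBINT t:{0..1}. p t * k t) = - ((p 1 - p 0) * (LBINT t:{0..c}. k t))"
    by (simp add: kI algebra_simps)
  then have "\<bar>LBINT t:{0..1}. p t * k t\<bar> = (p 1 - p 0) * \<bar>LBINT t:{0..c}. k t\<bar>"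
    using monoD[OF p(1), of 0 1] by (simp add: abs_mult)
  also have "\<dots> \<le> (p 1 - p 0) * 1"
    using kx[of c] c(1) monoD[OF p(1), of 0 1] by (intro mult_left_mono) auto
  finally show ?thesis by simp
qed

lemma pairing_split:
  fixes u g :: "real \<Rightarrow> real"
  assumes "bdd_borel u" "bdd_borel g"
  shows "(LINT x|leb. u x * g x) = (LBINT t:{0..1}. u t * g t) + (LBINT t:{0..1}. u (- t) * g (- t))"
proof -
  have "(LINT x|leb. u x * g x) = (LBINT t:{-1..1}. u t * g t)"
    by (simp add: integral_leb set_lebesgue_integral_def)
  also have "\<dots> = (LBINT t:{-1..0}. u t * g t) + (LBINT t:{0..1}. u t * g t)"
    by (rule set_integral_Icc_split) (auto intro: bdd_borel_mult assms)
  finally show ?thesis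
    using set_integral_Icc_reflect[where g = "\<lambda>t. u t * g t" and x = 1] by simp
qed

lemma bdd_borel_mono: "mono p \<Longrightarrow> \<exists>C. \<forall>x. \<bar>p x\<bar> \<le> C \<Longrightarrow> bdd_borel p"
  by (simp add: bdd_borel_def borel_measurable_mono)

text \<open>Split a representative into monotone parts \<open>r\<close>. On the reflected left half \<open>- r (- t)\<close> is monotone again.\<close>

lemma var_le_BV:
  assumes f: "f \<in> BV" and w: "\<And>x. 0 \<le> x \<Longrightarrow> x \<le> 1 \<Longrightarrow> w x \<le> 1"
  shows "\<exists>c\<ge>0. var_le w f c"
proof -
  obtain u where u: "integrable leb u" "abs_l1 u = f" "variation_on {-1..1} u < \<infinity>"
    using f by (auto simp: BV_def representatives_def)
  obtain c where c: "0 \<le> c" "variation_on {-1..1} u \<le> ennreal c"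
    using u(3) by (cases "variation_on {-1..1} u") auto
  obtain p q where pq: "mono p" "mono q" "\<And>x. x \<in> {-1..1} \<Longrightarrow> u x = p x - q x"
    "\<And>x y. p y - p x \<le> c" "\<And>x y. q y - q x \<le> 4 * c" "\<And>x. \<bar>p x\<bar> \<le> c" "\<exists>C. \<forall>x. \<bar>q x\<bar> \<le> C"
    using jordan_decomposition[OF c(2,1)] by metis
  have bp: "bdd_borel p" and bq: "bdd_borel q"
    using pq(1,2,6,7) by (auto intro: bdd_borel_mono)
  have one: "\<bar>LINT x|leb. r x * g x\<bar> \<le> 2 * d"
    if r: "mono r" "bdd_borel r" "\<And>x y. r y - r x \<le> d" and g: "paired_test w g" for r g d
  proof -
    have "\<bar>LBINT t:{0..1}. r t * g t\<bar> \<le> r 1 - r 0"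
      using g w by (intro set_integral_mono_half_test[where w = w] r) (auto simp: paired_test_def)
    moreover have "\<bar>LBINT t:{0..1}. (- r (- t)) * g (- t)\<bar> \<le> (- r (- 1)) - (- r (- 0))"
    proof (rule set_integral_mono_half_test[where w = w])
      show "mono (\<lambda>t. - r (- t))" using r(1) by (simp add: mono_def)
      show "bdd_borel (\<lambda>t. - r (- t))"
        using bdd_borel_cmult[OF bdd_borel_reflect[OF r(2)], of "-1"] by simp
    qed (use g w in \<open>auto simp: paired_test_def\<close>)
    ultimately show ?thesis
      using r(3)[of 1 0] r(3)[of 0 "-1"] pairing_split[OF r(2) paired_test_bdd_borel[OF g]]
      by (simp add: set_lebesgue_integral_def)
  qed
  have "pairing f g \<le> 10 * c" if g: "paired_test w g" for g
  proof -
    have gb: "bdd_borel g" using paired_test_bdd_borel[OF g] .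
    have int: "integrable leb (\<lambda>x. r x * g x)" if "bdd_borel r" for r
      using bdd_borel_set_integrable[OF bdd_borel_mult[OF that gb], of "-1" 1]
      by (simp add: integrable_leb_iff set_integrable_def)
    have "pairing f g = (LINT x|leb. u x * g x)"
      using pairing_abs_l1[OF u(1) bdd_borel_measurable_leb[OF gb]] u(2) by simp
    also have "\<dots> = (LINT x|leb. p x * g x - q x * g x)"
      by (rule Bochner_Integration.integral_cong) (auto simp: space_leb pq(3) left_diff_distrib)
    also have "\<dots> = (LINT x|leb. p x * g x) - (LINT x|leb. q x * g x)"
      using int[OF bp] int[OF bq] by simp
    also have "\<dots> \<le> 2 * c + 2 * (4 * c)"
      using one[OF pq(1) bp pq(4) g] one[OF pq(2) bq pq(5) g] by linarith
    finally show ?thesis by simp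
  qed
  then show ?thesis
    unfolding var_le_def using c(1) by (intro exI[of _ "10 * c"]) auto
qed

section \<open>Cell averages\<close>

lemma abs_set_integral_Icc_le:
  assumes "bdd_borel h" "\<And>t. \<bar>h t\<bar> \<le> C" "c \<le> d"
  shows "\<bar>LBINT t:{c..d}. h t\<bar> \<le> C * (d - c)"
proof -
  have "\<bar>LBINT t:{c..d}. h t\<bar> \<le> (LBINT t:{c..d}. \<bar>h t\<bar>)"
    using set_integral_norm_bound[OF bdd_borel_set_integrable[OF assms(1)], of c d] by simp
  also have "\<dots> \<le> (LBINT t:{c..d}. C)"
    using assms(2) set_integrable_abs[OF bdd_borel_set_integrable[OF assms(1), of c d]]
      bdd_borel_set_integrable[OF bdd_borel_const, of c d C]
    by (intro set_integral_mono) auto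
  finally show ?thesis using assms(3) by (simp add: set_integral_Icc_const mult.commute)
qed

lemma set_integral_Icc_sum:
  fixes f :: "'i \<Rightarrow> real \<Rightarrow> real"
  assumes "finite A" "\<And>i. i \<in> A \<Longrightarrow> bdd_borel (f i)"
  shows "(LBINT t:{c..d}. (\<Sum>i\<in>A. f i t)) = (\<Sum>i\<in>A. (LBINT t:{c..d}. f i t))"
  using assms
proof (induction A rule: finite_induct)
  case empty
  show ?case by (simp add: set_lebesgue_integral_def)
next
  case (insert i A)
  have "set_integrable lborel {c..d} (f i)" "set_integrable lborel {c..d} (\<lambda>t. \<Sum>i\<in>A. f i t)"
    using insert by (auto intro!: bdd_borel_set_integrable bdd_borel_sum)
  then show ?case
    using insert by (simp add: set_integral_add)
qed

text \<open>The conditional expectation with respect to the partition into intervals of length \<open>1 / N\<close>.\<close>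

definition cell_avg :: "nat \<Rightarrow> (real \<Rightarrow> real) \<Rightarrow> real \<Rightarrow> real" where
  "cell_avg N \<psi> x = real N * (LBINT t:{of_int \<lfloor>N * x\<rfloor> / N..(of_int \<lfloor>N * x\<rfloor> + 1) / N}. \<psi> t)"

lemma cell_avg_measurable: "cell_avg N \<psi> \<in> borel_measurable borel"
proof -
  let ?F = "\<lambda>j::int. real N * (LBINT t:{of_int j / N..(of_int j + 1) / N}. \<psi> t)"
  have "(\<lambda>x. ?F \<lfloor>real N * x\<rfloor>) \<in> borel_measurable borel"
  proof (rule measurable_compose[where g = ?F])
    show "(\<lambda>x. \<lfloor>real N * x\<rfloor>) \<in> borel \<rightarrow>\<^sub>M count_space UNIV" by measurable
  qed simp
  then show ?thesis by (simp add: cell_avg_def[abs_def])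
qed

lemma abs_cell_avg_le:
  assumes "bdd_borel \<psi>" "\<And>t. \<bar>\<psi> t\<bar> \<le> 1" "0 < N"
  shows "\<bar>cell_avg N \<psi> x\<bar> \<le> 1"
proof -
  let ?j = "real_of_int \<lfloor>N * x\<rfloor>"
  have le: "?j / N \<le> (?j + 1) / N" by (intro divide_right_mono) auto
  have "\<bar>cell_avg N \<psi> x\<bar> = N * \<bar>LBINT t:{?j / N..(?j + 1) / N}. \<psi> t\<bar>"
    by (simp add: cell_avg_def abs_mult)
  also have "\<dots> \<le> N * (1 * ((?j + 1) / N - ?j / N))"
    using abs_set_integral_Icc_le[OF assms(1,2) le] by (intro mult_left_mono) auto
  also have "\<dots> = 1" using assms(3) by (simp add: field_simps)
  finally show ?thesis .
qed

lemma bdd_borel_cell_avg: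
  assumes "integrable lborel \<phi>"
  shows "bdd_borel (cell_avg N \<phi>)"
proof (rule bdd_borelI[OF cell_avg_measurable])
  fix x
  let ?I = "{of_int \<lfloor>real N * x\<rfloor> / real N..(of_int \<lfloor>real N * x\<rfloor> + 1) / real N}"
  have "\<bar>LBINT t:?I. \<phi> t\<bar> \<le> (LINT t|lborel. \<bar>indicator ?I t * \<phi> t\<bar>)"
    unfolding set_lebesgue_integral_def real_scaleR_def by (rule integral_abs_bound)
  also have "\<dots> \<le> (LINT t|lborel. \<bar>\<phi> t\<bar>)"
    using assms integrable_mult_indicator[OF _ assms, of ?I]
    by (intro integral_mono integrable_abs) (auto simp: indicator_def)
  finally show "\<bar>cell_avg N \<phi> x\<bar> \<le> real N * (LINT t|lborel. \<bar>\<phi> t\<bar>)"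
    by (simp add: cell_avg_def abs_mult mult_left_mono)
qed

lemma cell_avg_eq:
  assumes "0 < N" "real j / N < x" "x < (real j + 1) / N"
  shows "cell_avg N \<psi> x = N * (LBINT t:{j / N..(real j + 1) / N}. \<psi> t)"
proof -
  have "\<lfloor>real N * x\<rfloor> = int j"
    using assms by (intro floor_unique) (auto simp: field_simps)
  then show ?thesis by (simp add: cell_avg_def)
qed

lemma set_integral_cells:
  fixes h :: "real \<Rightarrow> real"
  assumes h: "integrable lborel h" and N: "0 < N"
  shows "(LBINT t:{0..1}. h t) = (\<Sum>j<N. (LBINT t:{real j / N..(real j + 1) / N}. h t))"
proof -
  have hi: "set_integrable lborel {c..d} h" for c d
    unfolding set_integrable_def using integrable_mult_indicator[OF _ h, of "{c..d}"] by simp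
  have "(LBINT t:{0..real m / N}. h t) = (\<Sum>j<m. (LBINT t:{real j / N..(real j + 1) / N}. h t))" for m
  proof (induction m)
    case 0
    have "AE t in lborel. indicator {0..0} t *\<^sub>R h t = 0"
      using AE_lborel_singleton[of "0::real"] by eventually_elim (simp add: indicator_def)
    then show ?case
      by (simp add: set_lebesgue_integral_def integral_eq_zero_AE)
  next
    case (Suc m)
    have le: "0 \<le> real m / N" "real m / N \<le> (real m + 1) / N"
      by (auto intro: divide_right_mono)
    then have un: "{0..(real m + 1) / N} = {0..real m / N} \<union> {real m / N..(real m + 1) / N}"
      by (auto intro: order_trans[OF le(1)])
    have "AE t in lborel. \<not> (t \<in> {0..real m / N} \<and> t \<in> {real m / N..(real m + 1) / N})"
      using AE_lborel_singleton[of "real m / N"] by eventually_elim auto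
    then have "(LBINT t:{0..(real m + 1) / N}. h t)
        = (LBINT t:{0..real m / N}. h t) + (LBINT t:{real m / N..(real m + 1) / N}. h t)"
      unfolding un by (intro set_integral_Un_AE hi) auto
    then show ?case using Suc.IH by (simp add: add.commute)
  qed
  from this[of N] N show ?thesis by simp
qed

lemma set_integral_cell_avg:
  fixes \<psi> h :: "real \<Rightarrow> real"
  assumes "0 < N" and [measurable]: "h \<in> borel_measurable borel"
  shows "(LBINT t:{real j / N..(real j + 1) / N}. cell_avg N \<psi> t * h t)
    = N * (LBINT t:{real j / N..(real j + 1) / N}. \<psi> t) * (LBINT t:{real j / N..(real j + 1) / N}. h t)"
proof -
  have [measurable]: "cell_avg N \<psi> \<in> borel_measurable borel" by (rule cell_avg_measurable)
  have "(LBINT t:{real j / N..(real j + 1) / N}. cell_avg N \<psi> t * h t)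
    = (LBINT t:{real j / N..(real j + 1) / N}. (N * (LBINT t:{real j / N..(real j + 1) / N}. \<psi> t)) * h t)"
    by (rule set_integral_Icc_cong) (use assms(1) in \<open>auto simp: cell_avg_eq\<close>)
  then show ?thesis by simp
qed

lemma cell_avg_selfadjoint:
  assumes \<phi>: "integrable lborel \<phi>" and \<psi>: "bdd_borel \<psi>" and N: "0 < N"
    and supp: "\<And>x. x \<notin> {0..1} \<Longrightarrow> \<psi> x = 0"
  shows "(LBINT t:{0..1}. cell_avg N \<phi> t * \<psi> t) = (LBINT t:{0..1}. cell_avg N \<psi> t * \<phi> t)"
proof -
  have \<psi>i: "integrable lborel \<psi>"
  proof -
    have "(\<lambda>x. indicator {0..1} x *\<^sub>R \<psi> x) = \<psi>"
    proof
      fix x show "indicator {0..1} x *\<^sub>R \<psi> x = \<psi> x"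
        using supp[of x] by (cases "x \<in> {0..1}") auto
    qed
    then show ?thesis
      using bdd_borel_set_integrable[OF \<psi>, of 0 1] by (simp add: set_integrable_def)
  qed
  have prod: "integrable lborel (\<lambda>t. f t * h t)" if "bdd_borel f" "integrable lborel h" for f h
  proof -
    obtain C where C: "\<And>x. \<bar>f x\<bar> \<le> C" and [measurable]: "f \<in> borel_measurable borel"
      using \<open>bdd_borel f\<close> by (auto simp: bdd_borel_def)
    have "\<bar>f x * h x\<bar> \<le> \<bar>C * h x\<bar>" for x
      unfolding abs_mult by (rule mult_right_mono[OF order_trans[OF C abs_ge_self] abs_ge_zero])
    moreover have [measurable]: "h \<in> borel_measurable borel" using that(2) by auto
    ultimately show ?thesis
      by (intro Bochner_Integration.integrable_bound[OF integrable_mult_right[OF that(2), of C]]) auto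
  qed
  have m: "\<phi> \<in> borel_measurable borel" "\<psi> \<in> borel_measurable borel"
    using \<phi> \<psi> by (auto simp: bdd_borel_def)
  show ?thesis
    unfolding set_integral_cells[OF prod[OF bdd_borel_cell_avg[OF \<phi>] \<psi>i] N]
      set_integral_cells[OF prod[OF bdd_borel_cell_avg[OF \<psi>i] \<phi>] N]
      set_integral_cell_avg[OF N m(1)] set_integral_cell_avg[OF N m(2)]
    by (simp add: mult_ac)
qed

text \<open>Averaging does not change the integral over a cell, so the primitive of the difference vanishes at
all multiples of \<open>1 / N\<close>, and between them it cannot exceed \<open>2 / N\<close>.\<close>

lemma half_test_cell_avg:
  assumes \<psi>: "bdd_borel \<psi>" "\<And>t. \<bar>\<psi> t\<bar> \<le> 1" and N: "0 < N"
  shows "half_test (\<lambda>_. 2 / N) (\<lambda>x. cell_avg N \<psi> x - \<psi> x)"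
proof -
  let ?k = "\<lambda>x. cell_avg N \<psi> x - \<psi> x"
  have ab: "bdd_borel (cell_avg N \<psi>)"
    by (rule bdd_borelI[OF cell_avg_measurable abs_cell_avg_le[OF \<psi> N]])
  have kb: "bdd_borel ?k" by (rule bdd_borel_diff[OF ab \<psi>(1)])
  have k2: "\<bar>?k t\<bar> \<le> 2" for t
    using abs_cell_avg_le[OF \<psi> N, of t] \<psi>(2)[of t] by linarith
  have zero: "(LBINT t:{0..real j / N}. ?k t) = 0" for j
  proof (induction j)
    case 0
    then show ?case using set_integral_Icc_split[OF kb, of 0 0 0] by simp
  next
    case (Suc j)
    have le: "real j / N \<le> (real j + 1) / N" by (intro divide_right_mono) auto
    have "(LBINT t:{real j / N..(real j + 1) / N}. cell_avg N \<psi> t * 1)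
        = N * (LBINT t:{real j / N..(real j + 1) / N}. \<psi> t) * (LBINT t:{real j / N..(real j + 1) / N}. 1)"
      by (rule set_integral_cell_avg[OF N]) simp
    also have "(LBINT t:{real j / N..(real j + 1) / N}. 1) = (real j + 1) / N - real j / N"
      using set_integral_Icc_const[OF le, of 1] by simp
    also have "\<dots> = 1 / N" by (simp add: diff_divide_distrib[symmetric])
    finally have "(LBINT t:{real j / N..(real j + 1) / N}. ?k t) = 0"
      using N by (simp add: set_integral_Icc_diff[OF ab \<psi>(1)])
    then show ?case
      using set_integral_Icc_split[OF kb _ le, of 0] Suc.IH by (simp add: add.commute)
  qed
  have "\<bar>LBINT t:{0..x}. ?k t\<bar> \<le> 2 / N" if x: "0 \<le> x" for x
  proof -
    define j where "j = nat \<lfloor>N * x\<rfloor>"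
    have "real j = of_int \<lfloor>N * x\<rfloor>" using x by (simp add: j_def)
    then have j: "real j \<le> N * x" "N * x < real j + 1" by linarith+
    then have "real j / N \<le> x" "x \<le> (real j + 1) / N"
      using N by (simp_all add: pos_divide_le_eq pos_le_divide_eq mult.commute)
    then have j': "real j / N \<le> x" "x - real j / N \<le> 1 / N" by (simp_all add: add_divide_distrib)
    have "(LBINT t:{0..x}. ?k t) = (LBINT t:{real j / N..x}. ?k t)"
      using set_integral_Icc_split[OF kb _ j'(1), of 0] zero[of j] by simp
    also have "\<bar>\<dots>\<bar> \<le> 2 * (x - real j / N)"
      by (rule abs_set_integral_Icc_le[OF kb k2 j'(1)])
    finally show ?thesis using j'(2) by simp
  qed
  moreover have "(LBINT t:{0..1}. ?k t) = 0" using zero[of N] N by simp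
  ultimately show ?thesis using kb by (auto simp: half_test_def)
qed

lemma set_integral_indicator_cell:
  assumes "0 < N" "0 \<le> x"
  shows "real N * (LBINT t:{0..x}. indicator {real_of_int (int j) / N..(real_of_int (int j) + 1) / N} t)
    = max 0 (min (N * x - j) 1)"
proof -
  have le: "real j / N \<le> (real j + 1) / N" by (intro divide_right_mono) auto
  have "(LBINT t:{0..x}. indicator {real_of_int (int j) / N..(real_of_int (int j) + 1) / N} t)
      = (LINT t|lborel. indicator {real j / N..min x ((real j + 1) / N)} t :: real)"
    unfolding set_lebesgue_integral_def
    by (rule Bochner_Integration.integral_cong)
      (auto simp: indicator_def intro: order_trans[of 0 "real j / real N"])
  also have "\<dots> = max 0 (min x ((real j + 1) / N) - real j / N)"
    by (simp add: max_def)
  finally show ?thesis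
    using assms by (simp add: max_def min_def field_simps)
qed

text \<open>The variation along \<open>xs\<close> is the pairing of \<open>\<phi>\<close> with a signed sum of differences of normalised
indicators of cells. The primitive \<open>\<beta>\<close> of such an indicator decreases when the cell moves to the right, so
the primitives of the differences all have one sign and their sum telescopes to at most \<open>1\<close>.\<close>

lemma list_variation_cell_avg:
  assumes \<phi>: "integrable lborel \<phi>" and N: "0 < N" 
    and H: "\<And>k. half_test (\<lambda>_. 1) k \<Longrightarrow> \<bar>LINT x|lborel. \<phi> x * k x\<bar> \<le> c"
    and xs: "sorted xs" "set xs \<subseteq> {0..<1}"
  shows "list_variation (cell_avg N \<phi>) xs \<le> c"
proof -
  let ?f = "cell_avg N \<phi>"
  define m where "m = length xs - 1"
  define J where "J i = nat \<lfloor>N * xs ! i\<rfloor>" for i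
  define K :: "nat \<Rightarrow> real \<Rightarrow> real" where "K i = indicator {real_of_int (int (J i)) / N..(real_of_int (int (J i)) + 1) / N}" for i
  define \<theta> where "\<theta> i = sgn (?f (xs ! Suc i) - ?f (xs ! i))" for i
  define k where "k t = (\<Sum>i<m. (\<theta> i * N) * (K (Suc i) t - K i t))" for t
  have x01: "0 \<le> xs ! i" "xs ! i < 1" if "i < length xs" for i
    using xs(2) nth_mem[OF that] by (auto simp: subset_iff)
  have Jf: "int (J i) = \<lfloor>N * xs ! i\<rfloor>" if "i < length xs" for i
    using x01[OF that] by (simp add: J_def)
  have JN: "J i < N" if "i < length xs" for i
  proof -
    have "real N * xs ! i < N" using x01[OF that] N by simp
    then have "\<lfloor>real N * xs ! i\<rfloor> < int N" by (simp add: floor_less_iff)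
    then show ?thesis using Jf[OF that] by simp
  qed
  have Jmono: "J i \<le> J (Suc i)" if "i < m" for i
  proof -
    have "xs ! i \<le> xs ! Suc i" using that xs(1) by (intro sorted_nth_mono) (auto simp: m_def)
    then have "real N * xs ! i \<le> real N * xs ! Suc i" by (rule mult_left_mono) simp
    then show ?thesis unfolding J_def by (intro nat_mono floor_mono)
  qed
  have Kb: "bdd_borel (K i)" for i
    unfolding K_def by (rule bdd_borel_indicator) simp
  have f: "?f (xs ! i) = N * (LINT t|lborel. \<phi> t * K i t)" if "i < length xs" for i
    using Jf[OF that] by (simp add: cell_avg_def K_def set_lebesgue_integral_def mult.commute)
  have Ki: "integrable lborel (\<lambda>t. \<phi> t * K i t)" for i
    unfolding K_def using \<phi> by (intro integrable_real_mult_indicator) auto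
  define \<beta> where "\<beta> i x = max 0 (min (N * x - J i) 1)" for i and x :: real
  have \<beta>: "N * (LBINT t:{0..x}. K i t) = \<beta> i x" if "0 \<le> x" for i x
    unfolding K_def \<beta>_def by (rule set_integral_indicator_cell[OF N that])
  have kx: "(LBINT t:{0..x}. k t) = (\<Sum>i<m. \<theta> i * (\<beta> (Suc i) x - \<beta> i x))" if "0 \<le> x" for x
  proof -
    have "(LBINT t:{0..x}. k t) = (\<Sum>i<m. LBINT t:{0..x}. (\<theta> i * N) * (K (Suc i) t - K i t))"
      unfolding k_def by (intro set_integral_Icc_sum) (auto intro!: bdd_borel_cmult bdd_borel_diff Kb)
    also have "\<dots> = (\<Sum>i<m. \<theta> i * (\<beta> (Suc i) x - \<beta> i x))"
    proof (rule sum.cong[OF refl])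
      fix i
      have "(LBINT t:{0..x}. (\<theta> i * N) * (K (Suc i) t - K i t))
          = \<theta> i * N * ((LBINT t:{0..x}. K (Suc i) t) - (LBINT t:{0..x}. K i t))"
        by (simp only: set_integral_mult_right set_integral_Icc_diff[OF Kb Kb])
      then show "(LBINT t:{0..x}. (\<theta> i * N) * (K (Suc i) t - K i t)) = \<theta> i * (\<beta> (Suc i) x - \<beta> i x)"
        by (simp add: \<beta>[OF that, symmetric] algebra_simps)
    qed
    finally show ?thesis .
  qed
  have "half_test (\<lambda>_. 1) k"
    unfolding half_test_def
  proof (intro conjI ballI)
    show "bdd_borel k"
      unfolding k_def by (intro bdd_borel_sum bdd_borel_cmult bdd_borel_diff Kb) simp
    fix x :: real assume x: "x \<in> {0..1}"
    have \<beta>le: "\<beta> (Suc i) x \<le> \<beta> i x" if "i < m" for i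
      using Jmono[OF that] by (auto simp: \<beta>_def)
    have "\<bar>LBINT t:{0..x}. k t\<bar> \<le> (\<Sum>i<m. \<bar>\<theta> i * (\<beta> (Suc i) x - \<beta> i x)\<bar>)"
      using x by (simp add: kx)
    also have "\<dots> \<le> (\<Sum>i<m. \<beta> i x - \<beta> (Suc i) x)"
      using \<beta>le by (intro sum_mono) (auto simp: abs_mult \<theta>_def sgn_if)
    also have "\<dots> = \<beta> 0 x - \<beta> m x" by (rule sum_lessThan_telescope')
    also have "\<dots> \<le> 1" by (simp add: \<beta>_def)
    finally show "\<bar>LBINT t:{0..x}. k t\<bar> \<le> 1" .
  next
    have "\<beta> i 1 = 1" if "i < length xs" for i
      using JN[OF that] by (simp add: \<beta>_def)
    then show "(LBINT t:{0..1}. k t) = 0"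
      by (auto simp: kx m_def intro!: sum.neutral)
  qed
  then have "\<bar>LINT x|lborel. \<phi> x * k x\<bar> \<le> c" by (rule H)
  also have "(LINT x|lborel. \<phi> x * k x) = (\<Sum>i<m. \<theta> i * (?f (xs ! Suc i) - ?f (xs ! i)))"
  proof -
    have "(LINT x|lborel. \<phi> x * k x) = (LINT x|lborel. (\<Sum>i<m. (\<theta> i * N) * (\<phi> x * K (Suc i) x - \<phi> x * K i x)))"
      by (simp add: k_def sum_distrib_left algebra_simps)
    also have "\<dots> = (\<Sum>i<m. (\<theta> i * N) * ((LINT x|lborel. \<phi> x * K (Suc i) x) - (LINT x|lborel. \<phi> x * K i x)))"
      using Ki by (subst Bochner_Integration.integral_sum) auto
    also have "\<dots> = (\<Sum>i<m. \<theta> i * (?f (xs ! Suc i) - ?f (xs ! i)))"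
      by (intro sum.cong) (auto simp: f m_def algebra_simps)
    finally show ?thesis .
  qed
  also have "\<dots> = list_variation ?f xs"
    unfolding m_def by (intro sum.cong) (auto simp: \<theta>_def sgn_if)
  finally show ?thesis by simp
qed

section \<open>From dual variation to the norm of BV\<close>

text \<open>Test the difference against its sign \<open>\<psi>\<close>. Averaging is self-adjoint, so this is \<open>\<phi>\<close> paired with the
average of \<open>\<psi>\<close> minus \<open>\<psi>\<close>, a test function of size \<open>2 / N\<close>. The dual variation thus gives a rate of
convergence in the mean, without approximation by continuous functions.\<close>

lemma cell_avg_L1_convergence:
  assumes \<phi>: "integrable lborel \<phi>" and supp: "\<And>x. x \<notin> {0..1} \<Longrightarrow> \<phi> x = 0" and N: "0 < N"
    and H: "\<And>k. half_test (\<lambda>_. 1) k \<Longrightarrow> \<bar>LINT x|lborel. \<phi> x * k x\<bar> \<le> c"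
  shows "(LINT x|lborel. \<bar>indicator {0..1} x * (cell_avg N \<phi> x - \<phi> x)\<bar>) \<le> 2 / N * c"
proof -
  define D where "D x = indicator {0..1} x * (cell_avg N \<phi> x - \<phi> x)" for x
  define \<psi> where "\<psi> x = sgn (D x)" for x
  have fb: "bdd_borel (cell_avg N \<phi>)" by (rule bdd_borel_cell_avg[OF \<phi>])
  have [measurable]: "\<phi> \<in> borel_measurable borel" "cell_avg N \<phi> \<in> borel_measurable borel"
    using \<phi> cell_avg_measurable by auto
  have "\<psi> \<in> borel_measurable borel"
    unfolding \<psi>_def D_def by measurable
  then have \<psi>b: "bdd_borel \<psi>"
    by (rule bdd_borelI[where C = 1]) (simp add: \<psi>_def sgn_if)
  have \<psi>1: "\<bar>\<psi> x\<bar> \<le> 1" for x by (simp add: \<psi>_def sgn_if)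
  have \<psi>0: "\<psi> x = 0" if "x \<notin> {0..1}" for x using that by (simp add: \<psi>_def D_def)
  have supp': "indicator {0..1} x * \<phi> x = \<phi> x" for x
    using supp[of x] by (cases "x \<in> {0..1}") auto
  have i1: "integrable lborel (\<lambda>x. indicator {0..1} x * (cell_avg N \<phi> x * \<psi> x))"
    using bdd_borel_set_integrable[OF bdd_borel_mult[OF fb \<psi>b], of 0 1] by (simp add: set_integrable_def)
  have bound: "integrable lborel (\<lambda>x. \<phi> x * g x)" if "\<And>x. \<bar>g x\<bar> \<le> 1" "g \<in> borel_measurable borel" for g
  proof (rule Bochner_Integration.integrable_bound[OF \<phi>])
    show "AE x in lborel. norm (\<phi> x * g x) \<le> norm (\<phi> x)"
      using that(1) by (simp add: abs_mult mult_left_le)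
  qed (use that(2) in simp)
  have ab1: "\<bar>cell_avg N \<psi> x\<bar> \<le> 1" for x by (rule abs_cell_avg_le[OF \<psi>b \<psi>1 N])
  have i2: "integrable lborel (\<lambda>x. \<phi> x * \<psi> x)" "integrable lborel (\<lambda>x. \<phi> x * cell_avg N \<psi> x)"
    using bound[OF \<psi>1 bdd_borel_measurable[OF \<psi>b]] bound[OF ab1 cell_avg_measurable] by auto
  have "(LINT x|lborel. \<bar>D x\<bar>) = (LINT x|lborel. indicator {0..1} x * (cell_avg N \<phi> x * \<psi> x) - \<phi> x * \<psi> x)"
  proof (rule Bochner_Integration.integral_cong)
    fix x
    have "\<bar>D x\<bar> = D x * \<psi> x" by (simp add: \<psi>_def sgn_if)
    also have "\<dots> = indicator {0..1} x * (cell_avg N \<phi> x * \<psi> x) - (indicator {0..1} x * \<phi> x) * \<psi> x"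
      by (simp add: D_def algebra_simps)
    finally show "\<bar>D x\<bar> = indicator {0..1} x * (cell_avg N \<phi> x * \<psi> x) - \<phi> x * \<psi> x"
      by (simp only: supp')
  qed simp
  also have "\<dots> = (LBINT x:{0..1}. cell_avg N \<phi> x * \<psi> x) - (LINT x|lborel. \<phi> x * \<psi> x)"
    using i1 i2 by (simp add: set_lebesgue_integral_def)
  also have "(LBINT x:{0..1}. cell_avg N \<phi> x * \<psi> x) = (LBINT x:{0..1}. cell_avg N \<psi> x * \<phi> x)"
    by (rule cell_avg_selfadjoint[OF \<phi> \<psi>b N \<psi>0])
  also have "\<dots> = (LINT x|lborel. \<phi> x * cell_avg N \<psi> x)"
    unfolding set_lebesgue_integral_def
  proof (rule Bochner_Integration.integral_cong)
    fix x
    show "indicator {0..1} x *\<^sub>R (cell_avg N \<psi> x * \<phi> x) = \<phi> x * cell_avg N \<psi> x"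
      using supp[of x] by (cases "x \<in> {0..1}") auto
  qed simp
  also have "\<dots> - (LINT x|lborel. \<phi> x * \<psi> x) = (LINT x|lborel. \<phi> x * (cell_avg N \<psi> x - \<psi> x))"
    using i2 by (simp add: right_diff_distrib)
  also have "\<dots> \<le> 2 / N * c"
  proof -
    have "half_test (\<lambda>x. \<bar>N / 2\<bar> * (2 / N)) (\<lambda>x. N / 2 * (cell_avg N \<psi> x - \<psi> x))"
      by (rule half_test_cmult[OF half_test_cell_avg[OF \<psi>b \<psi>1 N]])
    then have "half_test (\<lambda>x. 1) (\<lambda>x. N / 2 * (cell_avg N \<psi> x - \<psi> x))"
      using N by simp
    from H[OF this] have "\<bar>N / 2 * (LINT x|lborel. \<phi> x * (cell_avg N \<psi> x - \<psi> x))\<bar> \<le> c"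
      by (simp only: mult.left_commute[of "\<phi> _"] Bochner_Integration.integral_mult_right_zero)
    then have "N / 2 * (LINT x|lborel. \<phi> x * (cell_avg N \<psi> x - \<psi> x)) \<le> c" by (rule abs_le_D1)
    then show ?thesis using N by (simp add: pos_le_divide_eq mult.commute)
  qed
  finally show ?thesis by (simp add: D_def)
qed

text \<open>Some subsequence of the cell averages converges almost everywhere. On the set of convergence the
limit inherits the bound for the variation, and the Jordan decomposition extends it to the interval.\<close>

lemma dual_variation_representative:
  assumes \<phi>: "integrable lborel \<phi>" and supp: "\<And>x. x \<notin> {0..1} \<Longrightarrow> \<phi> x = 0"
    and H: "\<And>k. half_test (\<lambda>_. 1) k \<Longrightarrow> \<bar>LINT x|lborel. \<phi> x * k x\<bar> \<le> c"
  obtains p q where "mono p" "mono q" "AE x in lborel. x \<in> {0..1} \<longrightarrow> \<phi> x = p x - q x"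
    "\<And>x y. p y - p x \<le> c" "\<And>x y. q y - q x \<le> 4 * c"
proof -
  have c: "0 \<le> c"
    using H[of "\<lambda>_. 0"] by (simp add: half_test_def bdd_borel_const set_lebesgue_integral_def)
  let ?u = "\<lambda>n x. indicator {0..1} x * (cell_avg (Suc n) \<phi> x - \<phi> x)"
  have ui: "integrable lborel (?u n)" for n
  proof -
    have "set_integrable lborel {0..1} (cell_avg (Suc n) \<phi>)"
      by (rule bdd_borel_set_integrable[OF bdd_borel_cell_avg[OF \<phi>]])
    moreover have "set_integrable lborel {0..1} \<phi>"
      unfolding set_integrable_def by (rule integrable_mult_indicator[OF _ \<phi>]) simp
    ultimately have "set_integrable lborel {0..1} (\<lambda>x. cell_avg (Suc n) \<phi> x - \<phi> x)"
      by (rule set_integral_diff)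
    then show ?thesis by (simp add: set_integrable_def)
  qed
  have lim: "(\<lambda>n. (LINT x|lborel. norm (?u n x))) \<longlonglongrightarrow> 0"
  proof (rule tendsto_sandwich[of "\<lambda>_. 0"])
    show "eventually (\<lambda>n. (LINT x|lborel. norm (?u n x)) \<le> 2 / real (Suc n) * c) sequentially"
      unfolding real_norm_def
      by (intro always_eventually allI cell_avg_L1_convergence[OF \<phi> supp zero_less_Suc H])
    have "(\<lambda>n. 2 * c * inverse (real (Suc n))) \<longlonglongrightarrow> 2 * c * 0"
      by (intro tendsto_mult tendsto_const LIMSEQ_inverse_real_of_nat)
    then show "(\<lambda>n. 2 / real (Suc n) * c) \<longlonglongrightarrow> 0"
      by (simp add: field_simps)
  qed auto
  obtain r where r: "AE x in lborel. (\<lambda>n. ?u (r n) x) \<longlonglongrightarrow> 0"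
    using tendsto_L1_AE_subseq[OF ui lim] by auto
  define E where "E = {x \<in> {0..<1}. (\<lambda>n. cell_avg (Suc (r n)) \<phi> x) \<longlonglongrightarrow> \<phi> x}"
  have EA: "AE x in lborel. x \<in> {0..1} \<longrightarrow> x \<in> E"
    using r AE_lborel_singleton[of 1]
  proof eventually_elim
    case (elim x)
    then show ?case
      by (auto simp: E_def LIM_zero_iff)
  qed
  have "list_variation \<phi> xs \<le> c" if xs: "sorted xs" "set xs \<subseteq> E" for xs
  proof (rule LIMSEQ_le_const2)
    show "(\<lambda>n. list_variation (cell_avg (Suc (r n)) \<phi>) xs) \<longlonglongrightarrow> list_variation \<phi> xs"
    proof (intro tendsto_sum tendsto_rabs tendsto_diff)
      fix i assume i: "i \<in> {..<length xs - 1}"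
      have "xs ! j \<in> E" if "j < length xs" for j using that xs by auto
      then have *: "(\<lambda>n. cell_avg (Suc (r n)) \<phi> (xs ! j)) \<longlonglongrightarrow> \<phi> (xs ! j)" if "j < length xs" for j
        using that by (auto simp: E_def)
      show "(\<lambda>n. cell_avg (Suc (r n)) \<phi> (xs ! Suc i)) \<longlonglongrightarrow> \<phi> (xs ! Suc i)"
        "(\<lambda>n. cell_avg (Suc (r n)) \<phi> (xs ! i)) \<longlonglongrightarrow> \<phi> (xs ! i)"
        using i by (auto intro!: *)
    qed
    have "set xs \<subseteq> {0..<1}" using xs by (auto simp: E_def)
    then show "\<exists>N. \<forall>n\<ge>N. list_variation (cell_avg (Suc (r n)) \<phi>) xs \<le> c"
      using list_variation_cell_avg[OF \<phi> zero_less_Suc H xs(1)] by blast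
  qed
  then have "variation_on E \<phi> \<le> ennreal c"
    using c by (simp add: variation_on_le_iff)
  then obtain p q where pq: "mono p" "mono q" "\<And>x. x \<in> E \<Longrightarrow> \<phi> x = p x - q x"
    "\<And>x y. p y - p x \<le> c" "\<And>x y. q y - q x \<le> 4 * c"
    using jordan_decomposition[OF _ c] by metis
  show thesis
    by (rule that[OF pq(1,2) _ pq(4,5)]) (use EA pq(3) in \<open>auto elim: eventually_mono\<close>)
qed

text \<open>Subtracting its means from a sign function of \<open>f\<close> leaves a test function for the constant weight \<open>2\<close>,
and the means are at most \<open>1\<close>.\<close>

lemma norm_le_var:
  assumes A: "\<And>g. paired_test (\<lambda>_. 1) g \<Longrightarrow> \<bar>pairing f g\<bar> \<le> c"
  shows "norm f \<le> 2 * c + \<bar>mass_right f\<bar> + \<bar>mass_left f\<bar>"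
proof -
  obtain g where g: "bdd_borel g" "\<And>x. \<bar>g x\<bar> \<le> 1" "pairing f g = norm f"
    using norm_l1_attained by metis
  define m1 where "m1 = (LBINT t:{0..1}. g t)"
  define m2 where "m2 = (LBINT t:{0..1}. g (- t))"
  have m: "\<bar>m1\<bar> \<le> 1" "\<bar>m2\<bar> \<le> 1"
    using abs_set_integral_Icc_le[OF g(1,2), of 0 1] abs_set_integral_Icc_le[OF bdd_borel_reflect[OF g(1)] g(2), of 0 1]
    by (auto simp: m1_def m2_def)
  define k where "k x = g x - (if 0 \<le> x then m1 else m2)" for x
  have kb: "bdd_borel k"
    unfolding k_def by (intro bdd_borel_diff g bdd_borel_two_constants)
  have half: "half_test (\<lambda>_. 2) (\<lambda>x. h x - (LBINT t:{0..1}. h t))" if h: "bdd_borel h" "\<And>x. \<bar>h x\<bar> \<le> 1" for h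
    unfolding half_test_def
  proof (intro conjI ballI)
    let ?m = "LBINT t:{0..1}. h t"
    show b: "bdd_borel (\<lambda>x. h x - ?m)" by (intro bdd_borel_diff h bdd_borel_const)
    have "\<bar>?m\<bar> \<le> 1" using abs_set_integral_Icc_le[OF h, of 0 1] by simp
    then have le: "\<bar>h t - ?m\<bar> \<le> 2" for t using h(2)[of t] by linarith
    fix x :: real assume "x \<in> {0..1}"
    then show "\<bar>LBINT t:{0..x}. h t - ?m\<bar> \<le> 2"
      using abs_set_integral_Icc_le[OF b le, of 0 x] by simp
  next
    show "(LBINT t:{0..1}. h t - (LBINT t:{0..1}. h t)) = 0"
      by (simp add: set_integral_Icc_diff h bdd_borel_const set_integral_Icc_const)
  qed
  have "paired_test (\<lambda>_. 2) k"
    unfolding paired_test_def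
  proof
    show "half_test (\<lambda>_. 2) k"
      by (rule half_test_cong[OF half[OF g(1,2)] kb]) (simp add: k_def m1_def)
    show "half_test (\<lambda>_. 2) (\<lambda>x. k (- x))"
      by (rule half_test_cong[OF half[OF bdd_borel_reflect[OF g(1)] g(2)] bdd_borel_reflect[OF kb]])
        (simp add: k_def m2_def)
  qed
  from paired_test_cmult[OF this, of "1/2"] have "paired_test (\<lambda>_. 1) (\<lambda>x. 1/2 * k x)" by simp
  from A[OF this] have "\<bar>pairing f k\<bar> \<le> 2 * c"
    using pairing_cmult_right[of f "1/2" k] by simp
  moreover have "pairing f k = norm f - (m1 * mass_right f + m2 * mass_left f)"
    unfolding k_def using pairing_diff_right[OF g(1) bdd_borel_two_constants, of f m1 m2] g(3)
    by (simp add: pairing_two_constants)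
  moreover have "m1 * mass_right f \<le> 1 * \<bar>mass_right f\<bar>"
    by (rule order_trans[OF abs_ge_self], unfold abs_mult, intro mult_right_mono) (use m in auto)
  moreover have "m2 * mass_left f \<le> 1 * \<bar>mass_left f\<bar>"
    by (rule order_trans[OF abs_ge_self], unfold abs_mult, intro mult_right_mono) (use m in auto)
  ultimately show ?thesis by linarith
qed

lemma integrable_lborel_half:
  fixes u :: "real \<Rightarrow> real"
  assumes "integrable leb u"
  shows "integrable lborel (\<lambda>x. indicator {0..1} x * u x)"
    "integrable lborel (\<lambda>x. indicator {0..1} x * u (- x))"
proof -
  have u: "integrable lborel (\<lambda>x. indicator {-1..1} x * u x)"
    using assms by (simp add: integrable_leb_iff)
  have u': "integrable lborel (\<lambda>x. indicator {-1..1} (- x) * u (- x))"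
    using lborel_integrable_real_affine[OF u, of "-1" 0] by simp
  have e: "indicator {0..1} x *\<^sub>R (indicator {-1..1} x * u x) = indicator {0..1} x * u x"
    "indicator {0..1} x *\<^sub>R (indicator {-1..1} (- x) * u (- x)) = indicator {0..1} x * u (- x)" for x
    by (auto simp: indicator_def)
  show "integrable lborel (\<lambda>x. indicator {0..1} x * u x)"
    "integrable lborel (\<lambda>x. indicator {0..1} x * u (- x))"
    using integrable_mult_indicator[OF _ u, of "{0..1}"] integrable_mult_indicator[OF _ u', of "{0..1}"]
    unfolding e by simp_all
qed

lemma pairing_half:
  assumes k: "bdd_borel k"
  shows "pairing f (\<lambda>x. if 0 < x then k x else 0) = (LINT x|lborel. (indicator {0..1} x * rep_l1 f x) * k x)"
    and "pairing f (\<lambda>x. if x < 0 then k (- x) else 0) = (LINT x|lborel. (indicator {0..1} x * rep_l1 f (- x)) * k x)"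
proof -
  have [measurable]: "k \<in> borel_measurable borel" using k by (rule bdd_borel_measurable)
  have [measurable]: "(\<lambda>x. indicator {0..1} x * rep_l1 f x) \<in> borel_measurable borel"
    "(\<lambda>x. indicator {0..1} x * rep_l1 f (- x)) \<in> borel_measurable borel"
    using integrable_lborel_half[OF integrable_rep_l1[of f]] by auto
  have 1: "indicator {-1..1} x * (rep_l1 f x * (if 0 < x then k x else 0))
      = indicator {0<..1} x * ((indicator {0..1} x * rep_l1 f x) * k x)" for x
    by (auto simp: indicator_def)
  show "pairing f (\<lambda>x. if 0 < x then k x else 0) = (LINT x|lborel. (indicator {0..1} x * rep_l1 f x) * k x)"
    unfolding pairing_def integral_leb 1
  proof (rule integral_cong_AE)
    show "AE x in lborel. indicator {0<..1} x * ((indicator {0..1} x * rep_l1 f x) * k x)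
        = (indicator {0..1} x * rep_l1 f x) * k x"
      using AE_lborel_singleton[of 0] by eventually_elim (auto simp: indicator_def)
  qed measurable
  let ?G = "\<lambda>x. indicator {-1..1} x * (rep_l1 f x * (if x < 0 then k (- x) else 0))"
  have aff: "(LINT x|lborel. G x) = (LINT x|lborel. G (- x))" for G :: "real \<Rightarrow> real"
    using lborel_integral_real_affine[of "-1" G 0] by simp
  have 2: "?G (- x) = indicator {0<..1} x * ((indicator {0..1} x * rep_l1 f (- x)) * k x)" for x
    by (auto simp: indicator_def)
  have "pairing f (\<lambda>x. if x < 0 then k (- x) else 0) = (LINT x|lborel. ?G x)"
    by (simp only: pairing_def integral_leb)
  also have "\<dots> = (LINT x|lborel. ?G (- x))"
    by (rule aff)
  also have "\<dots> = (LINT x|lborel. indicator {0<..1} x * ((indicator {0..1} x * rep_l1 f (- x)) * k x))"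
    by (simp only: 2)
  also have "\<dots> = (LINT x|lborel. (indicator {0..1} x * rep_l1 f (- x)) * k x)"
  proof (rule integral_cong_AE)
    show "AE x in lborel. indicator {0<..1} x * ((indicator {0..1} x * rep_l1 f (- x)) * k x)
        = (indicator {0..1} x * rep_l1 f (- x)) * k x"
      using AE_lborel_singleton[of 0] by eventually_elim (auto simp: indicator_def)
  qed measurable
  finally show "pairing f (\<lambda>x. if x < 0 then k (- x) else 0) = (LINT x|lborel. (indicator {0..1} x * rep_l1 f (- x)) * k x)" .
qed

lemma var0c_le:
  assumes A: "\<And>g. paired_test (\<lambda>_. 1) g \<Longrightarrow> \<bar>pairing f g\<bar> \<le> c"
  shows "var0c f \<le> ennreal (10 * c)"
proof -
  have zero: "half_test (\<lambda>_. 1) (\<lambda>_. 0)"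
    by (simp add: half_test_def bdd_borel_const set_lebesgue_integral_def)
  have H1: "\<bar>LINT x|lborel. (indicator {0..1} x * rep_l1 f x) * k x\<bar> \<le> c" if k: "half_test (\<lambda>_. 1) k" for k
  proof -
    have kb: "bdd_borel k" using k by (simp add: half_test_def)
    have b: "bdd_borel (\<lambda>x. if 0 < x then k x else 0)"
      using kb by (auto simp: bdd_borel_def intro: order_trans[OF abs_ge_zero])
    have "paired_test (\<lambda>_. 1) (\<lambda>x. if 0 < x then k x else 0)"
      unfolding paired_test_def
      by (intro conjI half_test_cong[OF k b] half_test_cong[OF zero bdd_borel_reflect[OF b]]) auto
    from A[OF this] show ?thesis by (simp only: pairing_half[OF kb])
  qed
  have H2: "\<bar>LINT x|lborel. (indicator {0..1} x * rep_l1 f (- x)) * k x\<bar> \<le> c" if k: "half_test (\<lambda>_. 1) k" for k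
  proof -
    have kb: "bdd_borel k" using k by (simp add: half_test_def)
    have b: "bdd_borel (\<lambda>x. if x < 0 then k (- x) else 0)"
      using bdd_borel_reflect[OF kb] by (auto simp: bdd_borel_def intro: order_trans[OF abs_ge_zero])
    have "paired_test (\<lambda>_. 1) (\<lambda>x. if x < 0 then k (- x) else 0)"
      unfolding paired_test_def
      by (intro conjI half_test_cong[OF k bdd_borel_reflect[OF b]] half_test_cong[OF zero b]) auto
    from A[OF this] show ?thesis by (simp only: pairing_half[OF kb])
  qed
  note int = integrable_lborel_half[OF integrable_rep_l1[of f]]
  have s1: "indicator {0..1} x * rep_l1 f x = 0" and s2: "indicator {0..1} x * rep_l1 f (- x) = 0"
    if "x \<notin> {0..1}" for x :: real
    using that by simp_all
  obtain p q where pq: "mono p" "mono q"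
    "AE x in lborel. x \<in> {0..1} \<longrightarrow> indicator {0..1} x * rep_l1 f x = p x - q x"
    "\<And>x y. p y - p x \<le> c" "\<And>x y. q y - q x \<le> 4 * c"
    using dual_variation_representative[OF int(1) s1 H1] by blast
  obtain p' q' where pq': "mono p'" "mono q'"
    "AE x in lborel. x \<in> {0..1} \<longrightarrow> indicator {0..1} x * rep_l1 f (- x) = p' x - q' x"
    "\<And>x y. p' y - p' x \<le> c" "\<And>x y. q' y - q' x \<le> 4 * c"
    using dual_variation_representative[OF int(2) s2 H2] by blast
  define u where "u x = (if 0 \<le> x then p x - q x else p' (- x) - q' (- x))" for x
  have [measurable]: "p \<in> borel_measurable borel" "q \<in> borel_measurable borel"
      "p' \<in> borel_measurable borel" "q' \<in> borel_measurable borel"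
    using pq(1,2) pq'(1,2) by (auto intro: borel_measurable_mono)
  have um: "u \<in> borel_measurable leb"
    by (rule borel_measurable_lebI) (unfold u_def[abs_def], measurable)
  have refl: "AE x in lborel. - x \<in> {0..1} \<longrightarrow> indicator {0..1} (- x) * rep_l1 f x = p' (- x) - q' (- x)"
  proof -
    have [measurable]: "(\<lambda>x. indicator {0..1} x * rep_l1 f (- x)) \<in> borel_measurable borel"
      using int(2) by auto
    have "Measurable.pred borel (\<lambda>x. x \<in> {0..1} \<longrightarrow> indicator {0..1} x * rep_l1 f (- x) = p' x - q' x)"
      by measurable
    from AE_borel_affine[OF _ this pq'(3), of "-1" 0] show ?thesis by simp
  qed
  have eq: "AE x in leb. rep_l1 f x = u x"
    unfolding AE_leb_iff using pq(3) refl
    by eventually_elim (auto simp: u_def indicator_def)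
  have ui: "integrable leb u"
    by (rule integrable_cong_AE_imp[OF integrable_rep_l1 um eq])
  have "abs_l1 u = f"
    using abs_l1_eqI[OF integrable_rep_l1 ui eq] by (simp add: abs_rep_l1)
  then have "u \<in> representatives f" using ui by (simp add: representatives_def)
  then have "var0c f \<le> variation_on {-1..<0} u + variation_on {0<..1} u"
    unfolding var0c_def by (rule INF_lower)
  also have "\<dots> \<le> ennreal (4 * c + c) + ennreal (c + 4 * c)"
  proof (rule add_mono)
    show "variation_on {-1..<0} u \<le> ennreal (4 * c + c)"
      by (rule variation_on_mono_diff[where p = "\<lambda>x. - q' (- x)" and q = "\<lambda>x. - p' (- x)"])
        (use pq'(1,2,4,5) in \<open>auto simp: mono_def u_def\<close>)
    show "variation_on {0<..1} u \<le> ennreal (c + 4 * c)"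
      by (rule variation_on_mono_diff[OF pq(1,2,4,5)]) (simp add: u_def)
  qed
  also have "\<dots> = ennreal (10 * c)"
    using pq(4)[of 0 0] by (simp flip: ennreal_plus)
  finally show ?thesis .
qed

text \<open>Conversely to \<open>var_le_BV\<close>, the dual variation and the two masses control the norm of \<open>BV\<close>.\<close>

lemma bv_norm_le:
  assumes A: "\<And>g. paired_test (\<lambda>_. 1) g \<Longrightarrow> \<bar>pairing f g\<bar> \<le> c"
  shows "bv_norm f \<le> ennreal (10 * c + \<bar>mass_right f\<bar> + \<bar>mass_left f\<bar>)"
proof -
  have c: "0 \<le> c"
    using A[of "\<lambda>_. 0"] by (simp add: paired_test_def half_test_def bdd_borel_const set_lebesgue_integral_def pairing_def)
  have "var0c f \<le> ennreal (10 * c + \<bar>mass_right f\<bar> + \<bar>mass_left f\<bar>)"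
    by (rule order_trans[OF var0c_le[OF A]]) (auto intro: ennreal_leI)
  moreover have "ennreal (norm f) \<le> ennreal (10 * c + \<bar>mass_right f\<bar> + \<bar>mass_left f\<bar>)"
    using norm_le_var[OF A] c by (intro ennreal_leI) auto
  ultimately show ?thesis by (simp add: bv_norm_def)
qed

section \<open>A one-sided ergodic theorem\<close>

lemma funpow_in_space:
  assumes "\<sigma> \<in> M \<rightarrow>\<^sub>M M" "\<omega> \<in> space M"
  shows "(\<sigma> ^^ n) \<omega> \<in> space M"
  using assms by (induction n) (auto dest: measurable_space)

lemma funpow_measurable:
  "\<sigma> \<in> M \<rightarrow>\<^sub>M M \<Longrightarrow> (\<sigma> ^^ n) \<in> M \<rightarrow>\<^sub>M M"
  by (induction n) (auto simp: id_def comp_def intro: measurable_compose)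

text \<open>After subtraction of the mean plus \<open>\<delta>\<close>, the integral of the function, now \<open>\<psi>\<close>, is negative. The set \<open>A\<close>
where its Birkhoff sums are unbounded above is invariant. On \<open>A\<close> the maximal sums \<open>Mx n\<close> tend to
infinity, so \<open>Mx (Suc n) - Mx n \<circ> \<sigma> = max \<psi> (- Mx n \<circ> \<sigma>)\<close> is eventually \<open>\<psi>\<close>; but its integral is nonnegative
because \<open>\<sigma>\<close> preserves the measure and \<open>Mx\<close> increases in \<open>n\<close>. So \<open>A\<close> cannot have full measure, and by ergodicity
it is null.\<close>

lemma birkhoff_upper_bound:
  fixes \<phi> :: "'w \<Rightarrow> real"
  assumes M: "prob_space M" and \<sigma>: "\<sigma> \<in> M \<rightarrow>\<^sub>M M" "distr M M \<sigma> = M" and erg: "ergodic M \<sigma>"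
    and \<phi>[measurable]: "\<phi> \<in> borel_measurable M" and bounded: "\<And>\<omega>. \<omega> \<in> space M \<Longrightarrow> \<bar>\<phi> \<omega>\<bar> \<le> K"
    and \<delta>: "0 < \<delta>"
  shows "AE \<omega> in M. \<exists>B. \<forall>n. (\<Sum>i<n. \<phi> ((\<sigma> ^^ i) \<omega>)) \<le> real n * ((LINT \<omega>|M. \<phi> \<omega>) + \<delta>) + B"
proof -
  interpret prob_space M by (rule M)
  note [measurable] = \<sigma>(1) funpow_measurable[OF \<sigma>(1)]
  note sp = measurable_space[OF \<sigma>(1)]
  have \<phi>i: "integrable M \<phi>"
    by (rule integrable_const_bound[where B = K]) (auto intro: AE_I2 bounded)
  define I where "I = (LINT \<omega>|M. \<phi> \<omega>)"
  define \<psi> where "\<psi> \<omega> = \<phi> \<omega> - (I + \<delta>)" for \<omega>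
  define K' where "K' = K + \<bar>I + \<delta>\<bar>"
  have [measurable]: "\<psi> \<in> borel_measurable M" unfolding \<psi>_def by measurable
  have \<psi>b: "\<bar>\<psi> \<omega>\<bar> \<le> K'" if "\<omega> \<in> space M" for \<omega>
    using bounded[OF that] by (auto simp: \<psi>_def K'_def)
  have \<psi>I: "(LINT \<omega>|M. \<psi> \<omega>) = - \<delta>"
    using \<phi>i by (simp add: \<psi>_def I_def prob_space)
  define S where "S n \<omega> = (\<Sum>i<n. \<psi> ((\<sigma> ^^ i) \<omega>))" for n \<omega>
  have [measurable]: "S n \<in> borel_measurable M" for n unfolding S_def by measurable
  have Srec: "S (Suc n) \<omega> = \<psi> \<omega> + S n (\<sigma> \<omega>)" for n \<omega>
    unfolding S_def sum.lessThan_Suc_shift by (simp add: funpow_swap1)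
  define A where "A = {\<omega> \<in> space M. \<forall>B::nat. \<exists>n. real B < S n \<omega>}"
  have [measurable]: "A \<in> sets M" unfolding A_def by measurable
  have A1: "\<sigma> \<omega> \<in> A" if \<omega>: "\<omega> \<in> A" for \<omega>
  proof -
    have \<omega>s: "\<omega> \<in> space M" using \<omega> by (simp add: A_def)
    have "\<exists>n. real B < S n (\<sigma> \<omega>)" for B
    proof -
      obtain B' :: nat where B': "real B + \<psi> \<omega> \<le> real B'" by (meson real_arch_simple)
      obtain n where n: "real B' < S n \<omega>" using \<omega> by (auto simp: A_def)
      then obtain m where "n = Suc m" by (cases n) (auto simp: S_def)
      then show ?thesis using n B' Srec[of m \<omega>] by (intro exI[of _ m]) simp
    qed
    then show ?thesis using sp[OF \<omega>s] by (simp add: A_def)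
  qed
  have A2: "\<omega> \<in> A" if \<omega>: "\<sigma> \<omega> \<in> A" "\<omega> \<in> space M" for \<omega>
  proof -
    have "\<exists>n. real B < S n \<omega>" for B
    proof -
      obtain B' :: nat where B': "real B - \<psi> \<omega> \<le> real B'" by (meson real_arch_simple)
      obtain n where n: "real B' < S n (\<sigma> \<omega>)" using \<omega> by (auto simp: A_def)
      then show ?thesis using B' Srec[of n \<omega>] by (intro exI[of _ "Suc n"]) simp
    qed
    then show ?thesis using \<omega> by (simp add: A_def)
  qed
  have "\<sigma> -` A \<inter> space M = A"
  proof -
    have "A \<subseteq> space M" by (auto simp: A_def)
    then show ?thesis using A1 A2 by blast
  qed
  then have "measure M A = 0 \<or> measure M A = 1"
    using erg by (simp add: ergodic_def)
  moreover have "measure M A \<noteq> 1"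
  proof
    assume "measure M A = 1"
    then have AEA: "AE \<omega> in M. \<omega> \<in> A" by (simp add: prob_eq_1)
    \<comment> \<open>\<open>Mx n\<close> is the maximum of \<open>0\<close> and the first \<open>n\<close> Birkhoff sums of \<open>\<psi>\<close>.\<close>
    define Mx where "Mx = rec_nat (\<lambda>_. 0) (\<lambda>_ h \<omega>. max 0 (\<psi> \<omega> + h (\<sigma> \<omega>)))"
    have Mx0: "Mx 0 \<omega> = 0" and MxS: "Mx (Suc n) \<omega> = max 0 (\<psi> \<omega> + Mx n (\<sigma> \<omega>))" for n \<omega>
      by (simp_all add: Mx_def)
    have [measurable]: "Mx n \<in> borel_measurable M" for n
    proof (induction n)
      case 0 show ?case unfolding Mx0 by simp
    next
      case (Suc n)
      note [measurable] = Suc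
      have "(\<lambda>\<omega>. Mx (Suc n) \<omega>) \<in> borel_measurable M" unfolding MxS by measurable
      then show ?case by simp
    qed
    have Mxpos: "0 \<le> Mx n \<omega>" for n \<omega> by (cases n) (simp_all add: Mx0 MxS)
    have Mxmono: "Mx n \<omega> \<le> Mx (Suc n) \<omega>" for n \<omega>
    proof (induction n arbitrary: \<omega>)
      case 0 then show ?case by (simp add: Mx0 Mxpos)
    next
      case (Suc n)
      show ?case unfolding MxS[of "Suc n" \<omega>] MxS[of n \<omega>] using Suc[of "\<sigma> \<omega>"]
        by (intro max.mono add_left_mono order_refl)
    qed
    have MxS': "S n \<omega> \<le> Mx n \<omega>" for n \<omega>
    proof (induction n arbitrary: \<omega>)
      case 0 then show ?case by (simp add: Mx0 S_def)
    next
      case (Suc n)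
      show ?case unfolding MxS Srec by (intro max.coboundedI2 add_left_mono Suc)
    qed
    have Mxb: "Mx n \<omega> \<le> real n * K'" if "\<omega> \<in> space M" for n \<omega>
      using that
    proof (induction n arbitrary: \<omega>)
      case 0 then show ?case by (simp add: Mx0)
    next
      case (Suc n)
      have "0 \<le> K'" using \<psi>b[OF Suc.prems] by linarith
      then show ?case
        using Suc.IH[OF sp[OF Suc.prems]] \<psi>b[OF Suc.prems] mult_nonneg_nonneg[of "real n" K']
        by (simp add: MxS algebra_simps)
    qed
    have Mxi: "integrable M (Mx n)" for n
      by (rule integrable_const_bound[where B = "real n * K'"]) (auto intro!: AE_I2 simp: Mxpos Mxb)
    have Mx\<sigma>: "integrable M (\<lambda>\<omega>. Mx n (\<sigma> \<omega>))" "(LINT \<omega>|M. Mx n (\<sigma> \<omega>)) = (LINT \<omega>|M. Mx n \<omega>)" for n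
    proof -
      show "integrable M (\<lambda>\<omega>. Mx n (\<sigma> \<omega>))"
        by (rule integrable_const_bound[where B = "real n * K'"]) (auto intro!: AE_I2 simp: Mxpos Mxb sp)
      show "(LINT \<omega>|M. Mx n (\<sigma> \<omega>)) = (LINT \<omega>|M. Mx n \<omega>)"
        using integral_distr[OF \<sigma>(1), of "Mx n"] \<sigma>(2) by simp
    qed
    define D where "D n \<omega> = Mx (Suc n) \<omega> - Mx n (\<sigma> \<omega>)" for n \<omega>
    have Dpos: "0 \<le> (LINT \<omega>|M. D n \<omega>)" for n
    proof -
      have "(LINT \<omega>|M. D n \<omega>) = (LINT \<omega>|M. Mx (Suc n) \<omega>) - (LINT \<omega>|M. Mx n \<omega>)"
        unfolding D_def using Mxi Mx\<sigma> by simp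
      also have "\<dots> \<ge> 0" using integral_mono[OF Mxi Mxi Mxmono, of n] by simp
      finally show ?thesis .
    qed
    have "(\<lambda>n. LINT \<omega>|M. D n \<omega>) \<longlonglongrightarrow> (LINT \<omega>|M. \<psi> \<omega>)"
    proof (rule integral_dominated_convergence[where w = "\<lambda>_. K'"])
      show "AE \<omega> in M. (\<lambda>n. D n \<omega>) \<longlonglongrightarrow> \<psi> \<omega>"
        using AEA
      proof eventually_elim
        case (elim \<omega>)
        obtain B :: nat where B: "- \<psi> \<omega> \<le> real B" by (meson real_arch_simple)
        obtain m where m: "real B < S m (\<sigma> \<omega>)" using A1[OF elim] by (auto simp: A_def)
        have "D n \<omega> = \<psi> \<omega>" if "m \<le> n" for n
        proof -
          have "Mx m (\<sigma> \<omega>) \<le> Mx n (\<sigma> \<omega>)"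
            using that by (rule lift_Suc_mono_le[of "\<lambda>n. Mx n (\<sigma> \<omega>)", OF Mxmono])
          then show ?thesis using MxS'[of m "\<sigma> \<omega>"] m B by (simp add: D_def MxS)
        qed
        then have "eventually (\<lambda>n. D n \<omega> = \<psi> \<omega>) sequentially"
          by (auto simp: eventually_sequentially)
        then show ?case by (rule tendsto_eventually)
      qed
      show "AE \<omega> in M. norm (D n \<omega>) \<le> K'" for n
      proof (rule AE_I2)
        fix \<omega> assume "\<omega> \<in> space M"
        then show "norm (D n \<omega>) \<le> K'"
          using \<psi>b[of \<omega>] Mxpos[of n "\<sigma> \<omega>"] by (simp add: D_def MxS)
      qed
    qed (auto simp: D_def[abs_def])
    then have "0 \<le> (LINT \<omega>|M. \<psi> \<omega>)"
      by (rule LIMSEQ_le_const) (use Dpos in auto)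
    then show False using \<psi>I \<delta> by simp
  qed
  ultimately have "AE \<omega> in M. \<omega> \<notin> A"
    by (simp add: prob_eq_0)
  then show ?thesis
    using AE_space
  proof eventually_elim
    case (elim \<omega>)
    then obtain B :: nat where B: "\<And>n. S n \<omega> \<le> real B" by (auto simp: A_def not_less)
    have "(\<Sum>i<n. \<phi> ((\<sigma> ^^ i) \<omega>)) \<le> real n * ((LINT \<omega>|M. \<phi> \<omega>) + \<delta>) + real B" for n
      using B[of n] by (simp add: S_def \<psi>_def sum_subtractf I_def)
    then show ?case by blast
  qed
qed

section \<open>Linearity and growth rates\<close>

lemma perron_frobenius_add:
  assumes "a \<in> {0..1}" "b \<in> {0..1}"
  shows "perron_frobenius (paired_tent a b) (f + h)
    = perron_frobenius (paired_tent a b) f + perron_frobenius (paired_tent a b) h"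
proof (rule pairing_eqI)
  fix g assume g: "bdd_borel g"
  then have "bdd_borel (\<lambda>x. g (paired_tent a b x))" by (rule bdd_borel_compose) simp
  with g show "pairing (perron_frobenius (paired_tent a b) (f + h)) g
    = pairing (perron_frobenius (paired_tent a b) f + perron_frobenius (paired_tent a b) h) g"
    by (simp add: pairing_perron_frobenius[OF assms] pairing_add_left)
qed

lemma perron_frobenius_scaleR:
  assumes "a \<in> {0..1}" "b \<in> {0..1}"
  shows "perron_frobenius (paired_tent a b) (c *\<^sub>R f) = c *\<^sub>R perron_frobenius (paired_tent a b) f"
proof (rule pairing_eqI)
  fix g assume g: "bdd_borel g"
  then have "bdd_borel (\<lambda>x. g (paired_tent a b x))" by (rule bdd_borel_compose) simp
  with g show "pairing (perron_frobenius (paired_tent a b) (c *\<^sub>R f)) g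
    = pairing (c *\<^sub>R perron_frobenius (paired_tent a b) f) g"
    by (simp add: pairing_perron_frobenius[OF assms] pairing_scaleR_left)
qed

lemma norm_perron_frobenius_le:
  assumes "a \<in> {0..1}" "b \<in> {0..1}"
  shows "norm (perron_frobenius (paired_tent a b) f) \<le> norm f"
proof -
  obtain g where g: "bdd_borel g" "\<And>x. \<bar>g x\<bar> \<le> 1"
    "pairing (perron_frobenius (paired_tent a b) f) g = norm (perron_frobenius (paired_tent a b) f)"
    using norm_l1_attained by metis
  have "bdd_borel (\<lambda>x. g (paired_tent a b x))" using g(1) by (rule bdd_borel_compose) simp
  then have "\<bar>pairing f (\<lambda>x. g (paired_tent a b x))\<bar> \<le> 1 * norm f"
    by (rule abs_pairing_le) (rule g(2))
  then show ?thesis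
    using g(3) by (simp add: pairing_perron_frobenius[OF assms g(1)])
qed

lemma abs_mass_le: "\<bar>mass_right f\<bar> \<le> norm f" "\<bar>mass_left f\<bar> \<le> norm f" "\<bar>mass_right f + mass_left f\<bar> \<le> norm f"
proof -
  show "\<bar>mass_right f\<bar> \<le> norm f" "\<bar>mass_left f\<bar> \<le> norm f"
    unfolding mass_right_def mass_left_def
    using abs_pairing_le[of "indicator {0<..}" 1 f] abs_pairing_le[of "indicator {..<0}" 1 f]
    by (simp_all add: bdd_borel_indicator)
  show "\<bar>mass_right f + mass_left f\<bar> \<le> norm f"
    using abs_pairing_le[of "\<lambda>_. 1" 1 f] pairing_two_constants[of f 1 1] by (simp add: bdd_borel_const)
qed

primrec transfer_orbit :: "(nat \<Rightarrow> real) \<Rightarrow> (nat \<Rightarrow> real) \<Rightarrow> nat \<Rightarrow> l1 \<Rightarrow> l1" where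
  "transfer_orbit \<alpha> \<beta> 0 f = f"
| "transfer_orbit \<alpha> \<beta> (Suc n) f = perron_frobenius (paired_tent (\<alpha> n) (\<beta> n)) (transfer_orbit \<alpha> \<beta> n f)"

definition growth :: "(nat \<Rightarrow> l1) \<Rightarrow> ereal" where
  "growth F = limsup (\<lambda>n. ereal (1 / real n) * ln_ennreal (bv_norm (F n)))"

lemma ln_ennreal_le:
  assumes "x \<le> ennreal y" "0 < y"
  shows "ln_ennreal x \<le> ereal (ln y)"
proof (cases x)
  case (real r)
  then show ?thesis
    using assms by (auto simp: ln_ennreal_def)
qed (use assms in \<open>auto simp: top_unique\<close>)

lemma ln_ennreal_ge:
  assumes "ennreal y \<le> x" "0 < y"
  shows "ereal (ln y) \<le> ln_ennreal x"
proof (cases x)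
  case (real r)
  then show ?thesis
    using assms by (auto simp: ln_ennreal_def)
qed (use assms in \<open>auto simp: ln_ennreal_def\<close>)

lemma growth_le:
  assumes K: "0 < K" and le: "\<And>n. bv_norm (F n) \<le> ennreal (K * exp (real n * r))"
  shows "growth F \<le> ereal r"
proof -
  have "growth F \<le> limsup (\<lambda>n. ereal (ln K / real n + r))"
    unfolding growth_def
  proof (rule Limsup_mono)
    show "eventually (\<lambda>n. ereal (1 / real n) * ln_ennreal (bv_norm (F n)) \<le> ereal (ln K / real n + r)) sequentially"
      using eventually_gt_at_top[of 0]
    proof eventually_elim
      case (elim n)
      have "ereal (1 / real n) * ln_ennreal (bv_norm (F n)) \<le> ereal (1 / real n) * ereal (ln (K * exp (real n * r)))"
        using K by (intro ereal_mult_left_mono ln_ennreal_le le) auto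
      also have "\<dots> = ereal (ln K / real n + r)"
        using elim K by (simp add: ln_mult field_simps)
      finally show ?case .
    qed
  qed
  also have "\<dots> = ereal r"
  proof (rule lim_imp_Limsup)
    have "(\<lambda>n. ln K / real n + r) \<longlonglongrightarrow> 0 + r"
      by (intro tendsto_add tendsto_const lim_const_over_n)
    then show "(\<lambda>n. ereal (ln K / real n + r)) \<longlonglongrightarrow> ereal r" by simp
  qed simp
  finally show ?thesis .
qed

lemma growth_ge:
  assumes K: "0 < K" and ge: "\<And>n. ennreal (K * exp (real n * r)) \<le> bv_norm (F n)"
  shows "ereal r \<le> growth F"
proof -
  have "ereal r = limsup (\<lambda>n. ereal (ln K / real n + r))"
  proof (rule lim_imp_Limsup[symmetric])
    have "(\<lambda>n. ln K / real n + r) \<longlonglongrightarrow> 0 + r"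
      by (intro tendsto_add tendsto_const lim_const_over_n)
    then show "(\<lambda>n. ereal (ln K / real n + r)) \<longlonglongrightarrow> ereal r" by simp
  qed simp
  also have "\<dots> \<le> growth F"
    unfolding growth_def
  proof (rule Limsup_mono)
    show "eventually (\<lambda>n. ereal (ln K / real n + r) \<le> ereal (1 / real n) * ln_ennreal (bv_norm (F n))) sequentially"
      using eventually_gt_at_top[of 0]
    proof eventually_elim
      case (elim n)
      have "ereal (ln K / real n + r) = ereal (1 / real n) * ereal (ln (K * exp (real n * r)))"
        using elim K by (simp add: ln_mult field_simps)
      also have "\<dots> \<le> ereal (1 / real n) * ln_ennreal (bv_norm (F n))"
        using K by (intro ereal_mult_left_mono ln_ennreal_ge ge) auto
      finally show ?case .
    qed
  qed
  finally show ?thesis .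
qed

lemma norm_le_bv_norm: "c \<le> norm f \<Longrightarrow> ennreal c \<le> bv_norm f"
  by (simp add: bv_norm_def ennreal_leI max.coboundedI2)

lemma var_le_mono: "var_le w f c \<Longrightarrow> c \<le> d \<Longrightarrow> var_le w f d"
  unfolding var_le_def by (meson order_trans)

lemma var_le_add:
  "var_le w f c \<Longrightarrow> var_le w h d \<Longrightarrow> var_le w (f + h) (c + d)"
  by (auto simp: var_le_def pairing_add_left paired_test_bdd_borel intro: add_mono)

lemma var_le_scaleR:
  assumes "var_le w f c" "\<And>x. 0 \<le> x \<Longrightarrow> x \<le> 1 \<Longrightarrow> 0 \<le> w x"
  shows "var_le w (r *\<^sub>R f) (\<bar>r\<bar> * c)"
  unfolding var_le_def
proof (intro allI impI)
  fix g assume g: "paired_test w g"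
  have "\<bar>pairing f g\<bar> \<le> 1 * c"
    using g by (intro var_leD_scaled[OF assms]) auto
  then have "\<bar>r\<bar> * \<bar>pairing f g\<bar> \<le> \<bar>r\<bar> * c" by (intro mult_left_mono) auto
  then show "pairing (r *\<^sub>R f) g \<le> \<bar>r\<bar> * c"
    using abs_ge_self[of "r * pairing f g"] by (simp add: pairing_scaleR_left paired_test_bdd_borel[OF g] abs_mult)
qed

lemma mass_add: "mass_right (f + h) = mass_right f + mass_right h" "mass_left (f + h) = mass_left f + mass_left h"
  by (simp_all add: mass_right_def mass_left_def pairing_add_left bdd_borel_indicator)

lemma mass_scaleR: "mass_right (c *\<^sub>R f) = c * mass_right f" "mass_left (c *\<^sub>R f) = c * mass_left f"
  by (simp_all add: mass_right_def mass_left_def pairing_scaleR_left bdd_borel_indicator)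

section \<open>Orbits of the transfer operators\<close>

text \<open>Everything that concerns a single orbit of the base only depends on the sequences of leak parameters
along it.\<close>

locale tent_orbit =
  fixes \<alpha> \<beta> :: "nat \<Rightarrow> real" and e \<gamma> :: real
  assumes \<alpha>: "\<And>n. \<alpha> n \<in> {0..e}" and \<beta>: "\<And>n. \<beta> n \<in> {0..e}"
    and e: "0 < e" "e \<le> 1/8" and \<gamma>: "0 < \<gamma>" "\<gamma> \<le> 1"
begin

abbreviation "F \<equiv> transfer_orbit \<alpha> \<beta>"
abbreviation "w \<equiv> weight e \<gamma>"
abbreviation "s \<equiv> e powr \<gamma>"
abbreviation "\<theta> \<equiv> contraction e \<gamma>"

definition \<tau> :: "nat \<Rightarrow> real" where
  "\<tau> n = \<alpha> n / (1 + \<alpha> n) + \<beta> n / (1 + \<beta> n)"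

lemma unit_params: "\<alpha> n \<in> {0..1}" "\<beta> n \<in> {0..1}"
  using \<alpha>[of n] \<beta>[of n] e by auto

lemma loss_bounds: "0 \<le> \<tau> n" "\<tau> n \<le> \<alpha> n + \<beta> n" "\<alpha> n + \<beta> n \<le> \<tau> n + 2 * e\<^sup>2" "\<tau> n \<le> 2 * e"
proof -
  have *: "0 \<le> x / (1 + x)" "x / (1 + x) \<le> x" "x \<le> x / (1 + x) + e\<^sup>2" if x: "x \<in> {0..e}" for x
  proof -
    show "0 \<le> x / (1 + x)" using x by simp
    have eq: "x - x / (1 + x) = x * x / (1 + x)" using x by (simp add: field_simps)
    have "0 \<le> x * x / (1 + x)" using x by simp
    then show "x / (1 + x) \<le> x" using eq by linarith
    have "x * x / (1 + x) \<le> x * x / 1" using x by (intro divide_left_mono) auto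
    also have "\<dots> \<le> e\<^sup>2" using x by (simp add: power2_eq_square mult_mono)
    finally show "x \<le> x / (1 + x) + e\<^sup>2" using eq by linarith
  qed
  show "0 \<le> \<tau> n" "\<tau> n \<le> \<alpha> n + \<beta> n" "\<alpha> n + \<beta> n \<le> \<tau> n + 2 * e\<^sup>2"
    using *[OF \<alpha>[of n]] *[OF \<beta>[of n]] by (auto simp: \<tau>_def)
  then show "\<tau> n \<le> 2 * e" using \<alpha>[of n] \<beta>[of n] by auto
qed

lemma w_le_1: "0 \<le> x \<Longrightarrow> x \<le> 1 \<Longrightarrow> w x \<le> 1"
  unfolding weight_def using e \<gamma> by (intro powr_le1) auto

lemma w_ge: "s \<le> w x"
  unfolding weight_def using e \<gamma> by (intro powr_mono2) auto

lemma s_pos: "0 < s" using e by simp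

lemma total_mass: "mass_right (F n f) + mass_left (F n f) = mass_right f + mass_left f"
  by (induction n) (simp_all add: total_mass_perron_frobenius[OF unit_params])

lemma F_add: "F n (f + h) = F n f + F n h"
  by (induction n) (simp_all add: perron_frobenius_add[OF unit_params])

lemma F_scaleR: "F n (c *\<^sub>R f) = c *\<^sub>R F n f"
  by (induction n) (simp_all add: perron_frobenius_scaleR[OF unit_params])

lemma norm_F_le: "norm (F n f) \<le> norm f"
  by (induction n) (auto intro: order_trans[OF norm_perron_frobenius_le[OF unit_params]])

lemma var_step:
  assumes "var_le w (F n f) c"
  shows "var_le w (F (Suc n) f) (\<theta> * c + s * (\<bar>mass_right (F n f)\<bar> + \<bar>mass_left (F n f)\<bar>))"
  using lasota_yorke[OF \<alpha> \<beta> e(1) _ \<gamma> assms] e by simp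

lemma mass_step:
  assumes f: "mass_right f + mass_left f = 0" and c: "var_le w (F n f) c"
  shows "\<bar>mass_right (F (Suc n) f) - (1 - \<tau> n) * mass_right (F n f)\<bar> \<le> \<tau> n * c"
proof -
  have l: "mass_left (F n f) = - mass_right (F n f)" using total_mass[of n f] f by simp
  show ?thesis
    using mass_right_perron_frobenius[OF unit_params \<gamma> e(1) c]
    by (simp add: \<tau>_def l algebra_simps)
qed

lemma var_step0:
  assumes f: "mass_right f + mass_left f = 0" and c: "var_le w (F n f) c"
  shows "var_le w (F (Suc n) f) (\<theta> * c + 2 * s * \<bar>mass_right (F n f)\<bar>)"
proof -
  have l: "mass_left (F n f) = - mass_right (F n f)" using total_mass[of n f] f by simp
  have eq: "s * (\<bar>mass_right (F n f)\<bar> + \<bar>- mass_right (F n f)\<bar>) = 2 * s * \<bar>mass_right (F n f)\<bar>" by simp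
  show ?thesis using var_step[OF c] unfolding l eq .
qed

lemma bv_norm_orbit_le:
  assumes "var_le w f c"
  shows "bv_norm f \<le> ennreal (10 * (c / s) + \<bar>mass_right f\<bar> + \<bar>mass_left f\<bar>)"
proof (rule bv_norm_le)
  fix g assume g: "paired_test (\<lambda>_. 1) g"
  have "paired_test (\<lambda>x. 1 / s * w x) g"
    using g by (rule paired_test_mono) (use w_ge s_pos in \<open>simp add: field_simps\<close>)
  then have "\<bar>pairing f g\<bar> \<le> 1 / s * c"
    using s_pos by (intro var_leD_scaled[OF assms]) (auto simp: weight_nonneg)
  then show "\<bar>pairing f g\<bar> \<le> c / s" by simp
qed

text \<open>The masses are bounded by the norm of \<open>f\<close>, so for \<open>\<theta> < 1\<close> the Lasota--Yorke inequality keeps the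
variation bounded.\<close>

lemma growth_le_0:
  assumes f: "f \<in> BV" and \<theta>1: "\<theta> < 1"
  shows "growth (\<lambda>n. F n f) \<le> 0"
proof -
  obtain c0 where c0: "0 \<le> c0" "var_le w f c0"
    using var_le_BV[OF f] w_le_1 by blast
  define m where "m = norm f"
  define C where "C = c0 + 2 * s * m / (1 - \<theta>)"
  have m: "0 \<le> m" by (simp add: m_def)
  have C0: "0 \<le> C" using c0 m \<theta>1 by (simp add: C_def)
  have masses: "\<bar>mass_right (F n f)\<bar> \<le> m" "\<bar>mass_left (F n f)\<bar> \<le> m" for n
    using abs_mass_le(1,2)[of "F n f"] norm_F_le[of n f] by (auto simp: m_def)
  have \<theta>0: "0 \<le> \<theta>" by (simp add: contraction_def)
  have step: "\<theta> * C + s * (2 * m) \<le> C"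
  proof -
    have "(1 - \<theta>) * C = (1 - \<theta>) * c0 + 2 * s * m" using \<theta>1 by (simp add: C_def distrib_left)
    moreover have "0 \<le> (1 - \<theta>) * c0" using \<theta>1 c0 by simp
    ultimately show ?thesis by (simp add: algebra_simps)
  qed
  have var: "var_le w (F n f) C" for n
  proof (induction n)
    case 0
    have "c0 \<le> C" using m \<theta>1 by (simp add: C_def)
    then show ?case using var_le_mono[OF c0(2)] by simp
  next
    case (Suc n)
    have "s * (\<bar>mass_right (F n f)\<bar> + \<bar>mass_left (F n f)\<bar>) \<le> s * (2 * m)"
      using masses[of n] by (intro mult_left_mono) auto
    then show ?case using var_le_mono[OF var_step[OF Suc]] step by (simp del: transfer_orbit.simps)
  qed
  have "growth (\<lambda>n. F n f) \<le> ereal 0"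
  proof (rule growth_le)
    show "0 < 10 * (C / s) + 2 * m + 1" using C0 m s_pos by (intro add_nonneg_pos add_nonneg_nonneg) auto
    fix n
    show "bv_norm (F n f) \<le> ennreal ((10 * (C / s) + 2 * m + 1) * exp (real n * 0))"
      using masses[of n] by (intro order_trans[OF bv_norm_orbit_le[OF var]] ennreal_leI) simp
  qed
  then show ?thesis by (simp add: zero_ereal_def)
qed

text \<open>The total mass is conserved and bounds the norm from below.\<close>

lemma growth_ge_0:
  assumes "mass_right f + mass_left f \<noteq> 0"
  shows "0 \<le> growth (\<lambda>n. F n f)"
proof -
  have "ereal 0 \<le> growth (\<lambda>n. F n f)"
  proof (rule growth_ge)
    show "0 < \<bar>mass_right f + mass_left f\<bar>" using assms by simp
    show "ennreal (\<bar>mass_right f + mass_left f\<bar> * exp (real n * 0)) \<le> bv_norm (F n f)" for n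
      using abs_mass_le(3)[of "F n f"] by (intro norm_le_bv_norm) (simp add: total_mass)
  qed
  then show ?thesis by (simp add: zero_ereal_def)
qed

text \<open>For total mass \<open>0\<close> the right mass \<open>P\<close> determines the left one. In the seminorm \<open>max |P| (V / K)\<close> a step
contracts by \<open>1 - \<tau> * (1 - K)\<close>: the leak does this to \<open>P\<close>, and the gap condition is chosen such that \<open>V / K\<close>
contracts at least as fast.\<close>

lemma cone_upper:
  assumes f: "f \<in> BV" "mass_right f + mass_left f = 0"
    and K: "0 < K" "K \<le> 1" and gap: "\<theta> + 2 * s / K \<le> 1 - 4 * e"
  shows "\<exists>X\<ge>0. \<forall>n. \<bar>mass_right (F n f)\<bar> \<le> X * (\<Prod>i<n. 1 - \<tau> i * (1 - K)) \<and>
    var_le w (F n f) (K * (X * (\<Prod>i<n. 1 - \<tau> i * (1 - K))))"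
proof -
  obtain c0 where c0: "0 \<le> c0" "var_le w f c0"
    using var_le_BV[OF f(1)] w_le_1 by blast
  define X where "X = \<bar>mass_right f\<bar> + c0 / K"
  define Y where "Y n = X * (\<Prod>i<n. 1 - \<tau> i * (1 - K))" for n
  have fac: "1 - 4 * e \<le> 1 - \<tau> i * (1 - K)" for i
    using loss_bounds(1,4)[of i] K e mult_mono[of "\<tau> i" "2 * e" "1 - K" 1] by simp
  have X0: "0 \<le> X" using c0 K by (simp add: X_def)
  have Y0: "0 \<le> Y n" for n
  proof -
    have "0 \<le> 1 - \<tau> i * (1 - K)" for i using fac[of i] e by linarith
    then show ?thesis unfolding Y_def using X0 by (intro mult_nonneg_nonneg prod_nonneg) blast+
  qed
  have "\<bar>mass_right (F n f)\<bar> \<le> Y n \<and> var_le w (F n f) (K * Y n)" for n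
  proof (induction n)
    case 0
    have "c0 \<le> K * Y 0" using K by (simp add: Y_def X_def distrib_left)
    then show ?case using var_le_mono[OF c0(2)] c0 K by (simp add: Y_def X_def)
  next
    case (Suc n)
    have YS: "Y (Suc n) = (1 - \<tau> n * (1 - K)) * Y n" by (simp add: Y_def mult.commute mult.left_commute)
    have "\<bar>mass_right (F (Suc n) f)\<bar> \<le> \<bar>(1 - \<tau> n) * mass_right (F n f)\<bar> + \<tau> n * (K * Y n)"
      using mass_step[OF f(2), of n "K * Y n"] Suc by linarith
    also have "\<bar>(1 - \<tau> n) * mass_right (F n f)\<bar> \<le> (1 - \<tau> n) * Y n"
      unfolding abs_mult using Suc loss_bounds[of n] e by (intro mult_mono) auto
    finally have 1: "\<bar>mass_right (F (Suc n) f)\<bar> \<le> Y (Suc n)" by (simp add: YS algebra_simps)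
    have "\<theta> * (K * Y n) + 2 * s * \<bar>mass_right (F n f)\<bar> \<le> \<theta> * (K * Y n) + 2 * s * Y n"
      using Suc s_pos by (intro add_left_mono mult_left_mono) auto
    also have "\<dots> = (\<theta> + 2 * s / K) * (K * Y n)" using K by (simp add: field_simps)
    also have "\<dots> \<le> (1 - \<tau> n * (1 - K)) * (K * Y n)"
      using gap fac[of n] K Y0[of n] by (intro mult_right_mono) auto
    finally have "\<theta> * (K * Y n) + 2 * s * \<bar>mass_right (F n f)\<bar> \<le> K * Y (Suc n)"
      by (simp add: YS mult.left_commute)
    then have "var_le w (F (Suc n) f) (K * Y (Suc n))"
      using var_le_mono[OF var_step0[OF f(2)]] Suc by blast
    with 1 show ?case by blast
  qed
  then show ?thesis using X0 unfolding Y_def by blast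
qed

lemma prod_one_minus_le_exp:
  fixes n :: nat
  assumes "\<And>i. y i \<le> (1::real)"
  shows "(\<Prod>i<n. 1 - y i) \<le> exp (- (\<Sum>i<n. y i))"
proof -
  have "(\<Prod>i<n. 1 - y i) \<le> (\<Prod>i<n. exp (- y i))"
    using assms exp_ge_add_one_self[of "- y _"] by (intro prod_mono) auto
  also have "\<dots> = exp (\<Sum>i<n. - y i)" by (rule exp_sum[symmetric]) simp
  finally show ?thesis by (simp only: sum_negf)
qed

lemma growth_upper:
  assumes f: "f \<in> BV" "mass_right f + mass_left f = 0"
    and K: "0 < K" "K \<le> 1" and gap: "\<theta> + 2 * s / K \<le> 1 - 4 * e"
    and r: "\<And>n. real n * r - B \<le> (\<Sum>i<n. \<alpha> i + \<beta> i)"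
  shows "growth (\<lambda>n. F n f) \<le> ereal (- r + 2 * e * K + 2 * e\<^sup>2)"
proof -
  obtain X where X: "0 \<le> X" "\<And>n. \<bar>mass_right (F n f)\<bar> \<le> X * (\<Prod>i<n. 1 - \<tau> i * (1 - K))"
    "\<And>n. var_le w (F n f) (K * (X * (\<Prod>i<n. 1 - \<tau> i * (1 - K))))"
    using cone_upper[OF f K gap] by blast
  define r' where "r' = - r + 2 * e * K + 2 * e\<^sup>2"
  have P: "(\<Prod>i<n. 1 - \<tau> i * (1 - K)) \<le> exp B * exp (real n * r')" for n
  proof -
    have "(\<Sum>i<n. \<alpha> i + \<beta> i) \<le> (\<Sum>i<n. \<tau> i * (1 - K) + (2 * e * K + 2 * e\<^sup>2))"
    proof (rule sum_mono)
      fix i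
      have "\<tau> i * K \<le> 2 * e * K" using loss_bounds(4)[of i] K by (intro mult_right_mono) auto
      then show "\<alpha> i + \<beta> i \<le> \<tau> i * (1 - K) + (2 * e * K + 2 * e\<^sup>2)"
        using loss_bounds(3)[of i] by (simp add: algebra_simps)
    qed
    then have "(\<Sum>i<n. \<alpha> i + \<beta> i) \<le> (\<Sum>i<n. \<tau> i * (1 - K)) + real n * (2 * e * K + 2 * e\<^sup>2)"
      by (simp add: sum.distrib)
    moreover have "real n * r' = - (real n * r) + real n * (2 * e * K + 2 * e\<^sup>2)"
      by (simp add: r'_def algebra_simps)
    ultimately have le: "- (\<Sum>i<n. \<tau> i * (1 - K)) \<le> B + real n * r'"
      using r[of n] by linarith
    have "\<tau> i * (1 - K) \<le> 1" for i
      using loss_bounds(1,4)[of i] K e mult_mono[of "\<tau> i" "2 * e" "1 - K" 1] by simp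
    then have "(\<Prod>i<n. 1 - \<tau> i * (1 - K)) \<le> exp (- (\<Sum>i<n. \<tau> i * (1 - K)))"
      by (rule prod_one_minus_le_exp)
    also have "\<dots> \<le> exp (B + real n * r')" using le by simp
    finally show ?thesis by (simp add: exp_add)
  qed
  define C where "C = (10 * K / s + 2) * (X * exp B) + 1"
  have "growth (\<lambda>n. F n f) \<le> ereal r'"
  proof (rule growth_le)
    show "0 < C" unfolding C_def using X K s_pos by (intro add_nonneg_pos mult_nonneg_nonneg add_nonneg_nonneg) auto
    fix n
    define Y where "Y = X * (\<Prod>i<n. 1 - \<tau> i * (1 - K))"
    have Y: "Y \<le> X * exp B * exp (real n * r')"
      unfolding Y_def mult.assoc using P X by (intro mult_left_mono) auto
    have "mass_left (F n f) = - mass_right (F n f)" using total_mass[of n f] f by simp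
    then have "10 * (K * Y / s) + \<bar>mass_right (F n f)\<bar> + \<bar>mass_left (F n f)\<bar> \<le> (10 * K / s + 2) * Y"
      using X(2)[of n] by (simp add: Y_def algebra_simps)
    also have "\<dots> \<le> (10 * K / s + 2) * (X * exp B * exp (real n * r'))"
      using Y K s_pos by (intro mult_left_mono add_nonneg_nonneg) auto
    also have "\<dots> \<le> C * exp (real n * r')" by (simp add: C_def distrib_right mult.assoc)
    finally show "bv_norm (F n f) \<le> ennreal (C * exp (real n * r'))"
      using X(3)[of n, folded Y_def] by (intro order_trans[OF bv_norm_orbit_le] ennreal_leI)
  qed
  then show ?thesis by (simp add: r'_def)
qed

text \<open>Inside the cone \<open>V \<le> K * |P|\<close> the mass \<open>P\<close> loses at most the fraction \<open>\<tau> * (1 + K) \<le> 4 * e\<close> of its modulus, while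
\<open>V\<close> is replaced by at most \<open>(\<theta> + 2 * s / K) * K * |P|\<close>.\<close>

lemma cone_invariant:
  assumes f: "mass_right f + mass_left f = 0"
    and K: "0 < K" "K \<le> 1" and gap: "\<theta> + 2 * s / K \<le> 1 - 4 * e"
    and c: "var_le w (F n f) (K * \<bar>mass_right (F n f)\<bar>)"
  shows "(1 - \<tau> n * (1 + K)) * \<bar>mass_right (F n f)\<bar> \<le> \<bar>mass_right (F (Suc n) f)\<bar>"
    and "var_le w (F (Suc n) f) (K * \<bar>mass_right (F (Suc n) f)\<bar>)"
proof -
  let ?P = "mass_right (F n f)" and ?Q = "mass_right (F (Suc n) f)"
  have "\<bar>(1 - \<tau> n) * ?P\<bar> = (1 - \<tau> n) * \<bar>?P\<bar>" using loss_bounds[of n] e by (simp add: abs_mult)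
  then show 1: "(1 - \<tau> n * (1 + K)) * \<bar>?P\<bar> \<le> \<bar>?Q\<bar>"
    using mass_step[OF f c] by (simp add: algebra_simps del: transfer_orbit.simps)
  have "\<tau> n * (1 + K) \<le> (2 * e) * 2" using loss_bounds(1,4)[of n] K e by (intro mult_mono) auto
  then have "(1 - 4 * e) * \<bar>?P\<bar> \<le> (1 - \<tau> n * (1 + K)) * \<bar>?P\<bar>" by (intro mult_right_mono) auto
  with 1 have PQ: "(1 - 4 * e) * \<bar>?P\<bar> \<le> \<bar>?Q\<bar>" by linarith
  have "\<theta> * (K * \<bar>?P\<bar>) + 2 * s * \<bar>?P\<bar> = K * ((\<theta> + 2 * s / K) * \<bar>?P\<bar>)" using K by (simp add: field_simps)
  also have "\<dots> \<le> K * ((1 - 4 * e) * \<bar>?P\<bar>)" using gap K by (intro mult_left_mono mult_right_mono) auto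
  also have "\<dots> \<le> K * \<bar>?Q\<bar>" using PQ K by (intro mult_left_mono) auto
  finally show "var_le w (F (Suc n) f) (K * \<bar>?Q\<bar>)" by (rule var_le_mono[OF var_step0[OF f c]])
qed

text \<open>The orbit starts in the cone, so \<open>|P|\<close> is at least a product of factors \<open>1 - y i\<close> with \<open>y i \<le> 4 * e\<close>, and
\<open>ln (1 - y) \<ge> - y - 2 * y\<^sup>2\<close> for \<open>0 \<le> y \<le> 1/2\<close>.\<close>

lemma growth_lower:
  assumes f: "mass_right f + mass_left f = 0" "mass_right f \<noteq> 0" "var_le w f 0"
    and K: "0 < K" "K \<le> 1" and gap: "\<theta> + 2 * s / K \<le> 1 - 4 * e"
    and r: "\<And>n. (\<Sum>i<n. \<alpha> i + \<beta> i) \<le> real n * r + B"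
  shows "ereal (- r - 2 * e * K - 32 * e\<^sup>2) \<le> growth (\<lambda>n. F n f)"
proof -
  define y where "y i = \<tau> i * (1 + K)" for i
  have y: "0 \<le> y i" "y i \<le> 4 * e" "y i \<le> \<alpha> i + \<beta> i + 2 * e * K" for i
  proof -
    show "0 \<le> y i" using loss_bounds(1)[of i] K by (simp add: y_def)
    show "y i \<le> 4 * e" unfolding y_def using mult_mono[of "\<tau> i" "2 * e" "1 + K" 2] loss_bounds(1,4)[of i] K e by auto
    have "\<tau> i * K \<le> 2 * e * K" using loss_bounds(4)[of i] K by (intro mult_right_mono) auto
    then show "y i \<le> \<alpha> i + \<beta> i + 2 * e * K" using loss_bounds(2)[of i] by (simp add: y_def algebra_simps)
  qed
  have main: "var_le w (F n f) (K * \<bar>mass_right (F n f)\<bar>) \<and>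
      \<bar>mass_right f\<bar> * (\<Prod>i<n. 1 - y i) \<le> \<bar>mass_right (F n f)\<bar>" for n
  proof (induction n)
    case 0
    have "0 \<le> K * \<bar>mass_right f\<bar>" using K by simp
    then show ?case using var_le_mono[OF f(3)] by simp
  next
    case (Suc n)
    have "\<bar>mass_right f\<bar> * (\<Prod>i<Suc n. 1 - y i) = (1 - y n) * (\<bar>mass_right f\<bar> * (\<Prod>i<n. 1 - y i))"
      by (simp add: mult_ac)
    also have "\<dots> \<le> (1 - y n) * \<bar>mass_right (F n f)\<bar>"
      using Suc y(2)[of n] e by (intro mult_left_mono) auto
    also have "\<dots> \<le> \<bar>mass_right (F (Suc n) f)\<bar>"
      unfolding y_def using Suc by (intro cone_invariant(1)[OF f(1) K gap]) auto
    finally show ?case using cone_invariant(2)[OF f(1) K gap] Suc by blast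
  qed
  define r' where "r' = - r - 2 * e * K - 32 * e\<^sup>2"
  have P: "exp (- B) * exp (real n * r') \<le> (\<Prod>i<n. 1 - y i)" for n
  proof -
    have one: "exp (- (\<alpha> i + \<beta> i) - 2 * e * K - 32 * e\<^sup>2) \<le> 1 - y i" for i
    proof -
      have "- y i - 2 * (y i)\<^sup>2 \<le> ln (1 - y i)"
        using y[of i] e by (intro ln_one_minus_pos_lower_bound) auto
      moreover have "(y i)\<^sup>2 \<le> (4 * e)\<^sup>2" using y[of i] by (intro power_mono) auto
      ultimately have "- (\<alpha> i + \<beta> i) - 2 * e * K - 32 * e\<^sup>2 \<le> ln (1 - y i)"
        using y(3)[of i] by (simp add: power_mult_distrib)
      then have "exp (- (\<alpha> i + \<beta> i) - 2 * e * K - 32 * e\<^sup>2) \<le> exp (ln (1 - y i))" by simp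
      also have "\<dots> = 1 - y i" using y(2)[of i] e by (intro exp_ln) auto
      finally show ?thesis .
    qed
    have "real n * r' = - (real n * r) - real n * (2 * e * K + 32 * e\<^sup>2)"
      by (simp add: r'_def algebra_simps)
    moreover have "(\<Sum>i<n. - (\<alpha> i + \<beta> i) - 2 * e * K - 32 * e\<^sup>2) = - (\<Sum>i<n. \<alpha> i + \<beta> i) - real n * (2 * e * K + 32 * e\<^sup>2)"
      by (simp only: sum_subtractf sum_negf sum_constant card_lessThan) (simp add: distrib_left)
    ultimately have "- B + real n * r' \<le> (\<Sum>i<n. - (\<alpha> i + \<beta> i) - 2 * e * K - 32 * e\<^sup>2)"
      using r[of n] by linarith
    then have "exp (- B + real n * r') \<le> exp (\<Sum>i<n. - (\<alpha> i + \<beta> i) - 2 * e * K - 32 * e\<^sup>2)" by simp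
    also have "\<dots> = (\<Prod>i<n. exp (- (\<alpha> i + \<beta> i) - 2 * e * K - 32 * e\<^sup>2))" by (rule exp_sum) simp
    also have "\<dots> \<le> (\<Prod>i<n. 1 - y i)" using one by (intro prod_mono) auto
    finally show ?thesis by (simp only: exp_add)
  qed
  have "ereal r' \<le> growth (\<lambda>n. F n f)"
  proof (rule growth_ge)
    show "0 < \<bar>mass_right f\<bar> * exp (- B)" using f by simp
    fix n
    have "\<bar>mass_right f\<bar> * exp (- B) * exp (real n * r') \<le> \<bar>mass_right f\<bar> * (\<Prod>i<n. 1 - y i)"
      unfolding mult.assoc using P by (intro mult_left_mono) auto
    also have "\<dots> \<le> norm (F n f)" using main[of n] abs_mass_le(1)[of "F n f"] by linarith
    finally show "ennreal (\<bar>mass_right f\<bar> * exp (- B) * exp (real n * r')) \<le> bv_norm (F n f)"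
      by (rule norm_le_bv_norm)
  qed
  then show ?thesis by (simp add: r'_def)
qed

text \<open>Once in the cone \<open>V \<le> |P|\<close> with \<open>P \<noteq> 0\<close>, an orbit stays there with \<open>P \<noteq> 0\<close>. So if \<open>P\<close> vanishes at time \<open>n\<close>, then
until then every bound for \<open>V\<close> is also one for \<open>|P|\<close>, and the Lasota--Yorke inequality becomes a contraction
by \<open>\<theta> + 2 * s\<close>.\<close>

lemma outside_cone_decay:
  assumes f: "mass_right f + mass_left f = 0" "var_le w f c" and gap: "\<theta> + 2 * s \<le> 1 - 4 * e"
    and zero: "mass_right (F n f) = 0" and j: "j \<le> n"
  shows "var_le w (F j f) ((\<theta> + 2 * s) ^ j * c) \<and> \<bar>mass_right (F j f)\<bar> \<le> (\<theta> + 2 * s) ^ j * c"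
proof -
  have outside: "\<bar>mass_right (F j f)\<bar> \<le> d" if j: "j \<le> n" and d: "var_le w (F j f) d" for j d
  proof (rule ccontr)
    assume "\<not> \<bar>mass_right (F j f)\<bar> \<le> d"
    then have cone: "var_le w (F j f) (1 * \<bar>mass_right (F j f)\<bar>)" using var_le_mono[OF d] by simp
    have nz: "mass_right (F j f) \<noteq> 0"
    proof
      assume "mass_right (F j f) = 0"
      moreover have "0 \<le> d"
      proof -
        have "paired_test w (\<lambda>_. 0)"
          by (simp add: paired_test_def half_test_def bdd_borel_const set_lebesgue_integral_def weight_nonneg)
        then have "pairing (F j f) (\<lambda>_. 0) \<le> d" using d by (simp add: var_le_def)
        then show ?thesis by (simp add: pairing_def)
      qed
      ultimately show False using \<open>\<not> \<bar>mass_right (F j f)\<bar> \<le> d\<close> by simp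
    qed
    have "var_le w (F m f) (1 * \<bar>mass_right (F m f)\<bar>) \<and> mass_right (F m f) \<noteq> 0" if "j \<le> m" for m
      using that
    proof (induction m rule: dec_induct)
      case base show ?case using cone nz by blast
    next
      case (step m)
      have gap': "\<theta> + 2 * s / 1 \<le> 1 - 4 * e" using gap by simp
      have "\<tau> m * (1 + 1) < 1" using loss_bounds(4)[of m] e by simp
      then have "0 < (1 - \<tau> m * (1 + 1)) * \<bar>mass_right (F m f)\<bar>" using step by simp
      also have "\<dots> \<le> \<bar>mass_right (F (Suc m) f)\<bar>"
        using step by (intro cone_invariant(1)[OF f(1) _ _ gap']) auto
      finally show ?case
        using cone_invariant(2)[OF f(1) _ _ gap'] step by auto
    qed
    from this[OF j] zero show False by blast
  qed
  show ?thesis using j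
  proof (induction j)
    case 0
    then show ?case using outside[of 0 c] f by simp
  next
    case (Suc j)
    let ?d = "(\<theta> + 2 * s) ^ j * c"
    have IH: "var_le w (F j f) ?d" "\<bar>mass_right (F j f)\<bar> \<le> ?d" using Suc by auto
    have "\<theta> * ?d + 2 * s * \<bar>mass_right (F j f)\<bar> \<le> \<theta> * ?d + 2 * s * ?d"
      using IH s_pos by (intro add_left_mono mult_left_mono) auto
    also have "\<dots> = (\<theta> + 2 * s) ^ Suc j * c" by (simp add: algebra_simps)
    finally have v: "var_le w (F (Suc j) f) ((\<theta> + 2 * s) ^ Suc j * c)"
      by (rule var_le_mono[OF var_step0[OF f(1) IH(1)]])
    then show ?case using outside[OF Suc.prems v] by blast
  qed
qed

text \<open>For each \<open>n\<close> some unit coefficient vector gives total mass \<open>0\<close> and right mass \<open>0\<close> at time \<open>n\<close>, hence the decay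
of \<open>outside_cone_decay\<close> up to time \<open>n\<close>. The bounds for a fixed time are closed conditions on the coefficients,
so they pass to a limit point of these vectors.\<close>

lemma slow_combination:
  assumes b: "b1 \<in> BV" "b2 \<in> BV" "b3 \<in> BV" and gap: "\<theta> + 2 * s \<le> 1 - 4 * e"
  shows "\<exists>x y z. (x, y, z) \<noteq> (0, 0, 0) \<and>
    growth (\<lambda>n. F n (x *\<^sub>R b1 + y *\<^sub>R b2 + z *\<^sub>R b3)) \<le> ereal (ln (\<theta> + 2 * s))"
proof -
  define comb :: "real \<times> real \<times> real \<Rightarrow> l1"
    where "comb v = fst v *\<^sub>R b1 + fst (snd v) *\<^sub>R b2 + snd (snd v) *\<^sub>R b3" for v
  define M where "M f = mass_right f + mass_left f" for f
  obtain c1 c2 c3 where c: "0 \<le> c1" "var_le w b1 c1" "0 \<le> c2" "var_le w b2 c2" "0 \<le> c3" "var_le w b3 c3"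
    using var_le_BV[OF b(1)] var_le_BV[OF b(2)] var_le_BV[OF b(3)] w_le_1 by metis
  define c where "c = c1 + c2 + c3"
  have c0: "0 \<le> c" using c by (simp add: c_def)
  have comb_var: "var_le w (comb v) c" if v: "norm v = 1" for v
  proof -
    have n: "\<bar>fst v\<bar> \<le> 1" "\<bar>fst (snd v)\<bar> \<le> 1" "\<bar>snd (snd v)\<bar> \<le> 1"
      using norm_fst_le[of "fst v" "snd v"] norm_snd_le[of "snd v" "fst v"]
        norm_fst_le[of "fst (snd v)" "snd (snd v)"] norm_snd_le[of "snd (snd v)" "fst (snd v)"] v
      by auto
    have 1: "var_le w (comb v) (\<bar>fst v\<bar> * c1 + \<bar>fst (snd v)\<bar> * c2 + \<bar>snd (snd v)\<bar> * c3)"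
      unfolding comb_def by (intro var_le_add var_le_scaleR c weight_nonneg)
    have 2: "\<bar>fst v\<bar> * c1 + \<bar>fst (snd v)\<bar> * c2 + \<bar>snd (snd v)\<bar> * c3 \<le> 1 * c1 + 1 * c2 + 1 * c3"
      using n c by (intro add_mono mult_right_mono) auto
    show ?thesis by (rule var_le_mono[OF 1]) (use 2 in \<open>simp add: c_def\<close>)
  qed
  have F_comb: "pairing (F n (comb v)) g = fst v * pairing (F n b1) g + fst (snd v) * pairing (F n b2) g
      + snd (snd v) * pairing (F n b3) g" if "bdd_borel g" for n v g
    using that by (simp add: comb_def F_add F_scaleR pairing_add_left pairing_scaleR_left)
  have M_comb: "M (comb v) = fst v * M b1 + fst (snd v) * M b2 + snd (snd v) * M b3" for v
    by (simp add: comb_def M_def mass_add mass_scaleR algebra_simps)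
  have P_comb: "mass_right (F n (comb v)) = fst v * mass_right (F n b1) + fst (snd v) * mass_right (F n b2)
      + snd (snd v) * mass_right (F n b3)" for n v
    unfolding mass_right_def by (rule F_comb) (simp add: bdd_borel_indicator)
  \<comment> \<open>Two linear conditions on three coefficients.\<close>
  have "\<exists>v. norm v = 1 \<and> M (comb v) = 0 \<and> mass_right (F n (comb v)) = 0" for n
  proof -
    let ?S = "{(M b1, M b2, M b3), (mass_right (F n b1), mass_right (F n b2), mass_right (F n b3))}"
    have "dim ?S \<le> card ?S" by (rule dim_le_card') simp
    also have "\<dots> \<le> 2" by (simp add: card_insert_if)
    finally have "dim ?S < DIM(real \<times> real \<times> real)" by simp
    from orthogonal_to_subspace_exists[OF this]
    obtain x where x: "x \<noteq> 0" "\<And>y. y \<in> span ?S \<Longrightarrow> orthogonal x y" by blast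
    have "M (comb x) = 0" "mass_right (F n (comb x)) = 0"
      using x(2)[OF span_base, of "(M b1, M b2, M b3)"]
        x(2)[OF span_base, of "(mass_right (F n b1), mass_right (F n b2), mass_right (F n b3))"]
      by (simp_all add: M_comb P_comb orthogonal_def inner_prod_def)
    moreover have "comb (t *\<^sub>R x) = t *\<^sub>R comb x" for t
      by (simp add: comb_def scaleR_add_right)
    ultimately have "M (comb ((1 / norm x) *\<^sub>R x)) = 0" "mass_right (F n (comb ((1 / norm x) *\<^sub>R x))) = 0"
      by (simp_all add: M_def mass_scaleR F_scaleR flip: distrib_left add_divide_distrib)
    then show ?thesis using x(1) by (intro exI[of _ "(1 / norm x) *\<^sub>R x"]) simp
  qed
  then obtain X where X: "\<And>n. norm (X n) = 1" "\<And>n. M (comb (X n)) = 0" "\<And>n. mass_right (F n (comb (X n))) = 0"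
    by metis
  have "seq_compact (sphere (0 :: real \<times> real \<times> real) 1)"
    by (intro compact_imp_seq_compact) simp
  moreover have "\<forall>n. X n \<in> sphere 0 1" using X(1) by simp
  ultimately obtain l and r :: "nat \<Rightarrow> nat" where l: "l \<in> sphere 0 1" and r: "strict_mono r" and lim: "(X \<circ> r) \<longlonglongrightarrow> l"
    using seq_compactE by blast
  have lim': "(\<lambda>k. fst (X (r k)) * A + fst (snd (X (r k))) * B + snd (snd (X (r k))) * C)
      \<longlonglongrightarrow> fst l * A + fst (snd l) * B + snd (snd l) * C" for A B C
    using lim unfolding comp_def
    by (intro tendsto_intros tendsto_fst tendsto_snd)
  let ?t = "\<theta> + 2 * s"
  have t0: "0 < ?t"
    unfolding contraction_def using s_pos powr_ge_zero[of "2 * (1 + e)" \<gamma>] by linarith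
  have dec: "var_le w (F j (comb (X (r k)))) (?t ^ j * c) \<and> \<bar>mass_right (F j (comb (X (r k))))\<bar> \<le> ?t ^ j * c"
    if "j \<le> k" for j k
    using that seq_suble[OF r, of k] X
    by (intro outside_cone_decay[OF _ _ gap, of _ _ "r k"] comb_var) (auto simp: M_def)
  have var: "var_le w (F j (comb l)) (?t ^ j * c)" for j
    unfolding var_le_def
  proof (intro allI impI)
    fix g assume g: "paired_test w g"
    show "pairing (F j (comb l)) g \<le> ?t ^ j * c"
      unfolding F_comb[OF paired_test_bdd_borel[OF g]]
    proof (rule LIMSEQ_le_const2[OF lim'], intro exI[of _ j] allI impI)
      fix k assume "j \<le> k"
      then show "fst (X (r k)) * pairing (F j b1) g + fst (snd (X (r k))) * pairing (F j b2) g
          + snd (snd (X (r k))) * pairing (F j b3) g \<le> ?t ^ j * c"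
        using dec[of j k] g unfolding F_comb[OF paired_test_bdd_borel[OF g], symmetric] by (simp add: var_le_def)
    qed
  qed
  have P: "\<bar>mass_right (F j (comb l))\<bar> \<le> ?t ^ j * c" for j
    unfolding P_comb
  proof (rule LIMSEQ_le_const2[OF tendsto_rabs[OF lim']], intro exI[of _ j] allI impI)
    fix k assume "j \<le> k"
    then show "\<bar>fst (X (r k)) * mass_right (F j b1) + fst (snd (X (r k))) * mass_right (F j b2)
        + snd (snd (X (r k))) * mass_right (F j b3)\<bar> \<le> ?t ^ j * c"
      using dec[of j k] unfolding P_comb by simp
  qed
  have Ml: "M (comb l) = 0"
    unfolding M_comb by (rule LIMSEQ_unique[OF lim']) (simp only: M_comb[symmetric] X tendsto_const)
  define D where "D = 10 * (c / s) + 2 * c + 1"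
  have "growth (\<lambda>n. F n (comb l)) \<le> ereal (ln ?t)"
  proof (rule growth_le)
    show "0 < D" unfolding D_def using c0 s_pos by (intro add_nonneg_pos add_nonneg_nonneg) auto
    fix n
    have "mass_left (F n (comb l)) = - mass_right (F n (comb l))"
      using total_mass[of n "comb l"] Ml by (simp add: M_def)
    then have "10 * (?t ^ n * c / s) + \<bar>mass_right (F n (comb l))\<bar> + \<bar>mass_left (F n (comb l))\<bar>
        \<le> 10 * (?t ^ n * c / s) + 2 * (?t ^ n * c)"
      using P[of n] by simp
    also have "\<dots> = (10 * (c / s) + 2 * c) * ?t ^ n" by (simp add: algebra_simps)
    also have "\<dots> \<le> D * ?t ^ n" using t0 by (intro mult_right_mono) (auto simp: D_def)
    finally have le: "10 * (?t ^ n * c / s) + \<bar>mass_right (F n (comb l))\<bar> + \<bar>mass_left (F n (comb l))\<bar> \<le> D * ?t ^ n" .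
    have "?t ^ n = exp (real n * ln ?t)" using t0 by (simp add: exp_of_nat_mult)
    then show "bv_norm (F n (comb l)) \<le> ennreal (D * exp (real n * ln ?t))"
      using order_trans[OF bv_norm_orbit_le[OF var] ennreal_leI[OF le]] by (simp only:)
  qed
  moreover have "l \<noteq> 0" using l by auto
  ultimately show ?thesis
    by (intro exI[of _ "fst l"] exI[of _ "fst (snd l)"] exI[of _ "snd (snd l)"])
      (simp add: comb_def zero_prod_def prod_eq_iff)
qed

end

section \<open>Exponents along an orbit\<close>

text \<open>The invariant densities of the two uncoupled tent maps and their combinations. Their dual variation is
\<open>0\<close>, so they lie in every cone.\<close>

definition two_valued :: "real \<Rightarrow> real \<Rightarrow> l1" where
  "two_valued c d = abs_l1 (\<lambda>x. if 0 \<le> x then c else d)"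

lemma integrable_two_valued: "integrable leb (\<lambda>x. if 0 \<le> x then c else d :: real)"
  using bdd_borel_set_integrable[OF bdd_borel_two_constants[of c d], of "-1" 1]
  by (simp add: integrable_leb_iff set_integrable_def)

lemma pairing_two_valued:
  assumes "bdd_borel g"
  shows "pairing (two_valued c d) g = c * (LBINT t:{0..1}. g t) + d * (LBINT t:{0..1}. g (- t))"
proof -
  have m: "g \<in> borel_measurable borel" "(\<lambda>t. g (- t)) \<in> borel_measurable borel"
    using bdd_borel_measurable[OF assms] bdd_borel_measurable[OF bdd_borel_reflect[OF assms]] by auto
  have "pairing (two_valued c d) g = (LBINT t:{0..1}. (if 0 \<le> t then c else d) * g t)
      + (LBINT t:{0..1}. (if 0 \<le> - t then c else d) * g (- t))"
    unfolding two_valued_def pairing_abs_l1[OF integrable_two_valued bdd_borel_measurable_leb[OF assms]]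
    by (rule pairing_split[OF bdd_borel_two_constants assms])
  also have "(LBINT t:{0..1}. (if 0 \<le> t then c else d) * g t) = (LBINT t:{0..1}. c * g t)"
    by (rule set_integral_Icc_cong) (use m in auto)
  also have "(LBINT t:{0..1}. (if 0 \<le> - t then c else d) * g (- t)) = (LBINT t:{0..1}. d * g (- t))"
    by (rule set_integral_Icc_cong) (use m in auto)
  finally show ?thesis by simp
qed

lemma mass_two_valued: "mass_right (two_valued c d) = c" "mass_left (two_valued c d) = d"
proof -
  have *: "(LBINT t:{0..1}. h t) = k" if "\<And>t. 0 < t \<Longrightarrow> t < 1 \<Longrightarrow> h t = k" "h \<in> borel_measurable borel"
    for h :: "real \<Rightarrow> real" and k
    using set_integral_Icc_cong[of h "\<lambda>_. k" 0 1] that by (simp add: set_integral_Icc_const)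
  have "(\<lambda>t::real. indicator {0<..} (- t) :: real) \<in> borel_measurable borel"
    "(\<lambda>t::real. indicator {..<0} (- t) :: real) \<in> borel_measurable borel"
    by (auto intro!: bdd_borel_measurable bdd_borel_reflect[of "indicator _"] bdd_borel_indicator)
  then show "mass_right (two_valued c d) = c" "mass_left (two_valued c d) = d"
    by (simp_all add: mass_right_def mass_left_def pairing_two_valued bdd_borel_indicator *)
qed

lemma var_le_two_valued: "var_le w (two_valued c d) 0"
  by (auto simp: var_le_def pairing_two_valued paired_test_bdd_borel) (simp add: paired_test_def half_test_def)

lemma two_valued_add: "two_valued c d + two_valued c' d' = two_valued (c + c') (d + d')"
proof -
  have "(\<lambda>x. (if 0 \<le> x then c else d) + (if 0 \<le> x then c' else d')) = (\<lambda>x::real. if 0 \<le> x then c + c' else d + d')"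
    by auto
  then show ?thesis
    unfolding two_valued_def by (subst plus_l1.abs_eq) (simp_all add: integrable_two_valued)
qed

lemma two_valued_scaleR: "r *\<^sub>R two_valued c d = two_valued (r * c) (r * d)"
proof -
  have "(\<lambda>x. r * (if 0 \<le> x then c else d)) = (\<lambda>x::real. if 0 \<le> x then r * c else r * d)"
    by auto
  then show ?thesis
    unfolding two_valued_def by (subst scaleR_l1.abs_eq) (simp_all add: integrable_two_valued)
qed

lemma two_valued_BV: "two_valued c d \<in> BV"
proof -
  let ?p = "\<lambda>x::real. if 0 \<le> x then max 0 (c - d) else 0" and ?q = "\<lambda>x::real. if 0 \<le> x then max 0 (d - c) - d else - d"
  have "variation_on {-1..1} (\<lambda>x. if 0 \<le> x then c else d) \<le> ennreal (\<bar>c - d\<bar> + \<bar>c - d\<bar>)"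
    by (rule variation_on_mono_diff[of ?p ?q]) (auto simp: mono_def)
  then have "variation_on {-1..1} (\<lambda>x. if 0 \<le> x then c else d) < \<infinity>"
    by (rule le_less_trans) simp
  then show ?thesis
    unfolding BV_def representatives_def two_valued_def using integrable_two_valued by blast
qed

lemma independent_combination:
  fixes b :: "'i \<Rightarrow> 'v::real_vector"
  assumes "independent B" "inj_on b I" "b ` I \<subseteq> B" "finite I" "i \<in> I" "c i \<noteq> 0"
  shows "(\<Sum>i\<in>I. c i *\<^sub>R b i) \<noteq> 0"
proof
  assume "(\<Sum>i\<in>I. c i *\<^sub>R b i) = 0"
  then have "(\<Sum>v\<in>b ` I. c (inv_into I b v) *\<^sub>R v) = 0"
    using assms(2) by (simp add: sum.reindex)
  then have "c (inv_into I b (b i)) = 0"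
    using assms by (intro independentD[of B "b ` I" "\<lambda>v. c (inv_into I b v)"]) auto
  then show False using assms by simp
qed

text \<open>The Lyapunov exponent in terms of the iterates along a fixed orbit of the base.\<close>

definition exponent :: "(nat \<Rightarrow> l1 \<Rightarrow> l1) \<Rightarrow> nat \<Rightarrow> ereal" where
  "exponent F k = (SUP V\<in>grassmannian k BV. INF f\<in>V - {0}. growth (\<lambda>n. F n f))"

lemma exponent_le:
  assumes "\<And>B. finite B \<Longrightarrow> card B = k \<Longrightarrow> independent B \<Longrightarrow> span B \<subseteq> BV \<Longrightarrow>
    \<exists>f\<in>span B - {0}. growth (\<lambda>n. F n f) \<le> r"
  shows "exponent F k \<le> r"
  unfolding exponent_def
proof (rule SUP_least)
  fix V assume "V \<in> grassmannian k BV"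
  then obtain f where "f \<in> V - {0}" "growth (\<lambda>n. F n f) \<le> r"
    using assms by (auto simp: grassmannian_def)
  then show "(INF f\<in>V - {0}. growth (\<lambda>n. F n f)) \<le> r" by (rule INF_lower2)
qed

lemma exponent_ge:
  assumes "finite B" "card B = k" "independent B" "span B \<subseteq> BV"
    and "\<And>f. f \<in> span B \<Longrightarrow> f \<noteq> 0 \<Longrightarrow> r \<le> growth (\<lambda>n. F n f)"
  shows "r \<le> exponent F k"
  unfolding exponent_def
proof (rule SUP_upper2)
  show "span B \<in> grassmannian k BV" using assms by (auto simp: grassmannian_def)
  show "r \<le> (INF f\<in>span B - {0}. growth (\<lambda>n. F n f))"
    using assms(5) by (auto intro: INF_greatest)
qed

lemma three_elements:
  assumes "3 \<le> card B"
  obtains b :: "nat \<Rightarrow> 'a" where "inj_on b {..<3}" "b ` {..<3} \<subseteq> B"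
proof -
  obtain T where T: "T \<subseteq> B" "card T = 3"
    using obtain_subset_with_card_n[OF assms] by blast
  then have "finite T" using card.infinite by fastforce
  then obtain h where "bij_betw h {0..<card T} T" using ex_bij_betw_nat_finite by blast
  then show thesis using T that[of h] by (auto simp: bij_betw_def lessThan_atLeast0)
qed

context tent_orbit
begin

lemma exponent_1:
  assumes "\<theta> < 1"
  shows "exponent F 1 = 0"
proof (rule antisym)
  show "exponent F 1 \<le> 0"
  proof (rule exponent_le)
    fix B :: "l1 set" assume B: "card B = 1" "independent B" "span B \<subseteq> BV"
    then obtain b where b: "B = {b}" by (auto simp: card_1_singleton_iff)
    then have "b \<in> span B - {0}" using B by (auto simp: span_base)
    then show "\<exists>f\<in>span B - {0}. growth (\<lambda>n. F n f) \<le> 0"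
      using growth_le_0[OF _ assms] B by blast
  qed
  show "0 \<le> exponent F 1"
  proof (rule exponent_ge[of "{two_valued 1 1}"])
    have nz: "two_valued 1 1 \<noteq> 0"
      using mass_two_valued(1)[of 1 1] mass_scaleR(1)[of 0 0] by auto
    then show "independent {two_valued 1 1}" by simp
    show "span {two_valued 1 1} \<subseteq> BV"
      by (auto simp: span_singleton two_valued_scaleR two_valued_BV)
    fix f assume "f \<in> span {two_valued 1 1}" "f \<noteq> 0"
    then obtain r where r: "f = two_valued r r" and "f \<noteq> 0" by (auto simp: span_singleton two_valued_scaleR)
    then have "r \<noteq> 0" using two_valued_scaleR[of 0 1 1] by auto
    then show "0 \<le> growth (\<lambda>n. F n f)"
      by (intro growth_ge_0) (simp add: r mass_two_valued)
  qed simp_all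
qed

text \<open>The total mass is linear, so it vanishes on some nonzero element of every plane.\<close>

lemma exponent_2_upper:
  assumes K: "0 < K" "K \<le> 1" and gap: "\<theta> + 2 * s / K \<le> 1 - 4 * e"
    and r: "\<And>n. real n * r - B \<le> (\<Sum>i<n. \<alpha> i + \<beta> i)"
  shows "exponent F 2 \<le> ereal (- r + 2 * e * K + 2 * e\<^sup>2)"
proof (rule exponent_le)
  fix B' :: "l1 set" assume B': "card B' = 2" "independent B'" "span B' \<subseteq> BV"
  then obtain b1 b2 where b: "B' = {b1, b2}" "b1 \<noteq> b2" by (auto simp: card_2_iff)
  define M where "M f = mass_right f + mass_left f" for f
  obtain x y where xy: "x * M b1 + y * M b2 = 0" "x \<noteq> 0 \<or> y \<noteq> 0"
  proof (cases "M b1 = 0")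
    case True
    show thesis by (rule that[of 1 0]) (simp_all add: True)
  next
    case False
    show thesis by (rule that[of "M b2" "- M b1"]) (use False in simp_all)
  qed
  define f where "f = x *\<^sub>R b1 + y *\<^sub>R b2"
  define c where "c i = (if i then x else y)" for i
  define b' where "b' i = (if i then b1 else b2)" for i
  have "(\<Sum>i\<in>UNIV. c i *\<^sub>R b' i) \<noteq> 0"
    using xy(2) b B' by (intro independent_combination[of B' b' UNIV "x \<noteq> 0"])
      (auto simp: b'_def c_def inj_on_def split: if_splits)
  then have "f \<noteq> 0" by (simp add: UNIV_bool c_def b'_def f_def add.commute)
  moreover have fs: "f \<in> span B'"
    unfolding f_def b by (intro span_add span_scale span_base) auto
  moreover have "mass_right f + mass_left f = 0"
    using xy(1) by (simp add: f_def mass_add mass_scaleR M_def algebra_simps)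
  ultimately show "\<exists>f\<in>span B' - {0}. growth (\<lambda>n. F n f) \<le> ereal (- r + 2 * e * K + 2 * e\<^sup>2)"
    using growth_upper[OF _ _ K gap r, of f] B'(3) by (intro bexI[of _ f]) auto
qed

text \<open>The plane consists of the two-valued functions. Those of nonzero total mass do not decay, and the others
are multiples of the difference of the two invariant densities, which lies in the cone.\<close>

lemma exponent_2_lower:
  assumes K: "0 < K" "K \<le> 1" and gap: "\<theta> + 2 * s / K \<le> 1 - 4 * e"
    and r: "\<And>n. (\<Sum>i<n. \<alpha> i + \<beta> i) \<le> real n * r + B"
    and neg: "- r - 2 * e * K - 32 * e\<^sup>2 \<le> 0"
  shows "ereal (- r - 2 * e * K - 32 * e\<^sup>2) \<le> exponent F 2"
proof (rule exponent_ge)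
  have ne: "two_valued 1 1 \<noteq> two_valued 1 (- 1)"
    using mass_two_valued(2)[of 1 1] mass_two_valued(2)[of 1 "- 1"] by auto
  have nz: "two_valued 1 1 \<noteq> 0"
    using mass_two_valued(1)[of 1 1] mass_scaleR(1)[of 0 0] by auto
  have "two_valued 1 (- 1) \<notin> span {two_valued 1 1}"
  proof
    assume "two_valued 1 (- 1) \<in> span {two_valued 1 1}"
    then obtain t where t: "two_valued 1 (- 1) = two_valued t t" by (auto simp: span_singleton two_valued_scaleR)
    show False
      using mass_two_valued[of 1 "- 1"] mass_two_valued[of t t] unfolding t by simp
  qed
  then show "independent {two_valued 1 (- 1), two_valued 1 1}"
    using nz ne by (simp add: independent_insert)
  show "card {two_valued 1 (- 1), two_valued 1 1} = 2" using ne by simp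
  have span: "\<exists>c d. f = two_valued c d" if "f \<in> span {two_valued 1 (- 1), two_valued 1 1}" for f
  proof -
    have "\<exists>k t. f - k *\<^sub>R two_valued 1 (- 1) - t *\<^sub>R two_valued 1 1 \<in> span {}"
      using that unfolding span_breakdown_eq .
    then obtain k t where "f = t *\<^sub>R two_valued 1 1 + k *\<^sub>R two_valued 1 (- 1)"
      by (auto simp: algebra_simps)
    then show ?thesis by (auto simp: two_valued_scaleR two_valued_add)
  qed
  show "span {two_valued 1 (- 1), two_valued 1 1} \<subseteq> BV"
    using span two_valued_BV by blast
  fix f assume f: "f \<in> span {two_valued 1 (- 1), two_valued 1 1}" "f \<noteq> 0"
  then obtain c d where cd: "f = two_valued c d" using span by blast
  show "ereal (- r - 2 * e * K - 32 * e\<^sup>2) \<le> growth (\<lambda>n. F n f)"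
  proof (cases "c + d = 0")
    case True
    have "c \<noteq> 0"
    proof
      assume "c = 0"
      then have "f = 0 *\<^sub>R two_valued 1 1" using True cd by (simp only: two_valued_scaleR) simp
      then show False using f by simp
    qed
    then show ?thesis
      using True by (intro growth_lower[OF _ _ _ K gap r]) (simp_all add: cd mass_two_valued var_le_two_valued)
  next
    case False
    have "ereal (- r - 2 * e * K - 32 * e\<^sup>2) \<le> 0" using neg by (simp add: zero_ereal_def)
    also have "0 \<le> growth (\<lambda>n. F n f)"
      using False by (intro growth_ge_0) (simp add: cd mass_two_valued)
    finally show ?thesis .
  qed
qed simp

lemma exponent_ge_3:
  assumes gap: "\<theta> + 2 * s \<le> 1 - 4 * e" and k: "3 \<le> k"
  shows "exponent F k \<le> ereal (ln (\<theta> + 2 * s))"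
proof (rule exponent_le)
  fix B :: "l1 set" assume B: "card B = k" "independent B" "span B \<subseteq> BV"
  obtain b :: "nat \<Rightarrow> l1" where b: "inj_on b {..<3}" "b ` {..<3} \<subseteq> B"
    using three_elements[of B] k B by metis
  have bB: "b 0 \<in> span B" "b 1 \<in> span B" "b 2 \<in> span B"
    using b(2) by (auto intro!: span_base)
  obtain x y z where xyz: "(x, y, z) \<noteq> (0, 0, 0)"
    "growth (\<lambda>n. F n (x *\<^sub>R b 0 + y *\<^sub>R b 1 + z *\<^sub>R b 2)) \<le> ereal (ln (\<theta> + 2 * s))"
    using slow_combination[OF _ _ _ gap, of "b 0" "b 1" "b 2"] bB B(3) by blast
  define f where "f = x *\<^sub>R b 0 + y *\<^sub>R b 1 + z *\<^sub>R b 2"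
  define c where "c i = (if i = 0 then x else if i = 1 then y else z)" for i :: nat
  obtain i where i: "i \<in> {..<3}" "c i \<noteq> 0"
  proof -
    have "c 0 \<noteq> 0 \<or> c 1 \<noteq> 0 \<or> c 2 \<noteq> 0" using xyz(1) by (auto simp: c_def)
    then show thesis using that[of 0] that[of 1] that[of 2] by auto
  qed
  have "(\<Sum>i<3. c i *\<^sub>R b i) \<noteq> 0"
    by (rule independent_combination[of B b "{..<3}" i c]) (use B b i in auto)
  then have "f \<noteq> 0" by (simp add: c_def f_def eval_nat_numeral)
  moreover have "f \<in> span B"
    unfolding f_def by (intro span_add span_scale bB)
  ultimately show "\<exists>f\<in>span B - {0}. growth (\<lambda>n. F n f) \<le> ereal (ln (\<theta> + 2 * s))"
    using xyz(2) unfolding f_def by blast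
qed

end

lemma cocycle_eq_transfer_orbit:
  assumes "\<And>\<omega>. L \<omega> = perron_frobenius (paired_tent (A \<omega>) (B \<omega>))"
  shows "cocycle \<sigma> L n \<omega> f = transfer_orbit (\<lambda>i. A ((\<sigma> ^^ i) \<omega>)) (\<lambda>i. B ((\<sigma> ^^ i) \<omega>)) n f"
  by (induction n) (simp_all add: assms)

lemma lyapunov_exponent_eq:
  assumes "\<And>\<omega>. L \<omega> = perron_frobenius (paired_tent (A \<omega>) (B \<omega>))"
  shows "lyapunov_exponent \<sigma> L k \<omega>
    = exponent (transfer_orbit (\<lambda>i. A ((\<sigma> ^^ i) \<omega>)) (\<lambda>i. B ((\<sigma> ^^ i) \<omega>))) k"
  by (simp add: lyapunov_exponent_def exponent_def growth_def cocycle_eq_transfer_orbit[OF assms])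

section \<open>The two weight exponents and small parameters\<close>

text \<open>With this exponent a new jump weighs \<open>exp 1 * e\<close>, while \<open>2 powr (- 1 / l)\<close> keeps the contraction factor below \<open>1\<close>
by at least \<open>1 / (3 * l)\<close>, up to order \<open>e\<close>. An aperture that is a large enough multiple of \<open>e * l\<close> balances the
two effects.\<close>

lemma gap_near_one:
  fixes e :: real
  defines "l \<equiv> ln (1 / e)"
  assumes e: "0 < e" and l: "1 \<le> l" and small: "96 * e * l \<le> 1"
  shows "contraction e (1 - 1 / l) + 2 * e powr (1 - 1 / l) / (24 * e * l) \<le> 1 - 4 * e"
proof -
  define u where "u = 1 / l"
  have u: "0 < u" "u \<le> 1" "u * l = 1" using l by (simp_all add: u_def)
  have lnle: "ln e = - l" using e by (simp add: l_def ln_div)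
  have "e powr (1 - u) = exp (- l + u * l)"
    using e by (simp add: powr_def lnle algebra_simps)
  also have "\<dots> = e * exp 1"
    unfolding exp_add u(3) using exp_ln[OF e] lnle by simp
  finally have s: "e powr (1 - u) \<le> 3 * e" using exp_le e by simp
  have ln2: "1/2 \<le> ln (2::real)" using ln2_ge_two_thirds by simp
  have two: "2 powr (- u) \<le> 1 - u / 3"
  proof -
    have pos: "0 < 1 + u * ln 2" using u ln2 by (intro add_pos_nonneg mult_nonneg_nonneg) auto
    have "1 + u * ln 2 \<le> 2 powr u" using exp_ge_add_one_self[of "u * ln 2"] by (simp add: powr_def)
    then have "2 powr (- u) \<le> 1 / (1 + u * ln 2)"
      using pos by (simp add: powr_minus_divide frac_le)
    also have "\<dots> \<le> 1 - u / 3"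
    proof -
      have "u * u * ln 2 \<le> 1 * u * ln 2" using u ln2 by (intro mult_right_mono) auto
      moreover have "u * (1/2) \<le> u * ln 2" using u ln2 by (intro mult_left_mono) auto
      ultimately have "1 \<le> (1 - u / 3) * (1 + u * ln 2)" by (simp add: algebra_simps)
      then show ?thesis using pos by (simp add: pos_divide_le_eq)
    qed
    finally show ?thesis .
  qed
  have "(2 * (1 + e)) powr (1 - u) = 2 powr (1 - u) * (1 + e) powr (1 - u)"
    using powr_mult[of 2 "1 + e" "1 - u"] e by simp
  moreover have "2 powr (1 - u) = 2 * 2 powr (- u)"
    using powr_add[of 2 1 "- u"] by simp
  ultimately have "(2 * (1 + e)) powr (1 - u) / 2 = 2 powr (- u) * (1 + e) powr (1 - u)"
    by simp
  also have "\<dots> \<le> (1 - u / 3) * (1 + e)"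
    using two powr_mono[of "1 - u" 1 "1 + e"] u e by (intro mult_mono) auto
  also have "\<dots> \<le> 1 - u / 3 + e" using u e by (simp add: algebra_simps)
  finally have \<theta>: "contraction e (1 - u) \<le> 1 - u / 3 + 4 * e"
    using s by (simp add: contraction_def)
  have "2 * e powr (1 - u) / (24 * e * l) \<le> 2 * (3 * e) / (24 * e * l)"
    using s e l by (intro divide_right_mono) auto
  also have "\<dots> = u / 4" using e by (simp add: u_def)
  finally have "contraction e (1 - u) + 2 * e powr (1 - u) / (24 * e * l) \<le> 1 - u / 12 + 4 * e"
    using \<theta> by simp
  moreover have "96 * e \<le> u" using small u l by (simp add: u_def field_simps)
  ultimately show ?thesis by (simp add: u_def)
qed

text \<open>With this exponent a new jump weighs \<open>1 / l\<close>, and the growth of the weights costs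
\<open>ln l / l * ln (2 * (1 + e))\<close> in the logarithm of the contraction factor.\<close>

lemma ln_contraction_near_zero:
  fixes e :: real
  defines "l \<equiv> ln (1 / e)"
  assumes e: "0 < e" "e \<le> 1/2" and l: "1 \<le> ln l" "0 < l"
  shows "ln (contraction e (ln l / l) + 2 * e powr (ln l / l)) \<le> - ln 2 + 8 * (ln l / l)"
proof -
  define g where "g = ln l / l"
  have "0 < ln l" using l by linarith
  then have g: "0 < g" "1 / l \<le> g" "g * l = ln l"
    using l by (simp_all add: g_def divide_right_mono)
  have lnle: "ln e = - l" using e by (simp add: l_def ln_div)
  have "e powr g = exp (- ln l)" using e g by (simp add: powr_def lnle)
  then have s: "e powr g = 1 / l" using l by (simp add: exp_minus inverse_eq_divide)
  define X where "X = (2 * (1 + e)) powr g"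
  have X1: "1 \<le> X" unfolding X_def using e g by (intro ge_one_powr_ge_zero) auto
  have X: "ln X \<le> 2 * g"
  proof -
    have "ln X = g * ln (2 * (1 + e))" using e by (simp add: X_def ln_powr)
    also have "ln (2 * (1 + e)) \<le> 2 * (1 + e) - 1" using e by (intro ln_le_minus_one) auto
    also have "\<dots> \<le> 2" using e by simp
    finally show ?thesis using g by (simp add: mult.commute)
  qed
  have "contraction e g + 2 * e powr g = X / 2 + 3 * (1 / l)" by (simp add: contraction_def X_def s)
  also have "\<dots> \<le> X / 2 + (X / 2) * (6 / l)"
    using mult_left_mono[OF X1, of "3 * (1 / l)"] l by simp
  also have "\<dots> = (X / 2) * (1 + 6 / l)" by (simp add: algebra_simps)
  finally have "ln (contraction e g + 2 * e powr g) \<le> ln ((X / 2) * (1 + 6 / l))"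
    using l e by (intro ln_mono) (auto simp: contraction_def intro!: add_nonneg_pos)
  also have "\<dots> = ln X - ln 2 + ln (1 + 6 / l)"
    using X1 l add_pos_pos[of 1 "6 / l"] by (simp add: ln_mult ln_div)
  also have "ln (1 + 6 / l) \<le> 6 / l" using l by (intro ln_add_one_self_le_self) simp
  finally show ?thesis using X g by (simp add: g_def)
qed


lemma eventually_at_right_0_ball:
  assumes "eventually Q (at_right (0::real))"
  shows "\<exists>r. 0 < r \<and> r \<le> 1 \<and> (\<forall>x\<in>{0<..<r}. Q x)"
proof -
  obtain b where "0 < b" "\<forall>y>0. y < b \<longrightarrow> Q y"
    using assms unfolding eventually_at_right_field by blast
  then show ?thesis by (intro exI[of _ "min b 1"]) simp
qed

lemma eventually_small_parameters:
  assumes I: "0 < (I :: real)" "I \<le> 2"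
  shows "\<exists>e\<^sub>0. 0 < e\<^sub>0 \<and> e\<^sub>0 \<le> 1 \<and> (\<forall>e\<in>{0<..<e\<^sub>0}. e \<le> 1/8 \<and> 1 \<le> ln (ln (1/e)) \<and> 2 \<le> ln (1/e) \<and>
    96 * e * ln (1/e) \<le> 1 \<and> ln (ln (1/e)) \<le> ln (1/e) \<and>
    contraction e (ln (ln (1/e)) / ln (1/e)) + 2 * e powr (ln (ln (1/e)) / ln (1/e)) \<le> 1 - 4 * e \<and>
    - (e * I) + 81 * (e\<^sup>2 * ln (1/e)) < 0 \<and>
    - ln 2 + 8 * (ln (ln (1/e)) / ln (1/e)) < - (e * I) - 81 * (e\<^sup>2 * ln (1/e)))"
proof -
  have "eventually (\<lambda>e::real. e \<le> 1/8 \<and> 1 \<le> ln (ln (1/e)) \<and> 2 \<le> ln (1/e) \<and>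
    96 * e * ln (1/e) \<le> 1 \<and> ln (ln (1/e)) \<le> ln (1/e) \<and>
    contraction e (ln (ln (1/e)) / ln (1/e)) + 2 * e powr (ln (ln (1/e)) / ln (1/e)) \<le> 1 - 4 * e \<and>
    - (e * I) + 81 * (e\<^sup>2 * ln (1/e)) < 0 \<and>
    - ln 2 + 8 * (ln (ln (1/e)) / ln (1/e)) < - (e * I) - 81 * (e\<^sup>2 * ln (1/e))) (at_right 0)"
    unfolding contraction_def using I(1) by (intro eventually_conj; real_asymp)
  from eventually_at_right_0_ball[OF this] show ?thesis .
qed

section \<open>The leading Lyapunov exponents\<close>

theorem theorem2p1:
  fixes M :: "'w measure" and \<sigma> :: "'w \<Rightarrow> 'w" and a b :: "'w \<Rightarrow> real"
    and T :: "real \<Rightarrow> 'w \<Rightarrow> real \<Rightarrow> real"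
    and L :: "real \<Rightarrow> 'w \<Rightarrow> l1 \<Rightarrow> l1"
    and lam :: "real \<Rightarrow> nat \<Rightarrow> 'w \<Rightarrow> ereal"
  assumes "prob_space M"
    and "invertible_measure_preserving M \<sigma>"
    and "ergodic M \<sigma>"
    and "a \<in> borel_measurable M" and "\<forall>\<omega>\<in>space M. a \<omega> \<in> {0..1}"
    and "\<not> (AE \<omega> in M. a \<omega> = 0)"
    and "b \<in> borel_measurable M" and "\<forall>\<omega>\<in>space M. b \<omega> \<in> {0..1}"
    and "\<not> (AE \<omega> in M. b \<omega> = 0)"
    and T_def: "\<And>\<epsilon> \<omega>. T \<epsilon> \<omega> = paired_tent (\<epsilon> * a \<omega>) (\<epsilon> * b \<omega>)"
    and L_def: "\<And>\<epsilon> \<omega>. L \<epsilon> \<omega> = perron_frobenius (T \<epsilon> \<omega>)"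
    and lam_def: "\<And>\<epsilon> k \<omega>. lam \<epsilon> k \<omega> = lyapunov_exponent \<sigma> (L \<epsilon>) k \<omega>"
  shows "\<exists>C \<epsilon>\<^sub>0. C > 0 \<and> 0 < \<epsilon>\<^sub>0 \<and> \<epsilon>\<^sub>0 \<le> 1 \<and>
    (\<forall>\<epsilon>\<in>{0<..<\<epsilon>\<^sub>0}. AE \<omega> in M.
       lam \<epsilon> 1 \<omega> = 0 \<and>
       \<bar>lam \<epsilon> 2 \<omega> + ereal (\<epsilon> * (LINT \<omega>'|M. a \<omega>' + b \<omega>'))\<bar> \<le> ereal (C * \<epsilon>\<^sup>2 * \<bar>ln \<epsilon>\<bar>) \<and>
       (\<forall>k\<ge>3. lam \<epsilon> k \<omega> \<le> ereal (- ln 2 + C * ln (ln (1 / \<epsilon>)) / ln (1 / \<epsilon>))) \<and>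
       lam \<epsilon> 2 \<omega> < lam \<epsilon> 1 \<omega> \<and> lam \<epsilon> 3 \<omega> < lam \<epsilon> 2 \<omega>)"
proof -
  interpret prob_space M by fact
  have \<sigma>: "\<sigma> \<in> M \<rightarrow>\<^sub>M M" "distr M M \<sigma> = M"
    using assms(2) by (auto simp: invertible_measure_preserving_def)
  define \<phi> where "\<phi> \<omega> = a \<omega> + b \<omega>" for \<omega>
  have [measurable]: "a \<in> borel_measurable M" "b \<in> borel_measurable M" by fact+
  have \<phi>m: "\<phi> \<in> borel_measurable M" unfolding \<phi>_def by measurable
  have \<phi>b: "0 \<le> \<phi> \<omega>" "\<phi> \<omega> \<le> 2" if "\<omega> \<in> space M" for \<omega>
    using assms(5,8) that by (fastforce simp: \<phi>_def)+
  have \<phi>i: "integrable M \<phi>"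
    by (rule integrable_const_bound[where B = 2]) (use \<phi>b \<phi>m in auto)
  define I where "I = (LINT \<omega>|M. \<phi> \<omega>)"
  have I2: "I \<le> 2"
    unfolding I_def using \<phi>b by (intro integral_le_const[OF \<phi>i]) auto
  have I0: "0 < I"
  proof -
    have "0 \<le> I" unfolding I_def using \<phi>b by (intro integral_nonneg_AE) auto
    moreover have "I \<noteq> 0"
    proof
      assume "I = 0"
      then have "AE \<omega> in M. \<phi> \<omega> = 0"
        using integral_nonneg_eq_0_iff_AE[OF \<phi>i] \<phi>b by (auto simp: I_def)
      then have "AE \<omega> in M. a \<omega> = 0"
        using AE_space by eventually_elim (use assms(5,8) in \<open>fastforce simp: \<phi>_def\<close>)
      then show False using assms(6) by simp
    qed
    ultimately show ?thesis by simp
  qed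
  obtain e\<^sub>0 where e\<^sub>0: "0 < e\<^sub>0" "e\<^sub>0 \<le> 1"
    and small: "\<And>e. 0 < e \<Longrightarrow> e < e\<^sub>0 \<Longrightarrow> e \<le> 1/8 \<and> 1 \<le> ln (ln (1/e)) \<and> 2 \<le> ln (1/e) \<and>
    96 * e * ln (1/e) \<le> 1 \<and> ln (ln (1/e)) \<le> ln (1/e) \<and>
    contraction e (ln (ln (1/e)) / ln (1/e)) + 2 * e powr (ln (ln (1/e)) / ln (1/e)) \<le> 1 - 4 * e \<and>
    - (e * I) + 81 * (e\<^sup>2 * ln (1/e)) < 0 \<and>
    - ln 2 + 8 * (ln (ln (1/e)) / ln (1/e)) < - (e * I) - 81 * (e\<^sup>2 * ln (1/e))"
    using eventually_small_parameters[OF I0 I2] by auto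
  show ?thesis
  proof (rule exI[of _ 81], rule exI[of _ e\<^sub>0], intro conjI ballI)
    show "0 < e\<^sub>0" "e\<^sub>0 \<le> 1" by fact+
    fix e assume "e \<in> {0<..<e\<^sub>0}"
    then have e: "0 < e" "e < e\<^sub>0" by auto
    define l where "l = ln (1 / e)"
    have e8: "e \<le> 1/8" and ll: "1 \<le> ln l" "ln l \<le> l" and l2: "2 \<le> l" and el: "96 * e * l \<le> 1"
      and gap3: "contraction e (ln l / l) + 2 * e powr (ln l / l) \<le> 1 - 4 * e"
      and sep1: "- (e * I) + 81 * (e\<^sup>2 * l) < 0"
      and sep2: "- ln 2 + 8 * (ln l / l) < - (e * I) - 81 * (e\<^sup>2 * l)"
      using small[OF e] by (simp_all add: l_def)
    \<comment> \<open>Up to the constant, \<open>e * l\<close> is the weight \<open>exp 1 * e\<close> of a new jump divided by the deficit \<open>1 / l\<close> of the contraction.\<close>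
    define K where "K = 24 * e * l"
    have K: "0 < K" "K \<le> 1" using e l2 el by (auto simp: K_def)
    have gap2: "contraction e (1 - 1 / l) + 2 * e powr (1 - 1 / l) / K \<le> 1 - 4 * e"
      unfolding K_def l_def using e l2 el by (intro gap_near_one) (auto simp: l_def)
    have \<theta>1: "contraction e (1 - 1 / l) < 1"
      using gap2 K e by (smt (verit) divide_nonneg_nonneg powr_ge_zero mult_nonneg_nonneg)
    have abs_ln: "\<bar>ln e\<bar> = l" using e l2 by (simp add: l_def ln_div)
    \<comment> \<open>Accuracy \<open>e\<close> suffices in the ergodic averages: multiplied by \<open>e\<close> it disappears in the error term.\<close>
    have "AE \<omega> in M. \<exists>B. \<forall>n. (\<Sum>i<n. \<phi> ((\<sigma> ^^ i) \<omega>)) \<le> real n * (I + e) + B"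
      unfolding I_def using \<phi>b e
      by (intro birkhoff_upper_bound[OF assms(1) \<sigma> assms(3) \<phi>m, of 2]) (auto simp: abs_le_iff intro: order_trans)
    moreover have "AE \<omega> in M. \<exists>B. \<forall>n. (\<Sum>i<n. - \<phi> ((\<sigma> ^^ i) \<omega>)) \<le> real n * ((LINT \<omega>|M. - \<phi> \<omega>) + e) + B"
      using \<phi>b e \<phi>m
      by (intro birkhoff_upper_bound[OF assms(1) \<sigma> assms(3), of "\<lambda>\<omega>. - \<phi> \<omega>" 2]) (auto simp: abs_le_iff intro: order_trans)
    ultimately show "AE \<omega> in M. lam e 1 \<omega> = 0 \<and>
       \<bar>lam e 2 \<omega> + ereal (e * (LINT \<omega>'|M. a \<omega>' + b \<omega>'))\<bar> \<le> ereal (81 * e\<^sup>2 * \<bar>ln e\<bar>) \<and>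
       (\<forall>k\<ge>3. lam e k \<omega> \<le> ereal (- ln 2 + 81 * ln (ln (1 / e)) / ln (1 / e))) \<and>
       lam e 2 \<omega> < lam e 1 \<omega> \<and> lam e 3 \<omega> < lam e 2 \<omega>"
      using AE_space
    proof eventually_elim
      case (elim \<omega>)
      obtain B1 where B1: "\<And>n. (\<Sum>i<n. \<phi> ((\<sigma> ^^ i) \<omega>)) \<le> real n * (I + e) + B1" using elim(1) by blast
      obtain B2 where "\<And>n. (\<Sum>i<n. - \<phi> ((\<sigma> ^^ i) \<omega>)) \<le> real n * ((LINT \<omega>|M. - \<phi> \<omega>) + e) + B2" using elim(2) by blast
      then have B2: "real n * (I - e) - B2 \<le> (\<Sum>i<n. \<phi> ((\<sigma> ^^ i) \<omega>))" for n
        using spec[of "\<lambda>n. (\<Sum>i<n. - \<phi> ((\<sigma> ^^ i) \<omega>)) \<le> real n * ((LINT \<omega>|M. - \<phi> \<omega>) + e) + B2" n]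
        by (simp add: sum_negf I_def algebra_simps)
      define \<alpha> where "\<alpha> i = e * a ((\<sigma> ^^ i) \<omega>)" for i
      define \<beta> where "\<beta> i = e * b ((\<sigma> ^^ i) \<omega>)" for i
      have ab: "\<alpha> i \<in> {0..e}" "\<beta> i \<in> {0..e}" for i
        using funpow_in_space[OF \<sigma>(1) elim(3), of i] assms(5,8) e by (auto simp: \<alpha>_def \<beta>_def mult_left_le)
      have sum: "(\<Sum>i<n. \<alpha> i + \<beta> i) = e * (\<Sum>i<n. \<phi> ((\<sigma> ^^ i) \<omega>))" for n
        by (simp add: \<alpha>_def \<beta>_def \<phi>_def sum_distrib_left distrib_left)
      have sum_upper: "(\<Sum>i<n. \<alpha> i + \<beta> i) \<le> real n * (e * (I + e)) + e * B1" for n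
        using mult_left_mono[OF B1[of n], of e] e by (simp add: sum algebra_simps)
      have sum_lower: "real n * (e * (I - e)) - e * B2 \<le> (\<Sum>i<n. \<alpha> i + \<beta> i)" for n
        using mult_left_mono[OF B2[of n], of e] e by (simp add: sum algebra_simps)
      have lam: "lam e k \<omega> = exponent (transfer_orbit \<alpha> \<beta>) k" for k
        unfolding lam_def \<alpha>_def \<beta>_def by (rule lyapunov_exponent_eq) (simp add: L_def T_def)
      interpret near_one: tent_orbit \<alpha> \<beta> e "1 - 1 / l"
        by unfold_locales (use ab e e8 l2 in auto)
      interpret near_zero: tent_orbit \<alpha> \<beta> e "ln l / l"
        by unfold_locales (use ab e e8 l2 ll in auto)
      have e2l: "e\<^sup>2 \<le> e\<^sup>2 * l" "0 \<le> e\<^sup>2 * l"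
        using mult_left_mono[of 1 l "e\<^sup>2"] l2 by simp_all
      have ex: "2 * e * K = 48 * (e\<^sup>2 * l)" "e * (I - e) = e * I - e\<^sup>2" "e * (I + e) = e * I + e\<^sup>2"
        by (simp_all add: K_def power2_eq_square algebra_simps)
      have first: "lam e 1 \<omega> = 0" unfolding lam by (rule near_one.exponent_1[OF \<theta>1])
      have "lam e 2 \<omega> \<le> ereal (- (e * (I - e)) + 2 * e * K + 2 * e\<^sup>2)"
        unfolding lam by (rule near_one.exponent_2_upper[OF K gap2 sum_lower])
      also have "\<dots> \<le> ereal (- (e * I) + 81 * (e\<^sup>2 * l))"
        unfolding ereal_less_eq ex using e2l by linarith
      finally have up: "lam e 2 \<omega> \<le> ereal (- (e * I) + 81 * (e\<^sup>2 * l))" .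
      have "0 \<le> e * I" "0 \<le> e\<^sup>2" using e I0 by auto
      then have "- (e * (I + e)) - 2 * e * K - 32 * e\<^sup>2 \<le> 0"
        unfolding ex using e2l by linarith
      then have "ereal (- (e * (I + e)) - 2 * e * K - 32 * e\<^sup>2) \<le> lam e 2 \<omega>"
        unfolding lam by (rule near_one.exponent_2_lower[OF K gap2 sum_upper])
      moreover have "ereal (- (e * I) - 81 * (e\<^sup>2 * l)) \<le> ereal (- (e * (I + e)) - 2 * e * K - 32 * e\<^sup>2)"
        unfolding ereal_less_eq ex using e2l by linarith
      ultimately have low: "ereal (- (e * I) - 81 * (e\<^sup>2 * l)) \<le> lam e 2 \<omega>" by (rule order_trans[rotated])
      have third: "lam e k \<omega> \<le> ereal (- ln 2 + 8 * (ln l / l))" if "3 \<le> k" for k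
      proof -
        have "lam e k \<omega> \<le> ereal (ln (contraction e (ln l / l) + 2 * e powr (ln l / l)))"
          unfolding lam by (rule near_zero.exponent_ge_3[OF gap3 that])
        also have "\<dots> \<le> ereal (- ln 2 + 8 * (ln l / l))"
          unfolding l_def using e e8 ll l2 by (simp only: ereal_less_eq, intro ln_contraction_near_zero) (auto simp: l_def)
        finally show ?thesis .
      qed
      have remainder: "lam e k \<omega> \<le> ereal (- ln 2 + 81 * ln (ln (1 / e)) / ln (1 / e))" if "3 \<le> k" for k
      proof -
        have "0 \<le> ln l / l" using ll l2 by simp
        then show ?thesis using order_trans[OF third[OF that]] by (simp add: l_def)
      qed
      obtain v where v: "lam e 2 \<omega> = ereal v" using up low by (cases "lam e 2 \<omega>") auto
      have "\<bar>v + e * I\<bar> \<le> 81 * (e\<^sup>2 * l)" using up low by (simp add: v abs_le_iff)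
      then have second: "\<bar>lam e 2 \<omega> + ereal (e * (LINT \<omega>'|M. a \<omega>' + b \<omega>'))\<bar> \<le> ereal (81 * e\<^sup>2 * \<bar>ln e\<bar>)"
        by (simp add: v abs_ln I_def \<phi>_def mult.assoc)
      have gap1: "lam e 2 \<omega> < lam e 1 \<omega>"
        unfolding first v using up[unfolded v] sep1 by (simp add: zero_ereal_def)
      have gap2': "lam e 3 \<omega> < lam e 2 \<omega>"
      proof -
        have "lam e 3 \<omega> \<le> ereal (- ln 2 + 8 * (ln l / l))" by (rule third) simp
        also have "\<dots> < ereal (- (e * I) - 81 * (e\<^sup>2 * l))" using sep2 by simp
        also have "\<dots> \<le> lam e 2 \<omega>" by (rule low)
        finally show ?thesis .
      qed
      show ?case using first second remainder gap1 gap2' by blast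
    qed
  qed simp
qed

end
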